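(* For all $\theta\in(0,\infty)^V$ and $\eta\in[0,\infty)^V$, $$\int_{\mathcal S}\nu_{\mathcal S}^{W,\theta,\eta}(d\beta)=\int_{\mathcal A}\nu_{\mathcal A}^{W,\theta,\eta}(da)$$ (as elements of $[0,\infty]$). Denote by $F^{W,\theta,\eta}$ this common value. Then $F^{W,\theta,\eta}<\infty$ as soon as for any vertex $i\in V$ there exists a directed path in $\mathcal G$ from $i$ to $i^\star$, or a directed path from $i$ to a vertex $j$ such that $\eta_j>0$.
   Context: $\mathcal G=(V,E)$ is a finite directed graph (not necessarily strongly connected) with an involution $\star:V\to V$, $i\mapsto i^\star$, such that $(i,j)\in E\Rightarrow(j^\star,i^\star)\in E$. $V_0=\{i:i=i^\star\}$ and $V_1$ is a fixed subset with $V=V_0\sqcup V_1\sqcup V_1^\star$; $\tilde V=V_0\cup V_1$. $(W_{i,j})_{(i,j)\in E}$ are positive weights with $W_{i,j}=W_{j^\star,i^\star}$, extended to a $V\times V$ matrix $W$ by $W_{i,j}=0$ if $(i,j)\notin E$. For $x\in\mathbb R^V$, $x^\star=(x_{i^\star})_{i\in V}$. $\mathcal S=\{s\in\mathbb R^V:s^\star=s\}$, $\mathcal A=\{a\in\mathbb R^V:a^\star=-a\}$, $\langle x,y\rangle=\sum_{i\in V}x_{i^\star}y_i$. For $\beta\in\mathcal S$, $H_\beta=\beta-W$, where $\beta$ acts as the diagonal multiplication operator; $H_\beta>0$ means that all eigenvalues of $H_\beta$ have positive real part; then $G_\beta=H_\beta^{-1}$; $|H_\beta|=\det H_\beta$.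 Measure on $\mathcal S$: $$\nu_{\mathcal S}^{W,\theta,\eta}(d\beta)=\Big(\prod_{i\in V_0}\theta_i\Big)\frac{\mathbf 1_{H_\beta>0}}{\sqrt{2\pi}^{\dim\mathcal S}}\exp\Big(-\tfrac12\langle\theta,H_\beta\theta\rangle-\tfrac12\langle\eta,G_\beta\eta\rangle+\langle\theta,\eta\rangle\Big)\frac{d\beta}{\sqrt{|H_\beta|}},\quad d\beta=\prod_{i\in\tilde V}d\beta_i.$$ Measure on $\mathcal A$: $$\nu_{\mathcal A}^{W,\theta,\eta}(da)=\frac1{\sqrt{2\pi}^{\dim\mathcal A}}\exp\Big(-\tfrac12\langle e^{a^\star}\theta,We^{a^\star}\theta\rangle+\tfrac12\langle\theta,W\theta\rangle-\langle\eta,e^{a^\star}\theta-\theta\rangle\Big)da,\quad da=\prod_{i\in V_1}da_i,$$ where $e^{a^\star}\theta=(e^{a_{i^\star}}\theta_i)_{i\in V}$. If $V_1=\emptyset$, then $\mathcal A=\{0\}$ and $\nu_{\mathcal A}^{W,\theta,\eta}=1$ (unit mass). *)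

theory Defs
  imports "HOL-Analysis.Analysis"
begin

text \<open>
  The vertex set is the finite type \<open>'n\<close>; the edge set is a relation on it, and \<open>star\<close> is the
  involution. Directed paths are rendered by \<open>E\<^sup>*\<close>, so the path of length 0 is a path.
\<close>

definition fixed_pts :: "('n \<Rightarrow> 'n) \<Rightarrow> 'n set" where
  "fixed_pts star = {i. star i = i}"

definition symm_space :: "('n::finite \<Rightarrow> 'n) \<Rightarrow> (real^'n) set" where
  "symm_space star = {s. (\<chi> i. s $ star i) = s}"

definition anti_space :: "('n::finite \<Rightarrow> 'n) \<Rightarrow> (real^'n) set" where
  "anti_space star = {a. (\<chi> i. a $ star i) = - a}"

definition star_inner :: "('n::finite \<Rightarrow> 'n) \<Rightarrow> real^'n \<Rightarrow> real^'n \<Rightarrow> real" where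
  "star_inner star x y = (\<Sum>i\<in>UNIV. x $ star i * y $ i)"

definition H_mat :: "real^'n^'n \<Rightarrow> real^'n \<Rightarrow> real^'n::finite^'n" where
  "H_mat W \<beta> = (\<chi> i j. (if i = j then \<beta> $ i else 0) - W $ i $ j)"

definition eigenvalue_of :: "real^'n::finite^'n \<Rightarrow> complex \<Rightarrow> bool" where
  "eigenvalue_of A z \<longleftrightarrow>
     (\<exists>v::complex^'n. v \<noteq> 0 \<and> map_matrix complex_of_real A *v v = z *s v)"

definition pos_mat :: "real^'n::finite^'n \<Rightarrow> bool" where
  "pos_mat A \<longleftrightarrow> (\<forall>z. eigenvalue_of A z \<longrightarrow> Re z > 0)"

text \<open>
  A vector of the symmetric space is determined by its coordinates in \<open>V\<^sub>0 \<union> V\<^sub>1\<close>, one of the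
  antisymmetric space by its coordinates in \<open>V\<^sub>1\<close>. The reference measures are the images of the
  product Lebesgue measures under the corresponding parametrisations; if \<open>V\<^sub>1 = {}\<close>, the
  reference measure on the antisymmetric space is the unit mass at 0.
\<close>

definition symm_emb :: "('n::finite \<Rightarrow> 'n) \<Rightarrow> 'n set \<Rightarrow> ('n \<Rightarrow> real) \<Rightarrow> real^'n" where
  "symm_emb star V1 b = (\<chi> i. if i \<in> fixed_pts star \<union> V1 then b i else b (star i))"

definition anti_emb :: "('n::finite \<Rightarrow> 'n) \<Rightarrow> 'n set \<Rightarrow> ('n \<Rightarrow> real) \<Rightarrow> real^'n" where
  "anti_emb star V1 b =
     (\<chi> i. if i \<in> fixed_pts star then 0 else if i \<in> V1 then b i else - b (star i))"

definition symm_lebesgue :: "('n::finite \<Rightarrow> 'n) \<Rightarrow> 'n set \<Rightarrow> (real^'n) measure" where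
  "symm_lebesgue star V1 =
     distr (\<Pi>\<^sub>M i\<in>fixed_pts star \<union> V1. lborel) (restrict_space borel (symm_space star))
       (symm_emb star V1)"

definition anti_lebesgue :: "('n::finite \<Rightarrow> 'n) \<Rightarrow> 'n set \<Rightarrow> (real^'n) measure" where
  "anti_lebesgue star V1 =
     distr (\<Pi>\<^sub>M i\<in>V1. lborel) (restrict_space borel (anti_space star)) (anti_emb star V1)"

definition nu_S ::
  "('n::finite \<Rightarrow> 'n) \<Rightarrow> 'n set \<Rightarrow> real^'n^'n \<Rightarrow> real^'n \<Rightarrow> real^'n \<Rightarrow> (real^'n) measure" where
  "nu_S star V1 W \<theta> \<eta> = density (symm_lebesgue star V1) (\<lambda>\<beta>. ennreal
     ((\<Prod>i\<in>fixed_pts star. \<theta> $ i)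
      * (if pos_mat (H_mat W \<beta>) then 1 else 0) / sqrt (2 * pi) ^ dim (symm_space star)
      * exp (- (1/2) * star_inner star \<theta> (H_mat W \<beta> *v \<theta>)
             - (1/2) * star_inner star \<eta> (matrix_inv (H_mat W \<beta>) *v \<eta>)
             + star_inner star \<theta> \<eta>)
      / sqrt (det (H_mat W \<beta>))))"

text \<open>The vector \<open>e\<^bsup>a\<star>\<^esup>\<theta>\<close>.\<close>

definition exp_star :: "('n::finite \<Rightarrow> 'n) \<Rightarrow> real^'n \<Rightarrow> real^'n \<Rightarrow> real^'n" where
  "exp_star star a \<theta> = (\<chi> i. exp (a $ star i) * \<theta> $ i)"

definition nu_A ::
  "('n::finite \<Rightarrow> 'n) \<Rightarrow> 'n set \<Rightarrow> real^'n^'n \<Rightarrow> real^'n \<Rightarrow> real^'n \<Rightarrow> (real^'n) measure" where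
  "nu_A star V1 W \<theta> \<eta> = density (anti_lebesgue star V1) (\<lambda>a. ennreal
     (1 / sqrt (2 * pi) ^ dim (anti_space star)
      * exp (- (1/2) * star_inner star (exp_star star a \<theta>) (W *v exp_star star a \<theta>)
             + (1/2) * star_inner star \<theta> (W *v \<theta>)
             - star_inner star \<eta> (exp_star star a \<theta> - \<theta>))))"

end

theory Submission
  imports Defs "HOL-Probability.Distributions"
begin

text \<open>
  The equality of the two masses is proved by eliminating the orbits \<open>{i, i\<^sup>\<star>}\<close> one after the other.
  The factors that depend only on \<open>W\<close>, \<open>\<theta>\<close> and \<open>\<eta>\<close> agree on both sides; once they are divided out,
  the symmetric side carries the exponent \<open>-\<langle>\<theta>,\<beta>\<theta>\<rangle>/2 - \<langle>\<eta>,G\<^sub>\<beta>\<eta>\<rangle>/2\<close> with the weight \<open>1/sqrt (det H\<^sub>\<beta>)\<close>, and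
  the antisymmetric side the exponent \<open>-\<langle>x,Wx\<rangle>/2 - \<langle>\<eta>,x\<rangle>\<close>, where \<open>x\<close> is the vector \<open>\<theta>\<close> multiplied
  coordinatewise by exponentials.

  Write the vertex set as one orbit \<open>U\<close> and the remaining vertices. On the symmetric side
  positivity, determinant and the form of the inverse split along a Schur complement
  (\<open>m_matrix_schur\<close>, \<open>det_schur\<close>, \<open>quad_schur\<close>): for a given coordinate of \<open>\<beta>\<close> at \<open>U\<close>, the density in
  the other coordinates is that of the same model with effective weights
  \<open>W + W\<^sub>\<bullet>\<^sub>U G\<^sub>U W\<^sub>U\<^sub>\<bullet>\<close> and effective field \<open>\<eta> + W\<^sub>\<bullet>\<^sub>U G\<^sub>U \<eta>\<^sub>U\<close>. By induction their integral is an integral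
  over antisymmetric vectors on the remaining vertices. In that integral the terms
  with \<open>G\<^sub>U\<close> form a complete square (\<open>complete_square\<close>): for a fixed vector \<open>x\<close> on the
  remaining vertices they amount to replacing \<open>\<eta>\<^sub>U\<close> by \<open>\<eta>\<^sub>U + W\<^sub>U\<^sub>\<bullet> x\<close> in the model that lives on \<open>U\<close>
  alone. After an exchange of the integrals only the identity for a single orbit remains.

  For a fixed vertex that identity is the normalisation of the inverse Gaussian law. For a pair
  without field it is the substitution \<open>h = r cosh s\<close> in the integral that represents the Bessel
  function \<open>K\<^sub>0\<close>. A pair with a field reduces to both: with an auxiliary variable \<open>t\<close> the factor
  \<open>exp (-\<langle>\<eta>,G\<eta>\<rangle>/2)\<close> becomes an inverse Gaussian integral, as if the field came from one more fixed
  vertex; for fixed \<open>t\<close> the pair has no field but shifted weights, and afterwards \<open>t\<close> is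
  integrated out (\<open>pair_integral\<close>).

  Finiteness is read off the antisymmetric side. Each edge \<open>(k, l)\<close> puts a multiple of
  \<open>exp (a\<^sub>k - a\<^sub>l)\<close> into minus the exponent, each vertex with \<open>\<eta>\<^sub>k > 0\<close> a multiple of \<open>exp a\<^sub>k\<close>. Telescoping along
  a path from \<open>i\<close> to \<open>i\<^sup>\<star>\<close>, where \<open>a\<close> changes sign, or to a vertex with a field, bounds every \<open>a\<^sub>i\<close> by a
  multiple of minus the exponent; since this holds at \<open>i\<^sup>\<star>\<close> too, it bounds \<open>|a\<^sub>i|\<close>, and the density decays
  exponentially (\<open>action_controls\<close>).
\<close>

section \<open>M-matrices and their solutions\<close>

text \<open>
  The matrix \<open>H\<^sub>\<beta>\<close> compressed to \<open>U\<close>, completed by the identity outside \<open>U\<close>. Determinant and inverse are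
  those of the \<open>U \<times> U\<close> submatrix, but the type of the matrix does not change with \<open>U\<close>, so that
  an induction over sets of vertices is possible.
\<close>

definition block :: "'n set \<Rightarrow> ('n \<Rightarrow> 'n \<Rightarrow> real) \<Rightarrow> ('n \<Rightarrow> real) \<Rightarrow> real^'n::finite^'n" where
  "block U W b = (\<chi> i j. if i \<in> U \<and> j \<in> U then (if i = j then b i else 0) - W i j
                         else if i = j then 1 else 0)"

definition row_apply :: "'n set \<Rightarrow> ('n \<Rightarrow> 'n \<Rightarrow> real) \<Rightarrow> ('n \<Rightarrow> real) \<Rightarrow> ('n::finite \<Rightarrow> real) \<Rightarrow> 'n \<Rightarrow> real" where
  "row_apply U W b x i = b i * x i - (\<Sum>j\<in>U. W i j * x j)"

text \<open>
  The characterisation of nonsingular M-matrices by a strictly positive vector with strictly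
  positive image. For the full vertex set and nonnegative \<open>W\<close> it is equivalent to the spectral
  condition \<open>pos_mat\<close> (\<open>pos_mat_block_iff\<close>), and unlike the latter it is easily followed through
  Schur complements.
\<close>

definition m_matrix :: "'n set \<Rightarrow> ('n \<Rightarrow> 'n \<Rightarrow> real) \<Rightarrow> ('n::finite \<Rightarrow> real) \<Rightarrow> bool" where
  "m_matrix U W b \<longleftrightarrow> (\<exists>x. (\<forall>i. x i > 0) \<and> (\<forall>i\<in>U. row_apply U W b x i > 0))"

text \<open>
  Cramer's formula for the solution of the linear system on \<open>U\<close>. An explicit formula makes the
  measurability in \<open>b\<close> evident.
\<close>

definition sol :: "'n set \<Rightarrow> ('n \<Rightarrow> 'n \<Rightarrow> real) \<Rightarrow> ('n \<Rightarrow> real) \<Rightarrow> ('n::finite \<Rightarrow> real) \<Rightarrow> 'n \<Rightarrow> real" where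
  "sol U W b y k =
     det (\<chi> i j. if j = k then (if i \<in> U then y i else 0) else block U W b $ i $ j) / det (block U W b)"

lemma row_apply_diff: "row_apply U W b (\<lambda>i. x i - y i) i = row_apply U W b x i - row_apply U W b y i"
  by (simp add: row_apply_def algebra_simps sum_subtractf)

lemma row_apply_add: "row_apply U W b (\<lambda>i. x i + y i) i = row_apply U W b x i + row_apply U W b y i"
  by (simp add: row_apply_def algebra_simps sum.distrib)

lemma row_apply_scale: "row_apply U W b (\<lambda>i. c * x i) i = c * row_apply U W b x i"
  by (simp add: row_apply_def algebra_simps sum_distrib_left)

lemma row_apply_cong: "(\<And>j. j \<in> U \<Longrightarrow> x j = y j) \<Longrightarrow> i \<in> U \<Longrightarrow> row_apply U W b x i = row_apply U W b y i"
  by (simp add: row_apply_def)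

lemma block_mult_vec:
  "(block U W b *v v) $ i = (if i \<in> U then row_apply U W b (\<lambda>j. v $ j) i else v $ i)"
proof (cases "i \<in> U")
  case True
  have "(block U W b *v v) $ i = (\<Sum>j\<in>UNIV. if j \<in> U then ((if i = j then b i else 0) - W i j) * v $ j else 0)"
    using True by (auto simp: matrix_vector_mult_def block_def intro!: sum.cong)
  also have "\<dots> = (\<Sum>j\<in>U. ((if i = j then b i else 0) - W i j) * v $ j)"
    by (simp add: sum.If_cases)
  also have "\<dots> = (\<Sum>j\<in>U. (if i = j then b i * v $ j else 0) - W i j * v $ j)"
    by (intro sum.cong) (auto simp: algebra_simps)
  also have "\<dots> = row_apply U W b (\<lambda>j. v $ j) i"
    using True by (simp add: sum_subtractf row_apply_def)
  finally show ?thesis using True by simp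
next
  case False
  then show ?thesis
    by (simp add: matrix_vector_mult_def block_def if_distrib[of "\<lambda>c. c * _"] cong: if_cong)
qed

text \<open>
  A minimum principle. Let \<open>y\<close> be a positive vector with positive image. If the minimum \<open>m\<close> of \<open>z/y\<close>
  were negative, then \<open>z - m y\<close> would be nonnegative and vanish where the minimum is attained,
  so that the row there, whose off-diagonal entries are nonpositive, would give a nonpositive
  value; but the value is that of \<open>z\<close> plus a positive multiple of that of \<open>y\<close>.
\<close>

lemma inverse_positive:
  assumes W: "\<forall>i j. W i j \<ge> 0" and pos: "m_matrix U W b"
    and z: "\<And>i. i \<in> U \<Longrightarrow> row_apply U W b z i \<ge> 0" and i: "i \<in> U"
  shows "z i \<ge> 0"
proof (rule ccontr)
  assume neg: "\<not> z i \<ge> 0"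
  obtain y where y: "\<And>i. y i > 0" "\<And>i. i \<in> U \<Longrightarrow> row_apply U W b y i > 0"
    using pos unfolding m_matrix_def by blast
  define m where "m = Min ((\<lambda>i. z i / y i) ` U)"
  have "m \<in> (\<lambda>i. z i / y i) ` U"
    unfolding m_def using i by (intro Min_in) auto
  then obtain k where k: "k \<in> U" "m = z k / y k" by auto
  have le: "m \<le> z j / y j" if "j \<in> U" for j
    unfolding m_def using that by (intro Min_le) auto
  have "m < 0" using le[OF i] neg y(1)[of i] by (smt (verit) divide_neg_pos)
  have ge: "z j - m * y j \<ge> 0" if "j \<in> U" for j
    using le[OF that] y(1)[of j] by (simp add: field_simps)
  have zk: "z k = m * y k" using k(2) y(1)[of k] by (simp add: field_simps)
  have "row_apply U W b (\<lambda>i. z i - m * y i) k \<le> 0"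
    unfolding row_apply_def using zk ge W by (auto intro!: sum_nonneg)
  moreover have "row_apply U W b (\<lambda>i. z i - m * y i) k = row_apply U W b z k - m * row_apply U W b y k"
    by (simp add: row_apply_diff row_apply_scale)
  moreover have "m * row_apply U W b y k < 0"
    using \<open>m < 0\<close> y(2)[OF k(1)] by (rule mult_neg_pos)
  ultimately show False using z[OF k(1)] by linarith
qed

text \<open>
  The minimum principle applies to a kernel vector and to its negative.
\<close>

lemma m_matrix_det_nonzero:
  assumes W: "\<forall>i j. W i j \<ge> 0" and pos: "m_matrix U W b"
  shows "det (block U W b) \<noteq> 0"
proof -
  have "v = 0" if v: "block U W b *v v = 0" for v
  proof -
    have v': "row_apply U W b (\<lambda>j. v $ j) i = 0" if "i \<in> U" for i
      using arg_cong[OF v, of "\<lambda>v. v $ i"] that by (simp add: block_mult_vec)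
    have "v $ i = 0" for i
    proof (cases "i \<in> U")
      case True
      have "v $ i \<ge> 0" using inverse_positive[OF W pos, of "\<lambda>j. v $ j" i] v' True by simp
      moreover have "- v $ i \<ge> 0"
        using inverse_positive[OF W pos, of "\<lambda>j. (-1) * v $ j" i] v' True
        unfolding row_apply_scale by simp
      ultimately show ?thesis by simp
    next
      case False
      then show ?thesis
        using arg_cong[OF v, of "\<lambda>v. v $ i"] by (simp add: block_mult_vec)
    qed
    then show ?thesis by (simp add: vec_eq_iff)
  qed
  then have "\<exists>B. B ** block U W b = mat 1"
    using matrix_left_invertible_ker by blast
  then show ?thesis
    by (simp add: invertible_det_nz[symmetric] invertible_left_inverse)
qed

lemma block_sol_iff:
  assumes "det (block U W b) \<noteq> 0"
  shows "block U W b *v v = (\<chi> i. if i \<in> U then y i else 0) \<longleftrightarrow> v = (\<chi> k. sol U W b y k)"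
  unfolding sol_def using cramer[OF assms, of v "\<chi> i. if i \<in> U then y i else 0"] by (simp cong: if_cong)

lemma sol_solves:
  assumes "det (block U W b) \<noteq> 0" "i \<in> U"
  shows "row_apply U W b (sol U W b y) i = y i"
proof -
  have "(block U W b *v (\<chi> k. sol U W b y k)) $ i = (if i \<in> U then y i else 0)"
    using block_sol_iff[OF assms(1), of "\<chi> k. sol U W b y k" y] by (auto simp: vec_eq_iff)
  then show ?thesis using assms(2) by (simp add: block_mult_vec row_apply_def)
qed

lemma sol_unique:
  assumes d: "det (block U W b) \<noteq> 0" and x: "\<And>i. i \<in> U \<Longrightarrow> row_apply U W b x i = y i" and i: "i \<in> U"
  shows "sol U W b y i = x i"
proof -
  have "block U W b *v (\<chi> i. if i \<in> U then x i else 0) = (\<chi> i. if i \<in> U then y i else 0)"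
    using x by (simp add: vec_eq_iff block_mult_vec row_apply_def)
  then have "(\<chi> i. if i \<in> U then x i else 0) = (\<chi> k. sol U W b y k)"
    using block_sol_iff[OF d] by blast
  then show ?thesis using i by (simp add: vec_eq_iff) (metis (full_types))
qed

lemma sol_nonneg:
  assumes W: "\<forall>i j. W i j \<ge> 0" and pos: "m_matrix U W b" and y: "\<And>i. i \<in> U \<Longrightarrow> y i \<ge> 0" and i: "i \<in> U"
  shows "sol U W b y i \<ge> 0"
  using inverse_positive[OF W pos _ i, of "sol U W b y"] sol_solves[OF m_matrix_det_nonzero[OF W pos]] y
  by simp

lemma pos_of_row_apply_pos:
  assumes W: "\<forall>i j. W i j \<ge> 0" and x: "\<And>i. i \<in> U \<Longrightarrow> x i \<ge> 0"
    and row_apply: "\<And>i. i \<in> U \<Longrightarrow> row_apply U W b x i > 0" and i: "i \<in> U"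
  shows "x i > 0"
proof (rule ccontr)
  assume "\<not> x i > 0"
  then have "x i = 0" using x[OF i] by simp
  then have "row_apply U W b x i \<le> 0"
    unfolding row_apply_def using W x by (auto intro!: sum_nonneg)
  then show False using row_apply[OF i] by simp
qed

lemma m_matrixI:
  assumes "\<And>i. i \<in> U \<Longrightarrow> x i > 0" "\<And>i. i \<in> U \<Longrightarrow> row_apply U W b x i > 0"
  shows "m_matrix U W b"
  unfolding m_matrix_def
proof (intro exI conjI allI ballI)
  show "(if i \<in> U then x i else 1) > 0" for i using assms(1) by auto
  show "row_apply U W b (\<lambda>i. if i \<in> U then x i else 1) i > 0" if "i \<in> U" for i
    using assms(2)[OF that] that by (simp add: row_apply_def)
qed

text \<open>
  The solution for the constant right-hand side 1 is a canonical witness. This turns the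
  existential quantifier into finitely many inequalities between determinants, hence into a
  measurable condition on \<open>b\<close>.
\<close>

lemma m_matrix_iff_sol:
  assumes W: "\<forall>i j. W i j \<ge> 0"
  shows "m_matrix U W b \<longleftrightarrow> det (block U W b) \<noteq> 0 \<and> (\<forall>k\<in>U. sol U W b (\<lambda>_. 1) k > 0)"
proof
  assume pos: "m_matrix U W b"
  note d = m_matrix_det_nonzero[OF W pos]
  have "sol U W b (\<lambda>_. 1) k > 0" if "k \<in> U" for k
    by (rule pos_of_row_apply_pos[where W = W and b = b and U = U])
       (auto simp: sol_solves[OF d] W that intro: sol_nonneg[OF W pos])
  then show "det (block U W b) \<noteq> 0 \<and> (\<forall>k\<in>U. sol U W b (\<lambda>_. 1) k > 0)"
    using d by blast
next
  assume "det (block U W b) \<noteq> 0 \<and> (\<forall>k\<in>U. sol U W b (\<lambda>_. 1) k > 0)"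
  then show "m_matrix U W b"
    by (intro m_matrixI[where x = "sol U W b (\<lambda>_. 1)"]) (auto simp: sol_solves)
qed

text \<open>
  Gershgorin's argument in the weighted maximum norm: at an index \<open>k\<close> that maximises \<open>|v\<^sub>k|/x\<^sub>k\<close>
  an eigenvalue \<open>z\<close> satisfies \<open>|b\<^sub>k - z| < b\<^sub>k\<close>.
\<close>

lemma m_matrix_imp_pos_mat:
  assumes W: "\<forall>i j. W i j \<ge> 0" and pos: "m_matrix UNIV W b"
  shows "pos_mat (block UNIV W b)"
  unfolding pos_mat_def
proof (intro allI impI)
  fix z assume "eigenvalue_of (block UNIV W b) z"
  then obtain v :: "complex^'a" where v: "v \<noteq> 0"
    and ev: "map_matrix complex_of_real (block UNIV W b) *v v = z *s v"
    unfolding eigenvalue_of_def by blast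
  obtain x where x: "\<And>i. x i > 0" "\<And>i. row_apply UNIV W b x i > 0"
    using pos unfolding m_matrix_def by auto
  define m where "m = Max (range (\<lambda>i. norm (v $ i) / x i))"
  have "m \<in> range (\<lambda>i. norm (v $ i) / x i)"
    unfolding m_def by (intro Max_in) auto
  then obtain k where k: "m = norm (v $ k) / x k" by auto
  have le: "norm (v $ j) / x j \<le> m" for j
    unfolding m_def by (intro Max_ge) auto
  have le': "norm (v $ j) \<le> m * x j" for j
    using le[of j] x(1)[of j] by (simp add: field_simps)
  obtain j where "v $ j \<noteq> 0" using v by (auto simp: vec_eq_iff)
  then have "m > 0" using le[of j] x(1)[of j] by (smt (verit) divide_pos_pos zero_less_norm_iff)
  have vk: "norm (v $ k) = m * x k" using k x(1)[of k] by (simp add: field_simps)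
  have "(map_matrix complex_of_real (block UNIV W b) *v v) $ k = z * v $ k"
    using ev by simp
  then have "(\<Sum>j\<in>UNIV. complex_of_real ((if k = j then b k else 0) - W k j) * v $ j) = z * v $ k"
    by (simp add: matrix_vector_mult_def map_matrix_def block_def)
  moreover have "(\<Sum>j\<in>UNIV. complex_of_real ((if k = j then b k else 0) - W k j) * v $ j)
     = (\<Sum>j\<in>UNIV. (if k = j then complex_of_real (b k) * v $ j else 0) - of_real (W k j) * v $ j)"
    by (intro sum.cong) (auto simp: algebra_simps)
  ultimately have "complex_of_real (b k) * v $ k - (\<Sum>j\<in>UNIV. of_real (W k j) * v $ j) = z * v $ k"
    by (simp add: sum_subtractf)
  then have "(complex_of_real (b k) - z) * v $ k = (\<Sum>j\<in>UNIV. of_real (W k j) * v $ j)"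
    by (simp add: algebra_simps)
  then have "norm (complex_of_real (b k) - z) * norm (v $ k) = norm (\<Sum>j\<in>UNIV. of_real (W k j) * v $ j)"
    by (metis norm_mult)
  also have "\<dots> \<le> (\<Sum>j\<in>UNIV. W k j * (m * x j))"
    using W le' by (intro sum_norm_le) (auto simp: norm_mult intro!: mult_mono)
  also have "\<dots> = m * (\<Sum>j\<in>UNIV. W k j * x j)"
    by (simp add: sum_distrib_left algebra_simps)
  also have "\<dots> < m * (b k * x k)"
    using x(2)[of k] \<open>m > 0\<close> by (simp add: row_apply_def)
  finally have "norm (complex_of_real (b k) - z) * (m * x k) < b k * (m * x k)"
    unfolding vk by (simp add: algebra_simps)
  then have "norm (complex_of_real (b k) - z) < b k"
    using \<open>m > 0\<close> x(1)[of k] by simp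
  then show "Re z > 0"
    using abs_Re_le_cmod[of "complex_of_real (b k) - z"] by simp
qed

text \<open>
  Raise the diagonal by \<open>t\<close>. For large \<open>t\<close> the constant vector shows that the matrix is an
  M-matrix. Suppose that some \<open>t \<ge> 0\<close> fails and let \<open>t0\<close> be the supremum of the failing values. At
  \<open>t0\<close> the matrix is still invertible, because \<open>-t0\<close> is not an eigenvalue of the original matrix. The
  solution \<open>x\<close> for the right-hand side 1 at \<open>t0\<close> has a nonnegative image also at slightly larger
  values, so the minimum principle there gives \<open>x \<ge> 0\<close>, and then \<open>x > 0\<close>. Thus \<open>x\<close> is a witness at
  \<open>t0\<close> and at slightly smaller values, which contradicts the choice of \<open>t0\<close>.
\<close>

lemma pos_mat_imp_m_matrix:
  assumes W: "\<forall>i j. W i j \<ge> 0" and pos: "pos_mat (block UNIV W b)"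
  shows "m_matrix UNIV W b"
proof (rule ccontr)
  assume neg: "\<not> m_matrix UNIV W b"
  define bad where "bad = {t. t \<ge> 0 \<and> \<not> m_matrix UNIV W (\<lambda>i. b i + t)}"
  have row_apply_shift: "row_apply UNIV W (\<lambda>i. b i + t) x i = row_apply UNIV W b x i + t * x i" for t x i
    by (simp add: row_apply_def algebra_simps)
  have "0 \<in> bad" using neg by (simp add: bad_def)
  have bdd: "bdd_above bad"
  proof (rule bdd_aboveI)
    fix t assume t: "t \<in> bad"
    show "t \<le> (\<Sum>i\<in>UNIV. \<bar>row_apply UNIV W b (\<lambda>_. 1) i\<bar>)"
    proof (rule ccontr)
      assume less: "\<not> ?thesis"
      have "\<bar>row_apply UNIV W b (\<lambda>_. 1) i\<bar> \<le> (\<Sum>i\<in>UNIV. \<bar>row_apply UNIV W b (\<lambda>_. 1) i\<bar>)" for i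
        by (rule member_le_sum) auto
      then have "row_apply UNIV W b (\<lambda>_. 1) i + t > 0" for i
        using less by (smt (verit))
      then have "m_matrix UNIV W (\<lambda>i. b i + t)"
        by (intro m_matrixI[where x = "\<lambda>_. 1"]) (auto simp: row_apply_shift)
      then show False using t by (simp add: bad_def)
    qed
  qed
  define t0 where "t0 = Sup bad"
  have "t0 \<ge> 0" unfolding t0_def using \<open>0 \<in> bad\<close> bdd by (rule cSup_upper)
  have above: "m_matrix UNIV W (\<lambda>i. b i + t)" if "t > t0" for t
    using that \<open>t0 \<ge> 0\<close> cSup_upper[OF _ bdd, of t] unfolding t0_def bad_def by fastforce
  have ker: "v = 0" if v: "block UNIV W (\<lambda>i. b i + t0) *v v = 0" for v
  proof (rule ccontr)
    assume "v \<noteq> 0"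
    have eq: "row_apply UNIV W b (\<lambda>j. v $ j) i = - t0 * v $ i" for i
      using arg_cong[OF v, of "\<lambda>v. v $ i"] by (simp add: block_mult_vec row_apply_shift)
    have "map_matrix complex_of_real (block UNIV W b) *v (\<chi> i. of_real (v $ i))
         = complex_of_real (- t0) *s (\<chi> i. of_real (v $ i))"
    proof -
      have "(\<Sum>j\<in>UNIV. block UNIV W b $ i $ j * v $ j) = - t0 * v $ i" for i
        using eq[of i] block_mult_vec[of UNIV W b v i] by (simp add: matrix_vector_mult_def)
      then have "complex_of_real (\<Sum>j\<in>UNIV. block UNIV W b $ i $ j * v $ j) = of_real (- t0 * v $ i)" for i
        by simp
      then show ?thesis
        by (simp add: vec_eq_iff matrix_vector_mult_def map_matrix_def)
    qed
    moreover have "(\<chi> i. complex_of_real (v $ i)) \<noteq> 0"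
      using \<open>v \<noteq> 0\<close> by (auto simp: vec_eq_iff)
    ultimately have "eigenvalue_of (block UNIV W b) (of_real (- t0))"
      unfolding eigenvalue_of_def by blast
    then show False using pos \<open>t0 \<ge> 0\<close> unfolding pos_mat_def by fastforce
  qed
  have d: "det (block UNIV W (\<lambda>i. b i + t0)) \<noteq> 0"
    using ker matrix_left_invertible_ker[of "block UNIV W (\<lambda>i. b i + t0)"]
    by (simp add: invertible_det_nz[symmetric] invertible_left_inverse)
  define x where "x = sol UNIV W (\<lambda>i. b i + t0) (\<lambda>_. 1)"
  have x1: "row_apply UNIV W (\<lambda>i. b i + t0) x i = 1" for i
    unfolding x_def using d by (intro sol_solves) auto
  \<comment> \<open>small enough to keep \<open>1 + e x\<^sub>i\<close> and \<open>1 - e x\<^sub>i\<close> nonnegative\<close>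
  define e where "e = 1 / (1 + (\<Sum>i\<in>UNIV. \<bar>x i\<bar>))"
  have S: "(\<Sum>i\<in>UNIV. \<bar>x i\<bar>) \<ge> 0" by (intro sum_nonneg) auto
  have "e > 0" unfolding e_def using S by (intro divide_pos_pos) linarith+
  have ex: "1 + e * x i \<ge> 0" for i
  proof -
    have "\<bar>x i\<bar> \<le> (\<Sum>i\<in>UNIV. \<bar>x i\<bar>)" by (rule member_le_sum) auto
    then have "\<bar>e * x i\<bar> \<le> 1" unfolding e_def abs_mult using S by (simp add: field_simps)
    then show ?thesis by linarith
  qed
  have "m_matrix UNIV W (\<lambda>i. b i + (t0 + e))" using above[of "t0 + e"] \<open>e > 0\<close> by simp
  moreover have "row_apply UNIV W (\<lambda>i. b i + (t0 + e)) x i = 1 + e * x i" for i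
    using x1[of i] unfolding row_apply_shift by (simp add: algebra_simps)
  ultimately have "x i \<ge> 0" for i
    using inverse_positive[OF W, of UNIV "\<lambda>i. b i + (t0 + e)" x i] ex by simp
  then have "x i > 0" for i
    using pos_of_row_apply_pos[OF W, of UNIV x "\<lambda>i. b i + t0" i] x1 by simp
  then have t0ok: "m_matrix UNIV W (\<lambda>i. b i + t0)"
    by (intro m_matrixI[where x = x]) (auto simp: x1)
  have "t0 \<in> bad"
  proof (rule ccontr)
    have e1: "m_matrix UNIV W (\<lambda>i. b i + t)" if t: "t > t0 - e" for t
    proof (rule m_matrixI[where x = x])
      show "x i > 0" for i by fact
      have "row_apply UNIV W (\<lambda>i. b i + t) x i = 1 + (t - t0) * x i" for i
        using x1[of i] unfolding row_apply_shift by (simp add: algebra_simps)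
      moreover have "1 + (t - t0) * x i > 0" for i
      proof -
        have "\<bar>x i\<bar> \<le> (\<Sum>i\<in>UNIV. \<bar>x i\<bar>)" by (rule member_le_sum) auto
        then have "e * x i \<le> 1" unfolding e_def using S \<open>x i > 0\<close> by (simp add: field_simps)
        moreover have "(t - t0) * x i > - e * x i" using t \<open>x i > 0\<close> by (intro mult_strict_right_mono) auto
        ultimately show ?thesis by linarith
      qed
      ultimately show "row_apply UNIV W (\<lambda>i. b i + t) x i > 0" for i by simp
    qed
    have "t \<le> t0 - e" if "t \<in> bad" for t using e1[of t] that by (force simp: bad_def)
    then have "t0 \<le> t0 - e" unfolding t0_def using \<open>0 \<in> bad\<close> by (intro cSup_least) auto
    then show False using \<open>e > 0\<close> by simp
  qed
  then show False using t0ok by (simp add: bad_def)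
qed

lemma pos_mat_block_iff:
  assumes "\<forall>i j. W i j \<ge> 0"
  shows "pos_mat (block UNIV W b) \<longleftrightarrow> m_matrix UNIV W b"
  using m_matrix_imp_pos_mat[OF assms] pos_mat_imp_m_matrix[OF assms] by blast

section \<open>Schur complements\<close>

text \<open>
  The effective weights after the vertices of \<open>U\<close> have been eliminated: \<open>b - schur_W U W b\<close> is the
  Schur complement of the block \<open>U\<close>.
\<close>

definition schur_W :: "'n set \<Rightarrow> ('n \<Rightarrow> 'n \<Rightarrow> real) \<Rightarrow> ('n::finite \<Rightarrow> real) \<Rightarrow> 'n \<Rightarrow> 'n \<Rightarrow> real" where
  "schur_W U W b k l = W k l + (\<Sum>p\<in>U. W k p * sol U W b (\<lambda>q. W q l) p)"

text \<open>
  The right-hand side that the elimination of \<open>U\<close> leaves on the other vertices.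
\<close>

definition schur_v :: "'n set \<Rightarrow> ('n \<Rightarrow> 'n \<Rightarrow> real) \<Rightarrow> ('n::finite \<Rightarrow> real) \<Rightarrow> ('n \<Rightarrow> real) \<Rightarrow> 'n \<Rightarrow> real" where
  "schur_v U W b y k = y k + (\<Sum>p\<in>U. W k p * sol U W b y p)"

lemma row_apply_sum: "row_apply U W b (\<lambda>i. \<Sum>l\<in>L. f l i) i = (\<Sum>l\<in>L. row_apply U W b (f l) i)"
proof -
  have "(\<Sum>j\<in>U. W i j * (\<Sum>l\<in>L. f l j)) = (\<Sum>l\<in>L. \<Sum>j\<in>U. W i j * f l j)"
    by (simp add: sum_distrib_left sum.swap[of _ U L])
  then show ?thesis by (simp add: row_apply_def sum_subtractf sum_distrib_left)
qed

lemma sol_add: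
  assumes d: "det (block U W b) \<noteq> 0" and i: "i \<in> U"
  shows "sol U W b (\<lambda>i. y i + z i) i = sol U W b y i + sol U W b z i"
  by (rule sol_unique[OF d _ i]) (simp add: row_apply_add sol_solves[OF d])

lemma sol_sum:
  assumes d: "det (block U W b) \<noteq> 0" and i: "i \<in> U"
  shows "sol U W b (\<lambda>i. \<Sum>l\<in>L. f i l * c l) i = (\<Sum>l\<in>L. sol U W b (\<lambda>i. f i l) i * c l)"
proof (rule sol_unique[OF d _ i])
  fix k assume k: "k \<in> U"
  have "row_apply U W b (\<lambda>i. \<Sum>l\<in>L. sol U W b (\<lambda>i. f i l) i * c l) k
      = (\<Sum>l\<in>L. row_apply U W b (\<lambda>i. c l * sol U W b (\<lambda>i. f i l) i) k)"
    by (simp add: row_apply_sum mult.commute)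
  also have "\<dots> = (\<Sum>l\<in>L. f k l * c l)"
    by (intro sum.cong) (auto simp: row_apply_scale sol_solves[OF d k])
  finally show "row_apply U W b (\<lambda>i. \<Sum>l\<in>L. sol U W b (\<lambda>i. f i l) i * c l) k = (\<Sum>l\<in>L. f k l * c l)" .
qed

lemma schur_W_apply:
  assumes d: "det (block U1 W b) \<noteq> 0"
  shows "(\<Sum>l\<in>L. schur_W U1 W b k l * x l)
    = (\<Sum>l\<in>L. W k l * x l) + (\<Sum>p\<in>U1. W k p * sol U1 W b (\<lambda>q. \<Sum>l\<in>L. W q l * x l) p)"
proof -
  have "(\<Sum>p\<in>U1. W k p * sol U1 W b (\<lambda>q. \<Sum>l\<in>L. W q l * x l) p)
      = (\<Sum>p\<in>U1. \<Sum>l\<in>L. W k p * (sol U1 W b (\<lambda>q. W q l) p * x l))"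
    by (intro sum.cong refl) (simp add: sol_sum[OF d] sum_distrib_left)
  also have "\<dots> = (\<Sum>l\<in>L. \<Sum>p\<in>U1. W k p * (sol U1 W b (\<lambda>q. W q l) p * x l))"
    by (rule sum.swap)
  finally show ?thesis
    by (simp add: schur_W_def algebra_simps sum.distrib sum_distrib_left)
qed

lemma row_apply_union:
  assumes "U1 \<inter> U2 = {}"
  shows "row_apply (U1 \<union> U2) W b x i = row_apply U1 W b x i - (\<Sum>j\<in>U2. W i j * x j)"
  using assms by (simp add: row_apply_def sum.union_disjoint)

text \<open>
  The term \<open>e\<close> measures by how much \<open>x\<close> fails to solve the rows of \<open>U1\<close> for the given
  values on \<open>U2\<close>. With \<open>e = 0\<close> the rows of \<open>U2\<close> become those of the Schur complement.
\<close>

lemma row_apply_schur: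
  fixes U1 U2 :: "'n::finite set"
  assumes disj: "U1 \<inter> U2 = {}" and d: "det (block U1 W b) \<noteq> 0" and k: "k \<in> U2"
    and x: "\<And>p. p \<in> U1 \<Longrightarrow> x p = sol U1 W b (\<lambda>q. \<Sum>l\<in>U2. W q l * x l) p + e p"
  shows "row_apply (U1 \<union> U2) W b x k = row_apply U2 (schur_W U1 W b) b x k - (\<Sum>p\<in>U1. W k p * e p)"
proof -
  have "(\<Sum>p\<in>U1. W k p * x p) = (\<Sum>p\<in>U1. W k p * sol U1 W b (\<lambda>q. \<Sum>l\<in>U2. W q l * x l) p)
      + (\<Sum>p\<in>U1. W k p * e p)"
    unfolding sum.distrib[symmetric] by (intro sum.cong refl) (subst x, auto simp: algebra_simps)
  then show ?thesis
    using disj by (simp add: row_apply_def sum.union_disjoint schur_W_apply[OF d])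
qed

lemma schur_W_nonneg:
  assumes W: "\<forall>i j. W i j \<ge> 0" and pos: "m_matrix U W b"
  shows "\<forall>i j. schur_W U W b i j \<ge> 0"
  unfolding schur_W_def using W sol_nonneg[OF W pos]
  by (auto intro!: add_nonneg_nonneg sum_nonneg mult_nonneg_nonneg)

lemma schur_v_nonneg:
  assumes W: "\<forall>i j. W i j \<ge> 0" and pos: "m_matrix U W b" and y: "\<forall>i. y i \<ge> 0"
  shows "\<forall>i. schur_v U W b y i \<ge> 0"
  unfolding schur_v_def using W y sol_nonneg[OF W pos]
  by (auto intro!: add_nonneg_nonneg sum_nonneg mult_nonneg_nonneg)

lemma m_matrix_subset:
  assumes W: "\<forall>i j. W i j \<ge> 0" and disj: "U1 \<inter> U2 = {}" and pos: "m_matrix (U1 \<union> U2) W b"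
  shows "m_matrix U1 W b"
proof -
  obtain x where x: "\<And>i. x i > 0" "\<And>i. i \<in> U1 \<union> U2 \<Longrightarrow> row_apply (U1 \<union> U2) W b x i > 0"
    using pos unfolding m_matrix_def by blast
  have "row_apply U1 W b x i > 0" if "i \<in> U1" for i
  proof -
    have "(\<Sum>j\<in>U2. W i j * x j) \<ge> 0" using W x(1) by (auto intro!: sum_nonneg simp: less_imp_le)
    then show ?thesis using x(2)[of i] that by (simp add: row_apply_union[OF disj])
  qed
  then show ?thesis using x(1) by (intro m_matrixI[where x = x]) auto
qed

text \<open>
  A witness for the union restricts to a witness for the Schur complement, because on \<open>U1\<close> it
  lies above the solution of the \<open>U1\<close>-rows. Conversely a witness on \<open>U2\<close> is extended to
  \<open>U1\<close> by that solution plus a small multiple of a witness for \<open>U1\<close>.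
\<close>

lemma m_matrix_schur:
  assumes W: "\<forall>i j. W i j \<ge> 0" and disj: "U1 \<inter> U2 = {}"
  shows "m_matrix (U1 \<union> U2) W b \<longleftrightarrow> m_matrix U1 W b \<and> m_matrix U2 (schur_W U1 W b) b"
proof
  assume pos: "m_matrix (U1 \<union> U2) W b"
  obtain x where x: "\<And>i. x i > 0" "\<And>i. i \<in> U1 \<union> U2 \<Longrightarrow> row_apply (U1 \<union> U2) W b x i > 0"
    using pos unfolding m_matrix_def by blast
  note pos1 = m_matrix_subset[OF W disj pos]
  note d = m_matrix_det_nonzero[OF W pos1]
  define e where "e p = x p - sol U1 W b (\<lambda>q. \<Sum>l\<in>U2. W q l * x l) p" for p
  have e: "e p \<ge> 0" if "p \<in> U1" for p
  proof (rule inverse_positive[OF W pos1 _ that])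
    fix i assume i: "i \<in> U1"
    show "row_apply U1 W b e i \<ge> 0"
      using x(2)[of i] i unfolding e_def row_apply_diff sol_solves[OF d i]
      by (simp add: row_apply_union[OF disj])
  qed
  have "row_apply U2 (schur_W U1 W b) b x k > 0" if k: "k \<in> U2" for k
  proof -
    have "row_apply (U1 \<union> U2) W b x k = row_apply U2 (schur_W U1 W b) b x k - (\<Sum>p\<in>U1. W k p * e p)"
      by (rule row_apply_schur[OF disj d k]) (simp add: e_def)
    moreover have "(\<Sum>p\<in>U1. W k p * e p) \<ge> 0" using W e by (auto intro!: sum_nonneg)
    ultimately show ?thesis using x(2)[of k] k by simp
  qed
  then show "m_matrix U1 W b \<and> m_matrix U2 (schur_W U1 W b) b"
    using pos1 x(1) by (auto intro!: m_matrixI[where x = x])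
next
  assume pos: "m_matrix U1 W b \<and> m_matrix U2 (schur_W U1 W b) b"
  obtain y where y: "\<And>i. y i > 0" "\<And>i. i \<in> U1 \<Longrightarrow> row_apply U1 W b y i > 0"
    using pos unfolding m_matrix_def by blast
  obtain x where x: "\<And>i. x i > 0" "\<And>i. i \<in> U2 \<Longrightarrow> row_apply U2 (schur_W U1 W b) b x i > 0"
    using pos unfolding m_matrix_def by blast
  note d = m_matrix_det_nonzero[OF W conjunct1[OF pos]]
  define A where "A k = row_apply U2 (schur_W U1 W b) b x k" for k
  define B where "B k = (\<Sum>p\<in>U1. W k p * y p)" for k
  have B: "B k \<ge> 0" for k unfolding B_def using W y(1) by (auto intro!: sum_nonneg simp: less_imp_le)
  \<comment> \<open>half of a bound, so that a strict inequality remains in every row of \<open>U2\<close>\<close>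
  define \<epsilon> where "\<epsilon> = Min (insert 1 ((\<lambda>k. A k / (B k + 1)) ` U2)) / 2"
  have \<epsilon>: "\<epsilon> > 0" unfolding \<epsilon>_def using x(2) B
    by (subst half_gt_zero_iff, subst Min_gr_iff) (auto simp: A_def intro!: divide_pos_pos add_nonneg_pos)
  have \<epsilon>_less: "\<epsilon> * B k < A k" if k: "k \<in> U2" for k
  proof -
    have "2 * \<epsilon> \<le> A k / (B k + 1)" unfolding \<epsilon>_def using k by (auto intro!: Min_le)
    then have "2 * \<epsilon> * (B k + 1) \<le> A k" using B[of k] by (simp add: field_simps)
    moreover have "\<epsilon> * B k \<ge> 0" using \<epsilon> B[of k] by simp
    ultimately show ?thesis using \<epsilon> by (simp add: algebra_simps)
  qed
  define S where "S = sol U1 W b (\<lambda>q. \<Sum>l\<in>U2. W q l * x l)"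
  define z where "z i = (if i \<in> U1 then S i + \<epsilon> * y i else x i)" for i
  have zx: "z l = x l" if "l \<in> U2" for l using that disj by (auto simp: z_def)
  show "m_matrix (U1 \<union> U2) W b"
  proof (rule m_matrixI[where x = z])
    fix i assume i: "i \<in> U1 \<union> U2"
    show "z i > 0"
    proof (cases "i \<in> U1")
      case True
      have "S i \<ge> 0" unfolding S_def
        using W x(1) True pos by (intro sol_nonneg[OF W]) (auto intro!: sum_nonneg simp: less_imp_le)
      then show ?thesis using \<epsilon> y(1)[of i] True by (simp add: z_def add_nonneg_pos)
    qed (simp add: z_def x(1))
    show "row_apply (U1 \<union> U2) W b z i > 0"
    proof (cases "i \<in> U1")
      case True
      have "row_apply U1 W b z i = row_apply U1 W b (\<lambda>i. S i + \<epsilon> * y i) i"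
        using True by (intro row_apply_cong) (auto simp: z_def)
      also have "\<dots> = (\<Sum>l\<in>U2. W i l * x l) + \<epsilon> * row_apply U1 W b y i"
        using sol_solves[OF d True] by (simp add: row_apply_add row_apply_scale S_def)
      finally show ?thesis
        using \<epsilon> y(2)[OF True] by (simp add: row_apply_union[OF disj] zx)
    next
      case False
      then have k: "i \<in> U2" using i by simp
      have "row_apply (U1 \<union> U2) W b z i = row_apply U2 (schur_W U1 W b) b z i - (\<Sum>p\<in>U1. W i p * (\<epsilon> * y p))"
        using zx by (intro row_apply_schur[OF disj d k]) (simp add: z_def S_def cong: sum.cong)
      also have "row_apply U2 (schur_W U1 W b) b z i = A i"
        unfolding A_def using k zx by (intro row_apply_cong) auto
      also have "(\<Sum>p\<in>U1. W i p * (\<epsilon> * y p)) = \<epsilon> * B i"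
        by (simp add: B_def sum_distrib_left algebra_simps)
      finally show ?thesis using \<epsilon>_less[OF k] by simp
    qed
  qed
qed

lemma sol_schur:
  assumes disj: "U1 \<inter> U2 = {}" and d: "det (block (U1 \<union> U2) W b) \<noteq> 0"
    and d1: "det (block U1 W b) \<noteq> 0" and d2: "det (block U2 (schur_W U1 W b) b) \<noteq> 0"
  shows "k \<in> U2 \<Longrightarrow> sol (U1 \<union> U2) W b y k = sol U2 (schur_W U1 W b) b (schur_v U1 W b y) k"
    and "p \<in> U1 \<Longrightarrow> sol (U1 \<union> U2) W b y p = sol U1 W b y p
      + sol U1 W b (\<lambda>q. \<Sum>l\<in>U2. W q l * sol U2 (schur_W U1 W b) b (schur_v U1 W b y) l) p"
proof -
  define X where "X = sol U2 (schur_W U1 W b) b (schur_v U1 W b y)"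
  define S where "S = sol U1 W b (\<lambda>q. \<Sum>l\<in>U2. W q l * X l)"
  define z where "z i = (if i \<in> U1 then S i + sol U1 W b y i else X i)" for i
  have zx: "z l = X l" if "l \<in> U2" for l using that disj by (auto simp: z_def)
  have z: "row_apply (U1 \<union> U2) W b z i = y i" if i: "i \<in> U1 \<union> U2" for i
  proof (cases "i \<in> U1")
    case True
    have "row_apply U1 W b z i = row_apply U1 W b (\<lambda>i. S i + sol U1 W b y i) i"
      using True by (intro row_apply_cong) (auto simp: z_def)
    also have "\<dots> = (\<Sum>l\<in>U2. W i l * X l) + y i"
      using sol_solves[OF d1 True] by (simp add: row_apply_add S_def)
    finally show ?thesis by (simp add: row_apply_union[OF disj] zx)
  next
    case False
    then have k: "i \<in> U2" using i by simp
    have "row_apply (U1 \<union> U2) W b z i = row_apply U2 (schur_W U1 W b) b z i - (\<Sum>p\<in>U1. W i p * sol U1 W b y p)"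
      using zx by (intro row_apply_schur[OF disj d1 k]) (simp add: z_def S_def cong: sum.cong)
    also have "row_apply U2 (schur_W U1 W b) b z i = row_apply U2 (schur_W U1 W b) b X i"
      using k zx by (intro row_apply_cong) auto
    also have "\<dots> = schur_v U1 W b y i"
      unfolding X_def by (rule sol_solves[OF d2 k])
    finally show ?thesis by (simp add: schur_v_def)
  qed
  have *: "sol (U1 \<union> U2) W b y i = z i" if "i \<in> U1 \<union> U2" for i
    by (rule sol_unique[OF d z that])
  show "k \<in> U2 \<Longrightarrow> sol (U1 \<union> U2) W b y k = sol U2 (schur_W U1 W b) b (schur_v U1 W b y) k"
    using *[of k] zx[of k] by (simp add: X_def)
  show "p \<in> U1 \<Longrightarrow> sol (U1 \<union> U2) W b y p = sol U1 W b y p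
      + sol U1 W b (\<lambda>q. \<Sum>l\<in>U2. W q l * sol U2 (schur_W U1 W b) b (schur_v U1 W b y) l) p"
    using *[of p] by (simp add: z_def S_def X_def)
qed

text \<open>
  Here \<open>L\<^sup>2 = 0\<close>, so \<open>c \<mapsto> 1 + c L\<close> turns sums into products. Conjugation with the diagonal sign
  matrix of \<open>A\<close> maps \<open>1 + L\<close> to its inverse \<open>1 - L\<close>; hence the determinant is 1 or -1, and it is a
  square, namely of the determinant of \<open>1 + L/2\<close>.
\<close>

lemma det_unipotent:
  fixes L :: "real^'n^'n::finite"
  assumes L: "\<And>i j. \<not> (i \<in> A \<and> j \<notin> A) \<Longrightarrow> L $ i $ j = 0"
  shows "det (mat 1 + L) = 1"
proof -
  define S :: "real^'n^'n" where "S = (\<chi> i j. if i = j then (if i \<in> A then 1 else -1) else 0)"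
  define h where "h c = mat 1 + (\<chi> i j. c * L $ i $ j)" for c :: real
  have L0: "L $ i $ k * L $ k $ j = 0" for i j k
    using L[of i k] L[of k j] by auto
  have hh: "h c ** h d = h (c + d)" for c d
  proof -
    have "(h c ** h d) $ i $ j = h (c + d) $ i $ j" for i j
    proof -
      have "(\<Sum>k\<in>UNIV. ((if i = k then 1 else 0) + c * L $ i $ k) * ((if k = j then 1 else 0) + d * L $ k $ j))
         = (\<Sum>k\<in>UNIV. (if i = k then (if k = j then 1 else 0) + d * L $ k $ j else 0) + (if k = j then c * L $ i $ k else 0))"
        using L0 by (intro sum.cong) (auto simp: algebra_simps)
      then show ?thesis
        by (simp add: h_def matrix_matrix_mult_def mat_def sum.distrib algebra_simps)
    qed
    then show ?thesis by (simp add: vec_eq_iff)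
  qed
  have h0: "h 0 = mat 1" by (simp add: h_def vec_eq_iff)
  have h1: "h 1 = mat 1 + L" by (simp add: h_def vec_eq_iff)
  have "S ** h 1 = h (-1) ** S"
  proof -
    have "(S ** h 1) $ i $ j = (h (-1) ** S) $ i $ j" for i j
      using L[of i j]
      by (simp add: matrix_matrix_mult_def S_def h_def mat_def if_distrib[of "\<lambda>c. c * _"]
            if_distrib[of "\<lambda>c. _ * c"] cong: if_cong)
    then show ?thesis by (simp add: vec_eq_iff)
  qed
  then have "det S * det (h 1) = det (h (-1)) * det S" by (metis det_mul)
  moreover have "det S \<noteq> 0"
    by (subst det_diagonal) (auto simp: S_def)
  ultimately have "det (h 1) = det (h (-1))" by simp
  moreover have "det (h 1) * det (h (-1)) = 1"
    using hh[of 1 "-1"] h0 by (metis add.right_inverse det_I det_mul)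
  moreover have "det (h 1) \<ge> 0"
  proof -
    have "det (h 1) = det (h (1/2)) * det (h (1/2))"
      using hh[of "1/2" "1/2"] by (simp add: det_mul[symmetric])
    then show ?thesis by simp
  qed
  ultimately have "det (h 1) = 1 \<or> det (h 1) = -1" "det (h 1) \<ge> 0"
    by (auto simp: square_eq_1_iff)
  then show ?thesis unfolding h1 by auto
qed

text \<open>
  Block elimination writes the matrix as \<open>(1 + L) H1 H2 (1 + R)\<close>, with \<open>H1\<close> the block of \<open>U1\<close>, \<open>H2\<close> the
  Schur complement, and nilpotent \<open>L\<close>, \<open>R\<close> supported on \<open>U2 \<times> U1\<close> and \<open>U1 \<times> U2\<close>.
\<close>

lemma det_schur:
  fixes U1 U2 :: "'n::finite set"
  assumes disj: "U1 \<inter> U2 = {}" and d: "det (block U1 W b) \<noteq> 0"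
  shows "det (block (U1 \<union> U2) W b) = det (block U1 W b) * det (block U2 (schur_W U1 W b) b)"
proof -
  define R :: "real^'n^'n" where
    "R = (\<chi> i j. if i \<in> U1 \<and> j \<in> U2 then - sol U1 W b (\<lambda>q. W q j) i else 0)"
  define G where "G p k = sol U1 W b (\<lambda>q. if q = k then 1 else 0) p" for p k
  define L :: "real^'n^'n" where
    "L = (\<chi> i j. if i \<in> U2 \<and> j \<in> U1 then - (\<Sum>p\<in>U1. W i p * G p j) else 0)"
  let ?W = "schur_W U1 W b"
  have dR: "det (mat 1 + R) = 1"
    by (rule det_unipotent[where A = U1]) (use disj in \<open>auto simp: R_def\<close>)
  have dL: "det (mat 1 + L) = 1"
    by (rule det_unipotent[where A = U2]) (use disj in \<open>auto simp: L_def\<close>)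
  have G: "(\<Sum>k\<in>U1. G p k * row_apply U1 W b x k) = x p" if p: "p \<in> U1" for p x
  proof -
    have "sol U1 W b (\<lambda>q. \<Sum>k\<in>U1. (if q = k then 1 else 0) * row_apply U1 W b x k) p
        = (\<Sum>k\<in>U1. G p k * row_apply U1 W b x k)"
      unfolding G_def using sol_sum[OF d p, of "\<lambda>q k. if q = k then 1 else 0"] .
    moreover have "sol U1 W b (\<lambda>q. \<Sum>k\<in>U1. (if q = k then 1 else 0) * row_apply U1 W b x k) p = x p"
      by (rule sol_unique[OF d _ p]) (simp add: if_distrib[of "\<lambda>c. c * _"] cong: if_cong)
    ultimately show ?thesis by simp
  qed
  have "(mat 1 + L) *v (block U1 W b *v (block U2 ?W b *v ((mat 1 + R) *v v))) = block (U1 \<union> U2) W b *v v" for v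
  proof -
    define r where "r i = (if i \<in> U1 then v $ i - sol U1 W b (\<lambda>q. \<Sum>j\<in>U2. W q j * v $ j) i else v $ i)" for i
    have R: "((mat 1 + R) *v v) $ i = r i" for i
    proof -
      have "(R *v v) $ i = (if i \<in> U1 then - (\<Sum>j\<in>U2. sol U1 W b (\<lambda>q. W q j) i * v $ j) else 0)"
        by (simp add: R_def matrix_vector_mult_def if_distrib[of "\<lambda>c. c * _"] sum.If_cases sum_negf
              cong: if_cong)
      then show ?thesis
        by (simp add: matrix_vector_mult_add_rdistrib r_def sol_sum[OF d])
    qed
    define s where "s i = (if i \<in> U2 then row_apply U2 ?W b (\<lambda>i. v $ i) i else r i)" for i
    have s: "(block U2 ?W b *v ((mat 1 + R) *v v)) $ i = s i" for i
    proof -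
      have "row_apply U2 ?W b r i = row_apply U2 ?W b (\<lambda>i. v $ i) i" if "i \<in> U2"
        using that disj by (intro row_apply_cong) (auto simp: r_def)
      then show ?thesis by (simp add: block_mult_vec row_apply_def R s_def)
    qed
    define t where "t i = (if i \<in> U1 then row_apply (U1 \<union> U2) W b (\<lambda>i. v $ i) i else s i)" for i
    have t: "(block U1 W b *v (block U2 ?W b *v ((mat 1 + R) *v v))) $ i = t i" for i
    proof -
      have "row_apply U1 W b s i = row_apply (U1 \<union> U2) W b (\<lambda>i. v $ i) i" if i: "i \<in> U1"
      proof -
        have "row_apply U1 W b s i = row_apply U1 W b (\<lambda>i. v $ i - sol U1 W b (\<lambda>q. \<Sum>j\<in>U2. W q j * v $ j) i) i"
          using i disj by (intro row_apply_cong) (auto simp: s_def r_def)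
        then show ?thesis unfolding row_apply_diff sol_solves[OF d i] row_apply_union[OF disj] .
      qed
      then show ?thesis by (simp add: block_mult_vec[of U1] s t_def row_apply_def)
    qed
    define S where "S p = sol U1 W b (\<lambda>q. \<Sum>j\<in>U2. W q j * v $ j) p" for p
    define Y where "Y = block U1 W b *v (block U2 ?W b *v ((mat 1 + R) *v v))"
    have Gt: "(\<Sum>k\<in>U1. G p k * t k) = v $ p - S p" if p: "p \<in> U1" for p
    proof -
      have "(\<Sum>k\<in>U1. G p k * t k) = (\<Sum>k\<in>U1. G p k * row_apply U1 W b (\<lambda>i. v $ i - S i) k)"
        unfolding S_def by (intro sum.cong refl) (simp add: t_def row_apply_diff sol_solves[OF d] row_apply_union[OF disj])
      then show ?thesis by (simp only: G[OF p])
    qed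
    have Lt: "(L *v Y) $ i = - (\<Sum>p\<in>U1. W i p * v $ p) + (\<Sum>p\<in>U1. W i p * S p)" if i: "i \<in> U2" for i
    proof -
      have "(L *v Y) $ i = - (\<Sum>k\<in>U1. (\<Sum>p\<in>U1. W i p * G p k) * t k)"
        using i unfolding matrix_vector_mult_def[of L] Y_def t
        by (simp add: L_def if_distrib[of "\<lambda>c. c * _"] sum.If_cases sum_negf cong: if_cong)
      also have "(\<Sum>k\<in>U1. (\<Sum>p\<in>U1. W i p * G p k) * t k) = (\<Sum>k\<in>U1. \<Sum>p\<in>U1. W i p * (G p k * t k))"
        by (simp add: sum_distrib_right mult.assoc)
      also have "\<dots> = (\<Sum>p\<in>U1. W i p * (\<Sum>k\<in>U1. G p k * t k))"
        unfolding sum_distrib_left by (rule sum.swap)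
      also have "\<dots> = (\<Sum>p\<in>U1. W i p * v $ p - W i p * S p)"
        by (intro sum.cong refl) (simp only: Gt right_diff_distrib)
      finally show ?thesis by (simp add: sum_subtractf)
    qed
    have L0: "(L *v Y) $ i = 0" if i: "i \<notin> U2" for i
      using i by (simp add: L_def matrix_vector_mult_def)
    have "((mat 1 + L) *v Y) $ i = (block (U1 \<union> U2) W b *v v) $ i" for i
    proof (cases "i \<in> U2")
      case True
      then have "t i = row_apply U2 ?W b (\<lambda>i. v $ i) i" using disj by (auto simp: t_def s_def)
      also have "\<dots> = row_apply U2 W b (\<lambda>i. v $ i) i - (\<Sum>p\<in>U1. W i p * S p)"
        by (simp add: row_apply_def schur_W_apply[OF d] S_def)
      finally have ti: "t i = \<dots>" .
      have "((mat 1 + L) *v Y) $ i = t i + (L *v Y) $ i"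
        by (simp add: matrix_vector_mult_add_rdistrib) (simp add: Y_def t)
      then show ?thesis
        using True disj by (simp add: ti Lt block_mult_vec row_apply_def sum.union_disjoint)
    next
      case False
      have "((mat 1 + L) *v Y) $ i = t i"
        using L0[OF False] by (simp add: matrix_vector_mult_add_rdistrib) (simp add: Y_def t)
      then show ?thesis
        using False by (simp add: block_mult_vec t_def s_def r_def)
    qed
    then show ?thesis by (simp add: vec_eq_iff Y_def)
  qed
  then have "(mat 1 + L) ** (block U1 W b ** (block U2 ?W b ** (mat 1 + R))) = block (U1 \<union> U2) W b"
    by (simp add: matrix_eq matrix_vector_mul_assoc[symmetric])
  then show ?thesis by (metis det_mul dL dR mult_1 mult.right_neutral)
qed

section \<open>Small blocks and measurability\<close>

text \<open>
  The form \<open>\<langle>y, G y\<rangle>\<close>, where \<open>G\<close> is the inverse of the \<open>U \<times> U\<close> submatrix.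
\<close>

definition quad :: "('n \<Rightarrow> 'n) \<Rightarrow> 'n set \<Rightarrow> ('n \<Rightarrow> 'n \<Rightarrow> real) \<Rightarrow> ('n::finite \<Rightarrow> real) \<Rightarrow> ('n \<Rightarrow> real) \<Rightarrow> real" where
  "quad star U W b y = (\<Sum>i\<in>U. y (star i) * sol U W b y i)"

lemma det_block_empty: "det (block {} W b) = 1"
proof -
  have "block {} W b = mat 1" by (simp add: block_def mat_def vec_eq_iff)
  then show ?thesis by (metis det_I)
qed

lemma det_block_single: "det (block {i} W b) = b i - W i i"
proof -
  have "det (block {i} W b) = (\<Prod>k\<in>UNIV. block {i} W b $ k $ k)"
    by (rule det_diagonal) (auto simp: block_def)
  also have "\<dots> = (\<Prod>k\<in>UNIV. if k = i then b i - W i i else 1)"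
    by (intro prod.cong) (auto simp: block_def)
  finally show ?thesis by simp
qed

lemma m_matrix_single: "m_matrix {i} W b \<longleftrightarrow> b i - W i i > 0"
proof
  assume "m_matrix {i} W b"
  then obtain x where "x i > 0" "row_apply {i} W b x i > 0" by (auto simp: m_matrix_def)
  then have "(b i - W i i) * x i > 0" by (simp add: row_apply_def algebra_simps)
  then show "b i - W i i > 0" using \<open>x i > 0\<close> by (simp add: zero_less_mult_iff)
next
  assume "b i - W i i > 0"
  then show "m_matrix {i} W b" by (intro m_matrixI[where x = "\<lambda>_. 1"]) (auto simp: row_apply_def)
qed

lemma sol_single:
  assumes "b i - W i i \<noteq> 0"
  shows "sol {i} W b y i = y i / (b i - W i i)"
proof -
  have "(b i - W i i) * (y i / (b i - W i i)) = y i" using assms by simp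
  then have "row_apply {i} W b (\<lambda>k. y k / (b i - W i i)) i = y i"
    by (simp add: row_apply_def left_diff_distrib diff_divide_distrib)
  then show ?thesis
    using assms by (intro sol_unique) (auto simp: det_block_single)
qed

lemma schur_W_single:
  assumes "b i - W i i \<noteq> 0"
  shows "schur_W {i} W b k l = W k l + W k i * W i l / (b i - W i i)"
  using assms by (simp add: schur_W_def sol_single)

text \<open>
  Two one-vertex Schur steps, as in the determinant below.
\<close>

lemma m_matrix_pair:
  assumes W: "\<forall>i j. W i j \<ge> 0" and ij: "i \<noteq> j"
  shows "m_matrix {i, j} W b \<longleftrightarrow> b i - W i i > 0 \<and> (b i - W i i) * (b j - W j j) > W i j * W j i"
proof -
  have "m_matrix {i, j} W b \<longleftrightarrow> m_matrix ({i} \<union> {j}) W b" by (simp add: insert_commute)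
  also have "\<dots> \<longleftrightarrow> m_matrix {i} W b \<and> m_matrix {j} (schur_W {i} W b) b"
    using ij by (intro m_matrix_schur[OF W]) auto
  also have "\<dots> \<longleftrightarrow> b i - W i i > 0 \<and> (b i - W i i) * (b j - W j j) > W i j * W j i"
    by (auto simp: m_matrix_single schur_W_single field_simps)
  finally show ?thesis .
qed

lemma det_block_pair:
  assumes ij: "i \<noteq> j" and h: "b i - W i i \<noteq> 0"
  shows "det (block {i, j} W b) = (b i - W i i) * (b j - W j j) - W i j * W j i"
proof -
  have "det (block ({i} \<union> {j}) W b) = det (block {i} W b) * det (block {j} (schur_W {i} W b) b)"
    using ij h by (intro det_schur) (auto simp: det_block_single)
  also have "{i} \<union> {j} = {i, j}" by auto
  finally have "det (block {i, j} W b)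
      = (b i - W i i) * (b j - (W j j + W j i * W i j / (b i - W i i)))"
    using h by (simp add: det_block_single schur_W_single)
  moreover have "h * (x - (y + z / h)) = h * (x - y) - z" if "h \<noteq> 0" for h x y z :: real
    using that by (simp add: field_simps)
  ultimately show ?thesis using h by (simp add: mult.commute)
qed

lemma sol_pair:
  fixes W b i j
  defines "D \<equiv> (b i - W i i) * (b j - W j j) - W i j * W j i"
  assumes ij: "i \<noteq> j" and h: "b i - W i i \<noteq> 0" and D: "D \<noteq> 0"
  shows "sol {i, j} W b y i = ((b j - W j j) * y i + W i j * y j) / D"
    and "sol {i, j} W b y j = (W j i * y i + (b i - W i i) * y j) / D"
proof -
  define x where "x k = (if k = i then ((b j - W j j) * y i + W i j * y j) / D
                              else (W j i * y i + (b i - W i i) * y j) / D)" for k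
  have d: "det (block {i, j} W b) \<noteq> 0" using D by (simp add: det_block_pair[of i j b W, OF ij h] D_def)
  have "row_apply {i, j} W b x k = y k" if "k \<in> {i, j}" for k
  proof -
    have "row_apply {i, j} W b x i = ((b i - W i i) * ((b j - W j j) * y i + W i j * y j)
        - W i j * (W j i * y i + (b i - W i i) * y j)) / D"
      using ij by (simp add: row_apply_def x_def diff_divide_distrib add_divide_distrib algebra_simps)
    also have "\<dots> = D * y i / D" by (simp add: D_def algebra_simps)
    finally have 1: "row_apply {i, j} W b x i = y i" using D by simp
    have "row_apply {i, j} W b x j = ((b j - W j j) * (W j i * y i + (b i - W i i) * y j)
        - W j i * ((b j - W j j) * y i + W i j * y j)) / D"
      using ij by (simp add: row_apply_def x_def diff_divide_distrib add_divide_distrib algebra_simps)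
    also have "\<dots> = D * y j / D" by (simp add: D_def algebra_simps)
    finally have 2: "row_apply {i, j} W b x j = y j" using D by simp
    show ?thesis using that 1 2 by auto
  qed
  then have "sol {i, j} W b y k = x k" if "k \<in> {i, j}" for k
    using that by (intro sol_unique[OF d]) auto
  then show "sol {i, j} W b y i = ((b j - W j j) * y i + W i j * y j) / D"
    "sol {i, j} W b y j = (W j i * y i + (b i - W i i) * y j) / D"
    using ij by (auto simp: x_def)
qed

lemma borel_measurable_det:
  fixes A :: "'a \<Rightarrow> real^'n^'n::finite"
  assumes "\<And>i j. (\<lambda>w. A w $ i $ j) \<in> borel_measurable M"
  shows "(\<lambda>w. det (A w)) \<in> borel_measurable M"
  unfolding det_def using assms by measurable

lemma borel_measurable_block:
  fixes b :: "'a \<Rightarrow> 'n::finite \<Rightarrow> real"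
  assumes [measurable]: "\<And>i. (\<lambda>w. b w i) \<in> borel_measurable M"
  shows "(\<lambda>w. block U W (b w) $ i $ j) \<in> borel_measurable M"
  by (cases "i \<in> U \<and> j \<in> U"; cases "i = j") (auto simp: block_def)

lemma borel_measurable_det_block:
  fixes b :: "'a \<Rightarrow> 'n::finite \<Rightarrow> real"
  assumes "\<And>i. (\<lambda>w. b w i) \<in> borel_measurable M"
  shows "(\<lambda>w. det (block U W (b w))) \<in> borel_measurable M"
  by (intro borel_measurable_det borel_measurable_block assms)

lemma borel_measurable_sol:
  fixes b :: "'a \<Rightarrow> 'n::finite \<Rightarrow> real"
  assumes b: "\<And>i. (\<lambda>w. b w i) \<in> borel_measurable M"
  shows "(\<lambda>w. sol U W (b w) y k) \<in> borel_measurable M"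
proof -
  have "(\<lambda>w. (\<chi> i j. if j = k then (if i \<in> U then y i else 0) else block U W (b w) $ i $ j) $ p $ q)
      \<in> borel_measurable M" for p q
    using borel_measurable_block[OF b] by (cases "q = k") auto
  then show ?thesis
    unfolding sol_def by (intro borel_measurable_divide borel_measurable_det borel_measurable_det_block b)
qed

lemma borel_measurable_quad:
  fixes b :: "'a \<Rightarrow> 'n::finite \<Rightarrow> real"
  assumes "\<And>i. (\<lambda>w. b w i) \<in> borel_measurable M"
  shows "(\<lambda>w. quad star U W (b w) y) \<in> borel_measurable M"
  unfolding quad_def by (intro borel_measurable_sum borel_measurable_times borel_measurable_const borel_measurable_sol assms)

lemma measurable_m_matrix:
  fixes b :: "'a \<Rightarrow> 'n::finite \<Rightarrow> real"
  assumes W: "\<forall>i j. W i j \<ge> 0" and b: "\<And>i. (\<lambda>w. b w i) \<in> borel_measurable M"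
  shows "Measurable.pred M (\<lambda>w. m_matrix U W (b w))"
proof -
  note [measurable] = borel_measurable_det_block[OF b] borel_measurable_sol[OF b]
  show ?thesis unfolding m_matrix_iff_sol[OF W] by measurable
qed

lemma borel_measurable_vec_componentwise:
  fixes f :: "'a \<Rightarrow> real^'n::finite"
  assumes "\<And>i. (\<lambda>x. f x $ i) \<in> borel_measurable M"
  shows "f \<in> borel_measurable M"
proof (rule borel_measurable_euclidean_space[THEN iffD2], rule ballI)
  fix e :: "real^'n" assume "e \<in> Basis"
  then obtain i where e: "e = axis i 1" by (auto simp: Basis_vec_def)
  have "(\<lambda>x. f x \<bullet> e) = (\<lambda>x. f x $ i)" by (simp add: e inner_axis)
  then show "(\<lambda>x. f x \<bullet> e) \<in> borel_measurable M" using assms[of i] by (simp only:)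
qed

lemma borel_measurable_vec_nth: "(\<lambda>x::real^'n::finite. x $ i) \<in> borel_measurable borel"
  by (rule borel_measurable_continuous_onI, rule continuous_on_component, rule continuous_on_id)

lemma H_mat_block: "H_mat W \<beta> = block UNIV (\<lambda>i j. W $ i $ j) (\<lambda>i. \<beta> $ i)"
  by (simp add: H_mat_def block_def vec_eq_iff)

lemma matrix_inv_mult_eq_sol:
  fixes W :: "'n::finite \<Rightarrow> 'n \<Rightarrow> real"
  assumes d: "det (block UNIV W b) \<noteq> 0"
  shows "(matrix_inv (block UNIV W b) *v v) $ i = sol UNIV W b (\<lambda>i. v $ i) i"
proof -
  have "invertible (block UNIV W b)" using d by (simp add: invertible_det_nz)
  then have "block UNIV W b ** matrix_inv (block UNIV W b) = mat 1
      \<and> matrix_inv (block UNIV W b) ** block UNIV W b = mat 1"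
    unfolding invertible_def matrix_inv_def by (rule someI_ex)
  then have "block UNIV W b *v (matrix_inv (block UNIV W b) *v v) = v"
    by (simp only: matrix_vector_mul_assoc matrix_vector_mul_lid)
  also have "v = (\<chi> i. if i \<in> UNIV then v $ i else 0)"
    by (simp add: vec_eq_iff)
  finally have "matrix_inv (block UNIV W b) *v v = (\<chi> k. sol UNIV W b (\<lambda>i. v $ i) k)"
    by (rule block_sol_iff[OF d, THEN iffD1])
  then show ?thesis by (simp only: vec_lambda_beta)
qed

section \<open>One-dimensional integrals\<close>

text \<open>
  This transfers the equivalence in the substitution rule for gauge integrals to nonnegative
  integrals, which are defined also when they are infinite.
\<close>

lemma has_integral_imp_nn_integral_eq:
  fixes f :: "real \<Rightarrow> real"
  assumes [measurable]: "S \<in> sets borel" and f: "(\<lambda>x. f x * indicator S x) \<in> borel_measurable borel"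
    and nonneg: "\<And>x. x \<in> S \<Longrightarrow> f x \<ge> 0" and r: "r \<ge> 0"
  shows "(\<integral>\<^sup>+x. ennreal (f x) * indicator S x \<partial>lborel) = ennreal r
      \<longleftrightarrow> f absolutely_integrable_on S \<and> integral S f = r"
proof
  assume "f absolutely_integrable_on S \<and> integral S f = r"
  then have "(f has_integral r) S"
    by (simp add: has_integral_integrable_integral set_lebesgue_integral_eq_integral(1))
  then show "(\<integral>\<^sup>+x. ennreal (f x) * indicator S x \<partial>lborel) = ennreal r"
    by (intro nn_integral_has_integral_lebesgue' nonneg)
next
  assume "(\<integral>\<^sup>+x. ennreal (f x) * indicator S x \<partial>lborel) = ennreal r"
  moreover have "ennreal (f x) * indicator S x = ennreal (f x * indicator S x)" for x
    by (simp add: indicator_def)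
  ultimately have "(\<integral>\<^sup>+x. ennreal (f x * indicator S x) \<partial>lborel) = ennreal r"
    by (simp only:)
  then have "((\<lambda>x. f x * indicator S x) has_integral r) UNIV"
    using f nonneg r by (intro nn_integral_has_integral) (auto simp: indicator_def)
  moreover have "(\<lambda>x. f x * indicator S x) = (\<lambda>x. if x \<in> S then f x else 0)"
    by (auto simp: indicator_def)
  ultimately have "((\<lambda>x. if x \<in> S then f x else 0) has_integral r) UNIV"
    by (simp only:)
  then have "(f has_integral r) S" by (simp add: has_integral_restrict_UNIV)
  then show "f absolutely_integrable_on S \<and> integral S f = r"
    using nonneg by (simp add: nonnegative_absolutely_integrable_1 has_integral_integrable_integral)
qed

text \<open>
  Both sides may be infinite. The substitution rule for absolutely integrable functions is an
  equivalence, so that the two integrals agree as soon as one of them is finite.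
\<close>

lemma nn_integral_change_of_variables:
  fixes f g g' :: "real \<Rightarrow> real"
  assumes S: "S \<in> sets borel" and T: "g ` S \<in> sets borel"
    and der: "\<And>x. x \<in> S \<Longrightarrow> (g has_field_derivative g' x) (at x within S)"
    and inj: "inj_on g S"
    and f: "f \<in> borel_measurable borel" and nonneg: "\<And>x. x \<in> g ` S \<Longrightarrow> f x \<ge> 0"
    and h: "(\<lambda>x. \<bar>g' x\<bar> * f (g x) * indicator S x) \<in> borel_measurable borel"
  shows "(\<integral>\<^sup>+x. ennreal (f x) * indicator (g ` S) x \<partial>lborel)
       = (\<integral>\<^sup>+x. ennreal (\<bar>g' x\<bar> * f (g x)) * indicator S x \<partial>lborel)" (is "?L = ?R")
proof -
  note [measurable] = S T f
  have iff: "?L = ennreal r \<longleftrightarrow> ?R = ennreal r" if r: "r \<ge> 0" for r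
  proof -
    have "?L = ennreal r \<longleftrightarrow> f absolutely_integrable_on (g ` S) \<and> integral (g ` S) f = r"
      using r nonneg T by (intro has_integral_imp_nn_integral_eq) simp_all
    moreover have "?R = ennreal r \<longleftrightarrow> (\<lambda>x. \<bar>g' x\<bar> * f (g x)) absolutely_integrable_on S
        \<and> integral S (\<lambda>x. \<bar>g' x\<bar> * f (g x)) = r"
      using r nonneg S h by (intro has_integral_imp_nn_integral_eq) simp_all
    moreover have "S \<in> sets lebesgue" using S by simp
    ultimately show ?thesis
      using has_absolute_integral_change_of_variables_1'[OF _ der inj, of f r] by (simp only:)
  qed
  show ?thesis
  proof (cases ?L rule: ennreal_cases)
    case (real r)
    then show ?thesis using iff[of r] by simp
  next
    case top
    show ?thesis
    proof (cases ?R rule: ennreal_cases)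
      case (real r)
      then show ?thesis using iff[of r] by simp
    qed (simp only: top)
  qed
qed

lemma nn_integral_even:
  fixes f :: "real \<Rightarrow> ennreal"
  assumes [measurable]: "f \<in> borel_measurable borel" and even: "\<And>x. f (- x) = f x"
  shows "(\<integral>\<^sup>+x. f x \<partial>lborel) = 2 * (\<integral>\<^sup>+x. f x * indicator {0<..} x \<partial>lborel)"
proof -
  have "AE x in lborel. f x = f x * indicator {0<..} x + f x * indicator {..<0} x"
    using AE_lborel_singleton[of "0::real"] by eventually_elim (simp add: indicator_def)
  then have "(\<integral>\<^sup>+x. f x \<partial>lborel) = (\<integral>\<^sup>+x. f x * indicator {0<..} x + f x * indicator {..<0} x \<partial>lborel)"
    by (rule nn_integral_cong_AE)
  also have "\<dots> = (\<integral>\<^sup>+x. f x * indicator {0<..} x \<partial>lborel) + (\<integral>\<^sup>+x. f x * indicator {..<0} x \<partial>lborel)"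
    by (rule nn_integral_add) simp_all
  also have "(\<integral>\<^sup>+x. f x * indicator {..<0} x \<partial>lborel)
      = ennreal (\<bar>-1\<bar>) * (\<integral>\<^sup>+x. f (0 + (-1) * x) * indicator {..<0} (0 + (-1) * x) \<partial>lborel)"
    by (rule nn_integral_real_affine) simp_all
  also have "\<dots> = (\<integral>\<^sup>+x. f x * indicator {0<..} x \<partial>lborel)"
    by (simp add: even indicator_def)
  finally show ?thesis by (simp add: mult_2)
qed

lemma nn_integral_std_normal: "(\<integral>\<^sup>+x. ennreal (exp (- x\<^sup>2 / 2) / sqrt (2 * pi)) \<partial>lborel) = 1"
proof -
  have "(\<integral>\<^sup>+x. ennreal (normal_density 0 1 x) \<partial>lborel) = 1"
    using nn_integral_eq_integral[OF integrable_normal_density[of 1 0]] integral_normal_density[of 1 0]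
    by simp
  moreover have "normal_density 0 1 x = exp (- x\<^sup>2 / 2) / sqrt (2 * pi)" for x
    by (simp add: normal_density_def)
  ultimately show ?thesis by (simp only:)
qed

text \<open>
  With \<open>X t = sqrt t - k / sqrt t\<close> the integrand is \<open>exp (-k) / sqrt t\<close> times the standard normal density
  at \<open>X t\<close>. The inversion \<open>t \<mapsto> k\<^sup>2/t\<close> changes the sign of \<open>X\<close> and turns the weight \<open>1 / sqrt t\<close> into
  \<open>k / (t sqrt t)\<close>. The sum of the two weights is twice the derivative of \<open>X\<close>, which maps the
  half-line onto the real line when \<open>k > 0\<close>. For \<open>k = 0\<close> the substitution \<open>t = z\<^sup>2\<close> gives half of the
  normal law.
\<close>

lemma inverse_gaussian_integral:
  fixes k :: real
  assumes k: "k \<ge> 0"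
  shows "(\<integral>\<^sup>+t. ennreal (exp (- (t + k\<^sup>2 / t) / 2) / sqrt (2 * pi * t)) * indicator {0<..} t \<partial>lborel)
       = ennreal (exp (- k))"
proof (cases "k = 0")
  case True
  have im: "(\<lambda>z::real. z\<^sup>2) ` {0<..} = {0<..}"
  proof (intro set_eqI iffI)
    fix t :: real assume "t \<in> {0<..}"
    then show "t \<in> (\<lambda>z. z\<^sup>2) ` {0<..}" by (intro image_eqI[of _ _ "sqrt t"]) auto
  qed auto
  have inj: "inj_on (\<lambda>z::real. z\<^sup>2) {0<..}"
    by (auto simp: inj_on_def)
  have "(\<integral>\<^sup>+t. ennreal (exp (- t / 2) / sqrt (2 * pi * t)) * indicator ((\<lambda>z. z\<^sup>2) ` {0<..}) t \<partial>lborel)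
    = (\<integral>\<^sup>+z. ennreal (\<bar>2 * z\<bar> * (exp (- z\<^sup>2 / 2) / sqrt (2 * pi * z\<^sup>2))) * indicator {0<..} z \<partial>lborel)"
    by (rule nn_integral_change_of_variables)
       (auto simp: im inj intro!: derivative_eq_intros)
  also have "\<dots> = (\<integral>\<^sup>+z. ennreal 2 * (ennreal (exp (- z\<^sup>2 / 2) / sqrt (2 * pi)) * indicator {0<..} z) \<partial>lborel)"
    by (intro nn_integral_cong)
       (auto simp: indicator_def real_sqrt_mult ennreal_mult[symmetric] field_simps simp del: ennreal_numeral)
  also have "\<dots> = 2 * (\<integral>\<^sup>+z. ennreal (exp (- z\<^sup>2 / 2) / sqrt (2 * pi)) * indicator {0<..} z \<partial>lborel)"
    by (subst nn_integral_cmult) auto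
  also have "\<dots> = 1"
    by (subst nn_integral_even[symmetric]) (use nn_integral_std_normal in simp_all)
  finally show ?thesis using True by (simp add: im)
next
  case False
  with k have k: "k > 0" by simp
  define F where "F t = exp (- (t + k\<^sup>2 / t) / 2) / sqrt (2 * pi * t)" for t
  define X where "X t = sqrt t - k / sqrt t" for t
  define X' where "X' t = (1 / sqrt t + k / (t * sqrt t)) / 2" for t
  define \<phi> where "\<phi> x = exp (- x\<^sup>2 / 2) / sqrt (2 * pi)" for x :: real
  have [measurable]: "F \<in> borel_measurable borel" "X \<in> borel_measurable borel"
    "X' \<in> borel_measurable borel" "\<phi> \<in> borel_measurable borel"
    unfolding F_def X_def X'_def \<phi>_def by measurable
  define I where "I = (\<integral>\<^sup>+t. ennreal (F t) * indicator {0<..} t \<partial>lborel)"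
  \<comment> \<open>the inversion exchanges the two halves of the derivative of \<open>X\<close>\<close>
  have im: "(\<lambda>t. k\<^sup>2 / t) ` {0<..} = {0<..}"
  proof (intro set_eqI iffI)
    fix t :: real assume "t \<in> {0<..}"
    then show "t \<in> (\<lambda>t. k\<^sup>2 / t) ` {0<..}" using k by (intro image_eqI[of _ _ "k\<^sup>2 / t"]) auto
  qed (use k in auto)
  have inj: "inj_on (\<lambda>t. k\<^sup>2 / t) {0<..}" using k by (auto simp: inj_on_def)
  have "I = (\<integral>\<^sup>+t. ennreal (F t) * indicator ((\<lambda>t. k\<^sup>2 / t) ` {0<..}) t \<partial>lborel)"
    by (simp add: I_def im)
  also have "\<dots> = (\<integral>\<^sup>+t. ennreal (\<bar>- (k\<^sup>2 / t\<^sup>2)\<bar> * F (k\<^sup>2 / t)) * indicator {0<..} t \<partial>lborel)"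
    by (rule nn_integral_change_of_variables)
       (simp_all add: im inj, auto simp: F_def power2_eq_square intro!: derivative_eq_intros)
  also have "\<dots> = (\<integral>\<^sup>+t. ennreal (k / t * F t) * indicator {0<..} t \<partial>lborel)"
  proof (intro nn_integral_cong)
    fix t :: real
    show "ennreal (\<bar>- (k\<^sup>2 / t\<^sup>2)\<bar> * F (k\<^sup>2 / t)) * indicator {0<..} t = ennreal (k / t * F t) * indicator {0<..} t"
    proof (cases "t > 0")
      case True
      define r where "r = sqrt t"
      define s where "s = sqrt (2 * pi)"
      have pos: "r > 0" "s > 0" "t = r * r" using True by (auto simp: r_def s_def)
      have s1: "sqrt (2 * pi * (k\<^sup>2 / t)) = s * k / r"
        using k True by (simp add: real_sqrt_mult real_sqrt_divide s_def r_def)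
      have s2: "sqrt (2 * pi * t) = s * r" by (simp add: real_sqrt_mult s_def r_def)
      have s3: "k\<^sup>2 / t + k\<^sup>2 / (k\<^sup>2 / t) = t + k\<^sup>2 / t" using k by simp
      have "k\<^sup>2 / t\<^sup>2 * (E / (s * k / r)) = k / t * (E / (s * r))" for E
        using pos k by (simp add: field_simps power2_eq_square)
      then have "k\<^sup>2 / t\<^sup>2 * F (k\<^sup>2 / t) = k / t * F t"
        unfolding F_def s1 s2 s3 .
      then show ?thesis using k by simp
    qed simp
  qed
  finally have I2: "I = (\<integral>\<^sup>+t. ennreal (k / t * F t) * indicator {0<..} t \<partial>lborel)" .
  have surj: "X ` {0<..} = UNIV"
  proof (intro set_eqI iffI UNIV_I)
    fix x :: real
    define z where "z = (x + sqrt (x\<^sup>2 + 4 * k)) / 2"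
    have "\<bar>x\<bar> < sqrt (x\<^sup>2 + 4 * k)"
      using k by (intro real_less_rsqrt) auto
    then have z: "z > 0" by (simp add: z_def abs_if split: if_splits)
    have "(2 * z - x)\<^sup>2 = x\<^sup>2 + 4 * k"
      using k unfolding z_def by (simp add: add_divide_distrib)
    then have "z * z - k = x * z" by (simp add: power2_eq_square algebra_simps)
    then have "z - k / z = x" using z by (simp add: field_simps)
    then have "X (z\<^sup>2) = x" using z by (simp add: X_def)
    then show "x \<in> X ` {0<..}" using z by (intro image_eqI[of _ _ "z\<^sup>2"]) auto
  qed
  have "(\<integral>\<^sup>+t. ennreal (F t) * indicator {0<..} t + ennreal (k / t * F t) * indicator {0<..} t \<partial>lborel)
      = (\<integral>\<^sup>+t. ennreal (F t) * indicator {0<..} t \<partial>lborel)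
      + (\<integral>\<^sup>+t. ennreal (k / t * F t) * indicator {0<..} t \<partial>lborel)"
    by (rule nn_integral_add) simp_all
  then have "I + I = (\<integral>\<^sup>+t. ennreal (F t) * indicator {0<..} t + ennreal (k / t * F t) * indicator {0<..} t \<partial>lborel)"
    unfolding I2[symmetric] I_def[symmetric] by simp
  also have "\<dots> = (\<integral>\<^sup>+t. ennreal (2 * exp (- k)) * (ennreal (\<bar>X' t\<bar> * \<phi> (X t)) * indicator {0<..} t) \<partial>lborel)"
  proof (intro nn_integral_cong)
    fix t :: real
    show "ennreal (F t) * indicator {0<..} t + ennreal (k / t * F t) * indicator {0<..} t
       = ennreal (2 * exp (- k)) * (ennreal (\<bar>X' t\<bar> * \<phi> (X t)) * indicator {0<..} t)"
    proof (cases "t > 0")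
      case True
      have "(X t)\<^sup>2 = t + k\<^sup>2 / t - 2 * k"
        using True by (simp add: X_def power2_diff power_divide)
      then have "- (t + k\<^sup>2 / t) / 2 = - k + - (X t)\<^sup>2 / 2" by (simp add: field_simps)
      then have "F t = exp (- k) * exp (- (X t)\<^sup>2 / 2) / sqrt (2 * pi * t)"
        unfolding F_def by (simp only: exp_add)
      then have F: "F t = exp (- k) * \<phi> (X t) / sqrt t"
        by (simp add: \<phi>_def real_sqrt_mult)
      have "\<bar>X' t\<bar> = (1 / sqrt t + k / t / sqrt t) / 2"
        using True k by (simp add: X'_def)
      then have "F t + k / t * F t = 2 * exp (- k) * (\<bar>X' t\<bar> * \<phi> (X t))"
        unfolding F by (simp add: algebra_simps add_divide_distrib)
      moreover have "F t \<ge> 0" "k / t * F t \<ge> 0" "\<phi> (X t) \<ge> 0"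
        using True k by (auto simp: F_def \<phi>_def)
      ultimately show ?thesis using True by (simp add: ennreal_plus[symmetric] ennreal_mult[symmetric] del: ennreal_plus)
    qed simp
  qed
  also have "\<dots> = ennreal (2 * exp (- k)) * (\<integral>\<^sup>+t. ennreal (\<bar>X' t\<bar> * \<phi> (X t)) * indicator {0<..} t \<partial>lborel)"
    by (rule nn_integral_cmult) simp
  also have "(\<integral>\<^sup>+t. ennreal (\<bar>X' t\<bar> * \<phi> (X t)) * indicator {0<..} t \<partial>lborel)
      = (\<integral>\<^sup>+x. ennreal (\<phi> x) * indicator (X ` {0<..}) x \<partial>lborel)"
  proof (rule nn_integral_change_of_variables[symmetric])
    have mono: "X s < X t" if "0 < s" "s < t" for s t
    proof -
      have 1: "sqrt s < sqrt t" "0 < sqrt s" using that by auto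
      then have "k / sqrt t < k / sqrt s" using k by (intro divide_strict_left_mono) auto
      with 1(1) show ?thesis unfolding X_def by linarith
    qed
    show "inj_on X {0<..}"
      by (rule linorder_inj_onI) (use mono in force)+
    show "X ` {0<..} \<in> sets borel" by (simp add: surj)
    show "(X has_field_derivative X' x) (at x within {0<..})" if "x \<in> {0<..}" for x
    proof -
      have x: "x > 0" using that by simp
      have "(X has_field_derivative (inverse (sqrt x) / 2 - (- (k * (inverse (sqrt x) / 2)) / (sqrt x * sqrt x)))) (at x within {0<..})"
        unfolding X_def[abs_def] using x
        by (auto intro!: derivative_eq_intros simp: field_simps)
      moreover have "inverse (sqrt x) / 2 - (- (k * (inverse (sqrt x) / 2)) / (sqrt x * sqrt x)) = X' x"
        using x by (simp add: X'_def field_simps)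
      ultimately show ?thesis by simp
    qed
    show "(\<lambda>x. \<bar>X' x\<bar> * \<phi> (X x) * indicator {0<..} x) \<in> borel_measurable borel" by measurable
  qed (auto simp: \<phi>_def)
  also note surj
  also have "(\<integral>\<^sup>+x. ennreal (\<phi> x) * indicator UNIV x \<partial>lborel) = 1"
    using nn_integral_std_normal by (simp add: \<phi>_def)
  finally have "I + I = ennreal (exp (- k)) + ennreal (exp (- k))"
    by (simp add: ennreal_plus[symmetric] del: ennreal_plus)
  then have "2 * I = 2 * ennreal (exp (- k))" by (simp add: mult_2)
  then have "I = ennreal (exp (- k))"
    by (subst (asm) ennreal_mult_cancel_left) auto
  then show ?thesis by (simp add: I_def F_def)
qed

text \<open>
  Scaling by \<open>\<theta>\<^sup>2\<close> brings all parameters into \<open>k = \<theta> e\<close>.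
\<close>

lemma single_integral:
  fixes \<theta> e :: real
  assumes \<theta>: "\<theta> > 0" and e: "e \<ge> 0"
  shows "(\<integral>\<^sup>+h. ennreal (\<theta> * exp (- (\<theta>\<^sup>2 * h + e\<^sup>2 / h) / 2) / sqrt (2 * pi * h)) * indicator {0<..} h \<partial>lborel)
       = ennreal (exp (- (\<theta> * e)))"
proof -
  let ?k = "\<theta> * e"
  let ?F = "\<lambda>h. ennreal (exp (- (0 + \<theta>\<^sup>2 * h + ?k\<^sup>2 / (0 + \<theta>\<^sup>2 * h)) / 2) / sqrt (2 * pi * (0 + \<theta>\<^sup>2 * h))) * indicator {0<..} (0 + \<theta>\<^sup>2 * h)"
    and ?G = "\<lambda>h. ennreal (\<theta> * exp (- (\<theta>\<^sup>2 * h + e\<^sup>2 / h) / 2) / sqrt (2 * pi * h)) * indicator {0<..} h"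
  have "ennreal (exp (- ?k)) = (\<integral>\<^sup>+t. ennreal (exp (- (t + ?k\<^sup>2 / t) / 2) / sqrt (2 * pi * t)) * indicator {0<..} t \<partial>lborel)"
    using \<theta> e by (intro inverse_gaussian_integral[symmetric]) auto
  also have "\<dots> = ennreal (\<bar>\<theta>\<^sup>2\<bar>) * (\<integral>\<^sup>+h. ?F h \<partial>lborel)"
    using \<theta> by (intro nn_integral_real_affine) auto
  also have "\<dots> = (\<integral>\<^sup>+h. ennreal (\<bar>\<theta>\<^sup>2\<bar>) * (?F h) \<partial>lborel)"
    by (rule nn_integral_cmult[symmetric]) auto
  also have "\<dots> = (\<integral>\<^sup>+h. ?G h \<partial>lborel)"
  proof (intro nn_integral_cong)
    fix h :: real
    have "sqrt (2 * pi * (\<theta>\<^sup>2 * h)) = \<theta> * sqrt (2 * pi * h)"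
      using \<theta> by (simp add: real_sqrt_mult)
    moreover have "?k\<^sup>2 / (\<theta>\<^sup>2 * h) = e\<^sup>2 / h" using \<theta> by (simp add: power_mult_distrib)
    moreover have "\<theta>\<^sup>2 * (E / (\<theta> * s)) = \<theta> * E / s" for E s using \<theta> by (simp add: power2_eq_square)
    ultimately have "\<theta>\<^sup>2 * (exp (- (\<theta>\<^sup>2 * h + ?k\<^sup>2 / (\<theta>\<^sup>2 * h)) / 2) / sqrt (2 * pi * (\<theta>\<^sup>2 * h)))
       = \<theta> * exp (- (\<theta>\<^sup>2 * h + e\<^sup>2 / h) / 2) / sqrt (2 * pi * h)" by (simp only:)
    moreover have "indicator {0<..} (\<theta>\<^sup>2 * h) = (indicator {0<..} h :: ennreal)"
      using \<theta> by (simp add: indicator_def zero_less_mult_iff)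
    ultimately show "ennreal (\<bar>\<theta>\<^sup>2\<bar>) * (?F h)
       = ?G h"
      unfolding mult.assoc[symmetric] add_0 abs_power2
      by (subst ennreal_mult'[symmetric]) simp_all
  qed
  finally show ?thesis ..
qed

text \<open>
  If \<open>a c > 0\<close>, both sides are \<open>K\<^sub>0 (r x y)\<close> with \<open>r = sqrt (a c)\<close>: on the left substitute
  \<open>h = r cosh s\<close>; on the right a shift of \<open>u\<close> balances the two exponentials into a multiple of
  \<open>cosh (2 u)\<close>. If \<open>a c = 0\<close>, both sides are infinite.
\<close>

lemma bessel_integral:
  fixes a c x y :: real
  assumes a: "a \<ge> 0" and c: "c \<ge> 0" and x: "x > 0" and y: "y > 0"
  shows "(\<integral>\<^sup>+h. ennreal (exp (- (h * (x * y))) / sqrt (h\<^sup>2 - a * c)) * indicator {h. h > 0 \<and> h\<^sup>2 > a * c} h \<partial>lborel)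
       = (\<integral>\<^sup>+u. ennreal (exp (- (a * y\<^sup>2 * exp (2 * u) + c * x\<^sup>2 * exp (- 2 * u)) / 2)) \<partial>lborel)" (is "?L = ?R")
proof (cases "a * c = 0")
  case True
  have *: "2 * emeasure lborel {0::real<..} = 2 * top"
    using nn_integral_even[of "\<lambda>_. 1"] by (simp add: ennreal_mult_top)
  have em: "emeasure lborel {0::real<..} = top"
    using * by (subst (asm) ennreal_mult_cancel_left) auto
  have "emeasure lborel {..<0::real} = (\<integral>\<^sup>+x. indicator {..<0::real} x \<partial>lborel)" by simp
  also have "\<dots> = ennreal (\<bar>-1\<bar>) * (\<integral>\<^sup>+x. indicator {..<0::real} (0 + (-1) * x) \<partial>lborel)"
    by (rule nn_integral_real_affine) simp_all
  also have "\<dots> = (\<integral>\<^sup>+x. indicator {0::real<..} x \<partial>lborel)"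
    by (simp add: indicator_def)
  finally have em': "emeasure lborel {..<0::real} = top" using em by simp
  have inf: "(\<integral>\<^sup>+(u::real). ennreal d * indicator {0<..} u \<partial>lborel) = top" "(\<integral>\<^sup>+(u::real). ennreal d * indicator {..<0} u \<partial>lborel) = top"
    if "d > 0" for d :: real
    using that by (simp_all add: nn_integral_cmult em em' ennreal_mult_top)
  have "?R = top"
  proof (cases "a = 0")
    case True
    have "(\<integral>\<^sup>+(u::real). ennreal (exp (- (c * x\<^sup>2) / 2)) * indicator {0<..} u \<partial>lborel) \<le> ?R"
      using True c by (intro nn_integral_mono) (auto simp: indicator_def mult_left_le)
    then show ?thesis by (simp add: inf top_unique)
  next
    case False
    with \<open>a * c = 0\<close> have "c = 0" by simp
    have "(\<integral>\<^sup>+(u::real). ennreal (exp (- (a * y\<^sup>2) / 2)) * indicator {..<0} u \<partial>lborel) \<le> ?R"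
      using \<open>c = 0\<close> a by (intro nn_integral_mono) (auto simp: indicator_def mult_left_le)
    then show ?thesis by (simp add: inf top_unique)
  qed
  moreover have "?L = top"
  proof -
    have im: "exp ` (UNIV :: real set) = {0<..}"
    proof (intro set_eqI iffI)
      fix x :: real assume "x \<in> {0<..}"
      then show "x \<in> range exp" by (intro range_eqI[of _ _ "ln x"]) simp
    qed auto
    have "?L = (\<integral>\<^sup>+h. ennreal (exp (- (h * (x * y))) / \<bar>h\<bar>) * indicator (exp ` UNIV) h \<partial>lborel)"
      using True by (intro nn_integral_cong) (auto simp: indicator_def im)
    also have "\<dots> = (\<integral>\<^sup>+s. ennreal (\<bar>exp s\<bar> * (exp (- (exp s * (x * y))) / \<bar>exp s\<bar>)) * indicator UNIV s \<partial>lborel)"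
      by (rule nn_integral_change_of_variables) (auto simp: im intro!: derivative_eq_intros inj_onI)
    also have "\<dots> \<ge> (\<integral>\<^sup>+(s::real). ennreal (exp (- (x * y))) * indicator {..<0} s \<partial>lborel)"
      using x y by (intro nn_integral_mono) (auto simp: indicator_def mult_right_le_one_le mult_left_le_one_le)
    finally show ?thesis by (simp add: inf top_unique)
  qed
  ultimately show ?thesis by simp
next
  case False
  with a c have a: "a > 0" and c: "c > 0" by auto
  define r where "r = sqrt (a * c)"
  have r: "r > 0" "r\<^sup>2 = a * c" using a c by (auto simp: r_def)
  \<comment> \<open>the shift for which \<open>a y\<^sup>2 exp (-d) = r x y = c x\<^sup>2 exp d\<close>\<close>
  define d where "d = ln (a * y / (r * x))"
  have ed: "exp d = a * y / (r * x)" unfolding d_def using a x y r by simp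
  have im: "(\<lambda>s. r * cosh s) ` {0<..} = {h. h > 0 \<and> h\<^sup>2 > a * c}"
  proof (intro set_eqI iffI)
    fix h assume "h \<in> {h. h > 0 \<and> h\<^sup>2 > a * c}"
    then have h: "h > 0" "h\<^sup>2 > r\<^sup>2" using r by auto
    then have "h > r" using r by (simp add: power2_less_imp_less)
    then have "h / r > 1" using r by simp
    then show "h \<in> (\<lambda>s. r * cosh s) ` {0<..}" using r
      by (intro image_eqI[of _ _ "arcosh (h / r)"]) auto
  next
    fix h assume "h \<in> (\<lambda>s. r * cosh s) ` {0<..}"
    then obtain s where s: "s > 0" "h = r * cosh s" by auto
    have "cosh 0 < cosh s" using s by (intro cosh_real_strict_mono) auto
    then have "h > r" using s r by simp
    then show "h \<in> {h. h > 0 \<and> h\<^sup>2 > a * c}" using r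
      by (auto simp: r(2)[symmetric] intro!: power_strict_mono)
  qed
  have inj: "inj_on (\<lambda>s. r * cosh s) {0<..}"
    using r by (auto simp: inj_on_def)
  have meas: "{h::real. h > 0 \<and> h\<^sup>2 > a * c} \<in> sets borel" by measurable
  have cm[measurable]: "(cosh :: real \<Rightarrow> real) \<in> borel_measurable borel" "(sinh :: real \<Rightarrow> real) \<in> borel_measurable borel"
    by (auto intro!: borel_measurable_continuous_onI continuous_intros)
  let ?f = "\<lambda>s. ennreal (exp (- (r * cosh s * (x * y))))"
  have "?L = (\<integral>\<^sup>+h. ennreal (exp (- (h * (x * y))) / sqrt (h\<^sup>2 - a * c)) * indicator ((\<lambda>s. r * cosh s) ` {0<..}) h \<partial>lborel)"
    by (simp add: im)
  also have "\<dots> = (\<integral>\<^sup>+s. ennreal (\<bar>r * sinh s\<bar> * (exp (- (r * cosh s * (x * y))) / sqrt ((r * cosh s)\<^sup>2 - a * c))) * indicator {0<..} s \<partial>lborel)"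
  proof (rule nn_integral_change_of_variables)
    show "(\<lambda>s. r * cosh s) ` {0<..} \<in> sets borel" unfolding im by (rule meas)
    show "exp (- (h * (x * y))) / sqrt (h\<^sup>2 - a * c) \<ge> 0" if "h \<in> (\<lambda>s. r * cosh s) ` {0<..}" for h
      using that unfolding im by simp
  qed (auto simp: inj intro!: derivative_eq_intros)
  also have "\<dots> = (\<integral>\<^sup>+s. ?f s * indicator {0<..} s \<partial>lborel)"
  proof (intro nn_integral_cong)
    fix s :: real
    have "(r * cosh s)\<^sup>2 - a * c = (r * sinh s)\<^sup>2"
      by (simp add: power_mult_distrib cosh_square_eq r algebra_simps)
    then have *: "sqrt ((r * cosh s)\<^sup>2 - a * c) = \<bar>r * sinh s\<bar>" by simp
    show "ennreal (\<bar>r * sinh s\<bar> * (exp (- (r * cosh s * (x * y))) / sqrt ((r * cosh s)\<^sup>2 - a * c))) * indicator {0<..} s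
       = ?f s * indicator {0<..} s"
      unfolding * using r by (auto simp: indicator_def)
  qed
  finally have L: "?L = (\<integral>\<^sup>+s. ?f s * indicator {0<..} s \<partial>lborel)" .
  have "2 * (\<integral>\<^sup>+s. ?f s * indicator {0<..} s \<partial>lborel) = (\<integral>\<^sup>+s. ?f s \<partial>lborel)"
    by (rule nn_integral_even[symmetric]) auto
  also have "\<dots> = ennreal (\<bar>2\<bar>) * (\<integral>\<^sup>+u. ?f (d + 2 * u) \<partial>lborel)"
    by (rule nn_integral_real_affine) auto
  also have "(\<integral>\<^sup>+u. ?f (d + 2 * u) \<partial>lborel) = ?R"
  proof (intro nn_integral_cong arg_cong[where f = ennreal] arg_cong[where f = exp])
    fix u
    have e1: "exp (d + 2 * u) = a * y / (r * x) * exp (2 * u)" by (simp add: exp_add ed)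
    have "exp (- (d + 2 * u)) = inverse (exp d) * exp (- 2 * u)"
      by (simp only: exp_minus[symmetric] mult_exp_exp) simp
    also have "inverse (exp d) = r * x / (a * y)" by (simp add: ed)
    also have "\<dots> = c * x / (r * y)"
    proof -
      have "r * x * (r * y) = c * x * (a * y)" using r(2) by algebra
      then show ?thesis using r a y by (simp add: frac_eq_eq)
    qed
    finally have e2: "exp (- (d + 2 * u)) = c * x / (r * y) * exp (- 2 * u)" .
    have "r * cosh (d + 2 * u) * (x * y) = (r * (x * y) * exp (d + 2 * u) + r * (x * y) * exp (- (d + 2 * u))) / 2"
      by (simp add: cosh_def algebra_simps)
    also have "r * (x * y) * exp (d + 2 * u) = a * y\<^sup>2 * exp (2 * u)"
      unfolding e1 using r x by (simp add: power2_eq_square)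
    also have "r * (x * y) * exp (- (d + 2 * u)) = c * x\<^sup>2 * exp (- 2 * u)"
      unfolding e2 using r y by (simp add: power2_eq_square)
    finally show "- (r * cosh (d + 2 * u) * (x * y)) = - (a * y\<^sup>2 * exp (2 * u) + c * x\<^sup>2 * exp (- 2 * u)) / 2"
      by simp
  qed
  finally have "2 * (\<integral>\<^sup>+s. ?f s * indicator {0<..} s \<partial>lborel) = 2 * ?R" by simp
  then show ?thesis unfolding L by (subst (asm) ennreal_mult_cancel_left) auto
qed

text \<open>
  Let \<open>Q h\<close> be the quotient in the exponent on the left. An auxiliary variable \<open>t > Q h\<close> writes
  \<open>exp (- Q h / 2)\<close> as an integral. The product of \<open>t - Q h\<close> and \<open>h\<^sup>2 - a c\<close> is, for fixed \<open>t\<close>, again of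
  the form \<open>t ((h - m)\<^sup>2 - a' c')\<close> with \<open>a' = a + e\<^sup>2/t\<close>, \<open>c' = c + f\<^sup>2/t\<close> and \<open>m = e f/t\<close>, and the region of
  integration becomes \<open>h - m > sqrt (a' c')\<close>. So the integral over \<open>h\<close> is a Bessel integral without field. In
  its other representation the terms with \<open>1/t\<close> form the square of \<open>f x exp (-u) + e y exp u\<close>, and
  the integral over \<open>t\<close> is the inverse Gaussian one.
\<close>

lemma pair_integral:
  fixes a c x y e f :: real
  assumes a: "a \<ge> 0" and c: "c \<ge> 0" and x: "x > 0" and y: "y > 0" and e: "e \<ge> 0" and f: "f \<ge> 0"
  shows "(\<integral>\<^sup>+h. ennreal (exp (- (h * (x * y)) - (2 * h * e * f + a * f\<^sup>2 + c * e\<^sup>2) / (h\<^sup>2 - a * c) / 2) / sqrt (h\<^sup>2 - a * c))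
            * indicator {h. h > 0 \<and> h\<^sup>2 > a * c} h \<partial>lborel)
       = (\<integral>\<^sup>+u. ennreal (exp (- (a * y\<^sup>2 * exp (2 * u) + c * x\<^sup>2 * exp (- 2 * u)) / 2 - f * x * exp (- u) - e * y * exp u)) \<partial>lborel)"
    (is "?L = ?R")
proof -
  let ?K = "\<lambda>u. exp (- (a * y\<^sup>2 * exp (2 * u) + c * x\<^sup>2 * exp (- 2 * u)) / 2)"
    and ?G = "\<lambda>t u. exp (- (t + (f * x * exp (- u) + e * y * exp u)\<^sup>2 / t) / 2) / sqrt (2 * pi * t)"
  define N where "N h = 2 * h * e * f + a * f\<^sup>2 + c * e\<^sup>2" for h
  define D where "D = {h. h > 0 \<and> h\<^sup>2 > a * c}"
  define Q where "Q h = N h / (h\<^sup>2 - a * c)" for h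
  define P where "P t h = exp (- t / 2 - h * (x * y)) / sqrt (2 * pi * ((t - Q h) * (h\<^sup>2 - a * c)))" for t h
  define B where "B = {(h, t). h \<in> D \<and> t > Q h}"
  have [measurable]: "D \<in> sets borel" unfolding D_def by measurable
  have [measurable]: "Q \<in> borel_measurable borel" unfolding Q_def[abs_def] N_def by measurable
  have Dm: "Measurable.pred borel (\<lambda>h. h \<in> D)" by measurable
  have Pm[measurable]: "(\<lambda>(h, t). ennreal (P t h) * indicator B (h, t)) \<in> borel_measurable (lborel \<Otimes>\<^sub>M lborel)"
  proof -
    have "B \<in> sets (lborel \<Otimes>\<^sub>M lborel)"
    proof -
      have "B = {z \<in> space (lborel \<Otimes>\<^sub>M lborel). fst z \<in> D \<and> snd z > Q (fst z)}"
        by (auto simp: B_def space_pair_measure)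
      also have "\<dots> \<in> sets (lborel \<Otimes>\<^sub>M lborel)" by measurable
      finally show ?thesis .
    qed
    then show ?thesis unfolding P_def by (auto simp: case_prod_beta')
  qed
  have N0: "N h \<ge> 0" if "h > 0" for h using that a c e f by (simp add: N_def)
  have half: "(\<integral>\<^sup>+t. ennreal (exp (- t / 2) / sqrt (2 * pi * (t - q))) * indicator {q<..} t \<partial>lborel) = ennreal (exp (- q / 2))" for q
  proof -
    have "(\<integral>\<^sup>+t. ennreal (exp (- t / 2) / sqrt (2 * pi * (t - q))) * indicator {q<..} t \<partial>lborel)
       = ennreal (\<bar>1\<bar>) * (\<integral>\<^sup>+t. ennreal (exp (- (q + 1 * t) / 2) / sqrt (2 * pi * ((q + 1 * t) - q))) * indicator {q<..} (q + 1 * t) \<partial>lborel)"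
      by (rule nn_integral_real_affine) simp_all
    also have "\<dots> = (\<integral>\<^sup>+t. ennreal (exp (- (q + t) / 2) / sqrt (2 * pi * t)) * indicator {0<..} t \<partial>lborel)"
      by (simp add: indicator_def)
    also have "\<dots> = (\<integral>\<^sup>+t. ennreal (exp (- q / 2)) * (ennreal (exp (- (t + 0\<^sup>2 / t) / 2) / sqrt (2 * pi * t)) * indicator {0<..} t) \<partial>lborel)"
    proof (intro nn_integral_cong)
      fix t :: real
      have "exp (- (q + t) / 2) / sqrt (2 * pi * t) = exp (- q / 2) * (exp (- (t + 0\<^sup>2 / t) / 2) / sqrt (2 * pi * t))"
        by (simp add: mult_exp_exp add_divide_distrib diff_divide_distrib)
      then show "ennreal (exp (- (q + t) / 2) / sqrt (2 * pi * t)) * indicator {0<..} t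
         = ennreal (exp (- q / 2)) * (ennreal (exp (- (t + 0\<^sup>2 / t) / 2) / sqrt (2 * pi * t)) * indicator {0<..} t)"
        by (simp only: ennreal_mult' exp_ge_zero mult.assoc)
    qed
    also have "\<dots> = ennreal (exp (- q / 2)) * (\<integral>\<^sup>+t. ennreal (exp (- (t + 0\<^sup>2 / t) / 2) / sqrt (2 * pi * t)) * indicator {0<..} t \<partial>lborel)"
      by (rule nn_integral_cmult) simp
    finally show ?thesis using inverse_gaussian_integral[of 0] by simp
  qed
  have "?L = (\<integral>\<^sup>+h. (\<integral>\<^sup>+t. ennreal (P t h) * indicator B (h, t) \<partial>lborel) \<partial>lborel)"
  proof (intro nn_integral_cong)
    fix h :: real
    show "ennreal (exp (- (h * (x * y)) - (2 * h * e * f + a * f\<^sup>2 + c * e\<^sup>2) / (h\<^sup>2 - a * c) / 2) / sqrt (h\<^sup>2 - a * c))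
            * indicator {h. h > 0 \<and> h\<^sup>2 > a * c} h = (\<integral>\<^sup>+t. ennreal (P t h) * indicator B (h, t) \<partial>lborel)"
    proof (cases "h \<in> D")
      case True
      define s where "s = exp (- (h * (x * y))) / sqrt (h\<^sup>2 - a * c)"
      have s: "s \<ge> 0" using True by (simp add: s_def D_def)
      have "(\<integral>\<^sup>+t. ennreal (P t h) * indicator B (h, t) \<partial>lborel)
        = (\<integral>\<^sup>+t. ennreal s * (ennreal (exp (- t / 2) / sqrt (2 * pi * (t - Q h))) * indicator {Q h<..} t) \<partial>lborel)"
      proof (intro nn_integral_cong)
        fix t
        have "exp (- t / 2 - h * (x * y)) = exp (- t / 2) * exp (- (h * (x * y)))"
          by (simp add: mult_exp_exp)
        moreover have "sqrt (2 * pi * ((t - Q h) * (h\<^sup>2 - a * c))) = sqrt (2 * pi * (t - Q h)) * sqrt (h\<^sup>2 - a * c)"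
          by (simp only: real_sqrt_mult mult.assoc)
        moreover have "A * B / (C * D) = B / D * (A / C)" for A B C D :: real by (simp add: mult.commute)
        ultimately have "P t h = s * (exp (- t / 2) / sqrt (2 * pi * (t - Q h)))"
          unfolding P_def s_def by (simp only:)
        then show "ennreal (P t h) * indicator B (h, t)
          = ennreal s * (ennreal (exp (- t / 2) / sqrt (2 * pi * (t - Q h))) * indicator {Q h<..} t)"
          using s True by (simp only: ennreal_mult' mult.assoc) (simp add: B_def indicator_def)
      qed
      also have "\<dots> = ennreal s * (\<integral>\<^sup>+t. ennreal (exp (- t / 2) / sqrt (2 * pi * (t - Q h))) * indicator {Q h<..} t \<partial>lborel)"
        by (rule nn_integral_cmult) simp
      also have "\<dots> = ennreal s * ennreal (exp (- Q h / 2))" by (simp only: half)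
      also have "\<dots> = ennreal (s * exp (- Q h / 2))" by (simp only: ennreal_mult' s)
      also have "s * exp (- Q h / 2) = exp (- (h * (x * y)) - (2 * h * e * f + a * f\<^sup>2 + c * e\<^sup>2) / (h\<^sup>2 - a * c) / 2) / sqrt (h\<^sup>2 - a * c)"
      proof -
        have "exp (- (h * (x * y)) - Q h / 2) = exp (- (h * (x * y))) * exp (- Q h / 2)"
          by (simp add: mult_exp_exp)
        then show ?thesis by (simp add: s_def Q_def N_def)
      qed
      finally show ?thesis using True by (simp add: D_def)
    next
      case False
      then show ?thesis by (simp add: B_def) (simp add: D_def)
    qed
  qed
  also have "\<dots> = (\<integral>\<^sup>+t. (\<integral>\<^sup>+h. ennreal (P t h) * indicator B (h, t) \<partial>lborel) \<partial>lborel)"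
    using lborel_pair.Fubini'[of "\<lambda>h t. ennreal (P t h) * indicator B (h, t)"] Pm by simp
  also have "\<dots> = (\<integral>\<^sup>+t. (\<integral>\<^sup>+u. ennreal (?K u)
       * (ennreal (?G t u) * indicator {0<..} t) \<partial>lborel) \<partial>lborel)"
  proof (rule nn_integral_cong)
    fix t :: real
    show "(\<integral>\<^sup>+h. ennreal (P t h) * indicator B (h, t) \<partial>lborel)
       = (\<integral>\<^sup>+u. ennreal (?K u)
       * (ennreal (?G t u) * indicator {0<..} t) \<partial>lborel)"
    proof (cases "t > 0")
      case False
      have "(h, t) \<notin> B" for h
      proof
        assume "(h, t) \<in> B"
        then have h: "h \<in> D" "t > Q h" by (auto simp: B_def)
        then have "Q h \<ge> 0" using N0[of h] by (simp add: Q_def D_def)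
        then show False using h False by simp
      qed
      then show ?thesis using False by simp
    next
      case t: True
      define m where "m = e * f / t"
      define a' where "a' = a + e\<^sup>2 / t"
      define c' where "c' = c + f\<^sup>2 / t"
      have m: "m \<ge> 0" "a' \<ge> 0" "c' \<ge> 0" using a c e f t by (auto simp: m_def a'_def c'_def)
      have key: "t * (h\<^sup>2 - a * c) - N h = t * ((h - m)\<^sup>2 - a' * c')" for h
      proof -
        have "t * m = e * f" "t * a' = t * a + e\<^sup>2" "t * c' = t * c + f\<^sup>2"
          using t by (simp_all add: m_def a'_def c'_def field_simps)
        then have "t * (t * (h\<^sup>2 - a * c) - N h) = t * (t * ((h - m)\<^sup>2 - a' * c'))"
          unfolding N_def by algebra
        then show ?thesis using t by simp
      qed
      have Biff: "(h, t) \<in> B \<longleftrightarrow> h - m > 0 \<and> (h - m)\<^sup>2 > a' * c'" for h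
      proof
        assume "(h, t) \<in> B"
        then have h: "h > 0" "h\<^sup>2 > a * c" "t > Q h" by (auto simp: B_def D_def)
        then have N: "t * (h\<^sup>2 - a * c) > N h" by (simp add: Q_def field_simps)
        then have "t * ((h - m)\<^sup>2 - a' * c') > 0" using key[of h] by linarith
        then have 1: "(h - m)\<^sup>2 > a' * c'" using t by (simp add: zero_less_mult_iff)
        have "h * t > e * f"
        proof (rule ccontr)
          assume "\<not> h * t > e * f"
          then have "h * (h * t) \<le> h * (e * f)" using h by (intro mult_left_mono) auto
          moreover have "t * (a * c) \<ge> 0" using t a c by simp
          ultimately have "t * (h\<^sup>2 - a * c) \<le> h * (e * f)" by (simp add: power2_eq_square algebra_simps)
          moreover have "N h \<ge> h * (e * f)"
          proof -
            have "h * (e * f) \<ge> 0" "a * f\<^sup>2 \<ge> 0" "c * e\<^sup>2 \<ge> 0" using h a c e f by auto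
            then show ?thesis unfolding N_def by linarith
          qed
          ultimately show False using N by linarith
        qed
        then have "h - m > 0" using t by (simp add: m_def field_simps)
        with 1 show "h - m > 0 \<and> (h - m)\<^sup>2 > a' * c'" by blast
      next
        assume h: "h - m > 0 \<and> (h - m)\<^sup>2 > a' * c'"
        then have h0: "h > 0" using m by linarith
        have "t * ((h - m)\<^sup>2 - a' * c') > 0" using h t by simp
        then have N: "t * (h\<^sup>2 - a * c) > N h" using key[of h] by linarith
        then have "t * (h\<^sup>2 - a * c) > 0" using N0[OF h0] by linarith
        then have "h\<^sup>2 > a * c" using t by (simp add: zero_less_mult_iff)
        moreover from this have "t > Q h" using N by (simp add: Q_def field_simps)
        ultimately show "(h, t) \<in> B" using h0 by (simp add: B_def D_def)
      qed
      define g where "g h = ennreal (exp (- (h * (x * y))) / sqrt (h\<^sup>2 - a' * c')) * indicator {h. h > 0 \<and> h\<^sup>2 > a' * c'} h" for h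
      have gm: "g \<in> borel_measurable borel" unfolding g_def[abs_def] by measurable
      define s where "s = exp (- t / 2 - m * (x * y)) / sqrt (2 * pi * t)"
      have s: "s \<ge> 0" using t by (simp add: s_def)
      have Pg: "ennreal (P t h) * indicator B (h, t) = ennreal s * g (- m + 1 * h)" for h
      proof (cases "(h, t) \<in> B")
        case True
        then have h2: "h\<^sup>2 - a * c \<noteq> 0" by (auto simp: B_def D_def)
        have "(t - Q h) * (h\<^sup>2 - a * c) = t * ((h - m)\<^sup>2 - a' * c')"
          using h2 by (simp add: key[symmetric] Q_def left_diff_distrib)
        moreover have "exp (- t / 2 - h * (x * y)) = exp (- t / 2 - m * (x * y)) * exp (- ((h - m) * (x * y)))"
          by (simp add: mult_exp_exp algebra_simps)
        moreover have "sqrt (2 * pi * (t * ((h - m)\<^sup>2 - a' * c'))) = sqrt (2 * pi * t) * sqrt ((h - m)\<^sup>2 - a' * c')"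
          by (simp only: real_sqrt_mult mult.assoc)
        moreover have "A * B / (C * D) = A / C * (B / D)" for A B C D :: real by simp
        ultimately have "P t h = s * (exp (- ((h - m) * (x * y))) / sqrt ((h - m)\<^sup>2 - a' * c'))"
          unfolding P_def s_def by (simp only:)
        then show ?thesis
          using True Biff[of h] s by (simp add: g_def ennreal_mult'[symmetric])
      next
        case False
        then show ?thesis using Biff[of h] by (auto simp: g_def indicator_def)
      qed
      have "(\<integral>\<^sup>+h. ennreal (P t h) * indicator B (h, t) \<partial>lborel) = ennreal s * (\<integral>\<^sup>+h. g (- m + 1 * h) \<partial>lborel)"
        unfolding Pg using gm by (intro nn_integral_cmult) simp
      also have "(\<integral>\<^sup>+h. g (- m + 1 * h) \<partial>lborel) = (\<integral>\<^sup>+h. g h \<partial>lborel)"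
        using nn_integral_real_affine[OF gm, of 1 "- m"] by simp
      also have "(\<integral>\<^sup>+h. g h \<partial>lborel) = (\<integral>\<^sup>+u. ennreal (exp (- (a' * y\<^sup>2 * exp (2 * u) + c' * x\<^sup>2 * exp (- 2 * u)) / 2)) \<partial>lborel)"
        unfolding g_def by (rule bessel_integral[OF m(2,3) x y])
      also have "ennreal s * \<dots> = (\<integral>\<^sup>+u. ennreal s * ennreal (exp (- (a' * y\<^sup>2 * exp (2 * u) + c' * x\<^sup>2 * exp (- 2 * u)) / 2)) \<partial>lborel)"
        by (rule nn_integral_cmult[symmetric]) simp
      also have "\<dots> = (\<integral>\<^sup>+u. ennreal (?K u)
       * (ennreal (?G t u) * indicator {0<..} t) \<partial>lborel)"
      proof (intro nn_integral_cong)
        fix u :: real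
        define E where "E = exp u"
        define F where "F = exp (- u)"
        have EF: "E * F = 1" "exp (2 * u) = E\<^sup>2" "exp (- 2 * u) = F\<^sup>2"
          by (simp_all add: E_def F_def mult_exp_exp power2_eq_square)
        have "(f * x * F + e * y * E)\<^sup>2 = f\<^sup>2 * x\<^sup>2 * F\<^sup>2 + e\<^sup>2 * y\<^sup>2 * E\<^sup>2 + 2 * (e * f * (x * y))"
          using EF(1) by algebra
        then have "(f * x * F + e * y * E)\<^sup>2 / t = f\<^sup>2 / t * x\<^sup>2 * F\<^sup>2 + e\<^sup>2 / t * y\<^sup>2 * E\<^sup>2 + 2 * (m * (x * y))"
          by (simp add: m_def add_divide_distrib)
        moreover have "a' * y\<^sup>2 * E\<^sup>2 = a * y\<^sup>2 * E\<^sup>2 + e\<^sup>2 / t * y\<^sup>2 * E\<^sup>2"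
          "c' * x\<^sup>2 * F\<^sup>2 = c * x\<^sup>2 * F\<^sup>2 + f\<^sup>2 / t * x\<^sup>2 * F\<^sup>2"
          by (simp_all only: a'_def c'_def distrib_right)
        moreover have "(- t / 2 - M) + (- (A + C) / 2) = (- (A0 + C0) / 2) + (- (t + S) / 2)"
          if "S = C1 + A1 + 2 * M" "A = A0 + A1" "C = C0 + C1" for A A0 A1 C C0 C1 M S :: real
          using that by (simp add: field_simps)
        ultimately have ex: "(- t / 2 - m * (x * y)) + (- (a' * y\<^sup>2 * E\<^sup>2 + c' * x\<^sup>2 * F\<^sup>2) / 2)
           = (- (a * y\<^sup>2 * E\<^sup>2 + c * x\<^sup>2 * F\<^sup>2) / 2) + (- (t + (f * x * F + e * y * E)\<^sup>2 / t) / 2)"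
          by blast
        have "s * exp (- (a' * y\<^sup>2 * E\<^sup>2 + c' * x\<^sup>2 * F\<^sup>2) / 2)
          = exp ((- t / 2 - m * (x * y)) + (- (a' * y\<^sup>2 * E\<^sup>2 + c' * x\<^sup>2 * F\<^sup>2) / 2)) / sqrt (2 * pi * t)"
          unfolding s_def by (simp only: exp_add times_divide_eq_left)
        also have "\<dots> = exp (- (a * y\<^sup>2 * E\<^sup>2 + c * x\<^sup>2 * F\<^sup>2) / 2) * (exp (- (t + (f * x * F + e * y * E)\<^sup>2 / t) / 2) / sqrt (2 * pi * t))"
          unfolding ex by (simp only: exp_add times_divide_eq_right)
        finally have "ennreal s * ennreal (exp (- (a' * y\<^sup>2 * E\<^sup>2 + c' * x\<^sup>2 * F\<^sup>2) / 2))
           = ennreal (exp (- (a * y\<^sup>2 * E\<^sup>2 + c * x\<^sup>2 * F\<^sup>2) / 2))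
           * ennreal (exp (- (t + (f * x * F + e * y * E)\<^sup>2 / t) / 2) / sqrt (2 * pi * t))"
          by (simp only: ennreal_mult'[symmetric] s exp_ge_zero)
        moreover have "indicator {0<..} t = (1::ennreal)" using t by simp
        ultimately show "ennreal s * ennreal (exp (- (a' * y\<^sup>2 * exp (2 * u) + c' * x\<^sup>2 * exp (- 2 * u)) / 2))
           = ennreal (?K u)
           * (ennreal (?G t u) * indicator {0<..} t)"
          unfolding EF(2,3) E_def[symmetric] F_def[symmetric] by (simp only: mult_1_right)
      qed
      finally show ?thesis .
    qed
  qed
  also have "\<dots> = (\<integral>\<^sup>+u. (\<integral>\<^sup>+t. ennreal (?K u)
       * (ennreal (?G t u) * indicator {0<..} t) \<partial>lborel) \<partial>lborel)"
    by (rule lborel_pair.Fubini') measurable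
  also have "\<dots> = ?R"
  proof (intro nn_integral_cong)
    fix u :: real
    define k where "k = f * x * exp (- u) + e * y * exp u"
    have k: "k \<ge> 0" using x y e f by (simp add: k_def)
    have "(\<integral>\<^sup>+t. ennreal (?K u)
       * (ennreal (exp (- (t + k\<^sup>2 / t) / 2) / sqrt (2 * pi * t)) * indicator {0<..} t) \<partial>lborel)
      = ennreal (?K u) *
       (\<integral>\<^sup>+t. ennreal (exp (- (t + k\<^sup>2 / t) / 2) / sqrt (2 * pi * t)) * indicator {0<..} t \<partial>lborel)"
      by (rule nn_integral_cmult) simp
    also have "\<dots> = ennreal (?K u * exp (- k))"
      by (simp only: inverse_gaussian_integral[OF k] ennreal_mult' exp_ge_zero)
    also have "?K u * exp (- k)
      = exp (- (a * y\<^sup>2 * exp (2 * u) + c * x\<^sup>2 * exp (- 2 * u)) / 2 - f * x * exp (- u) - e * y * exp u)"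
      by (simp only: mult_exp_exp k_def minus_add_distrib diff_conv_add_uminus add.assoc)
    finally show "(\<integral>\<^sup>+t. ennreal (?K u)
       * (ennreal (?G t u) * indicator {0<..} t) \<partial>lborel)
       = ennreal (exp (- (a * y\<^sup>2 * exp (2 * u) + c * x\<^sup>2 * exp (- 2 * u)) / 2 - f * x * exp (- u) - e * y * exp u))"
      unfolding k_def .
  qed
  finally show ?thesis .
qed

lemma nn_integral_exp_abs_finite:
  assumes e: "e > 0"
  shows "(\<integral>\<^sup>+u. ennreal (exp (- (e * \<bar>u\<bar>))) \<partial>lborel) < top"
proof -
  have "(\<integral>\<^sup>+u. ennreal (exp (- \<bar>u\<bar>)) \<partial>lborel) = ennreal (\<bar>e\<bar>) * (\<integral>\<^sup>+u. ennreal (exp (- \<bar>0 + e * u\<bar>)) \<partial>lborel)"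
    using e by (intro nn_integral_real_affine) auto
  moreover have "\<bar>0 + e * u\<bar> = e * \<bar>u\<bar>" for u using e by (simp add: abs_mult)
  ultimately have *: "(\<integral>\<^sup>+u. ennreal (exp (- \<bar>u\<bar>)) \<partial>lborel) = ennreal e * (\<integral>\<^sup>+u. ennreal (exp (- (e * \<bar>u\<bar>))) \<partial>lborel)"
    using e by (simp only: abs_of_pos)
  have "(\<integral>\<^sup>+u. ennreal (exp (- \<bar>u\<bar>)) \<partial>lborel) = 2 * (\<integral>\<^sup>+u. ennreal (exp (- \<bar>u\<bar>)) * indicator {0<..} u \<partial>lborel)"
    by (rule nn_integral_even) simp_all
  also have "\<dots> \<le> 2 * (\<integral>\<^sup>+u. ennreal (u ^ 0 * exp (- u)) * indicator {0..} u \<partial>lborel)"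
    by (intro mult_left_mono nn_integral_mono) (auto simp: indicator_def)
  also have "\<dots> < top" by (subst nn_intergal_power_times_exp_Ici) (simp add: ennreal_mult_less_top)
  finally show ?thesis unfolding * using e by (auto simp: ennreal_mult_less_top)
qed

section \<open>Matrices symmetric under the involution\<close>

locale involution =
  fixes star :: "'n::finite \<Rightarrow> 'n" and V1 :: "'n set"
  assumes star_star [simp]: "star (star i) = i"
    and V_union: "fixed_pts star \<union> V1 \<union> star ` V1 = UNIV"
    and V_disjoint: "fixed_pts star \<inter> V1 = {}" "fixed_pts star \<inter> star ` V1 = {}"
      "V1 \<inter> star ` V1 = {}"
begin

definition orbits :: "'n set \<Rightarrow> 'n set" where "orbits I = I \<union> star ` I"

text \<open>
  The structure of the weights that the elimination of an orbit preserves
  (\<open>star_symmetric_schur\<close>). An edge set is not preserved: elimination creates new edges.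
\<close>

definition star_symmetric :: "('n \<Rightarrow> 'n \<Rightarrow> real) \<Rightarrow> bool" where
  "star_symmetric W \<longleftrightarrow> (\<forall>i j. W i j \<ge> 0) \<and> (\<forall>i j. W i j = W (star j) (star i))"

definition star_invariant :: "('n \<Rightarrow> real) \<Rightarrow> bool" where "star_invariant b \<longleftrightarrow> (\<forall>i. b (star i) = b i)"

definition star_closed :: "'n set \<Rightarrow> bool" where "star_closed U \<longleftrightarrow> (\<forall>i. star i \<in> U \<longleftrightarrow> i \<in> U)"

lemma star_symmetricD: "star_symmetric W \<Longrightarrow> \<forall>i j. W i j \<ge> 0" "star_symmetric W \<Longrightarrow> W (star j) (star i) = W i j"
  unfolding star_symmetric_def by metis+

lemma star_symmetric_swap: "star_symmetric W \<Longrightarrow> W (star i) j = W (star j) i"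
  using star_symmetricD(2)[of W j "star i"] by simp

lemma sum_star:
  assumes "star_closed U"
  shows "(\<Sum>i\<in>U. f (star i)) = (\<Sum>i\<in>U. f i)"
  by (rule sum.reindex_bij_witness[of _ star star]) (use assms in \<open>auto simp: star_closed_def\<close>)

text \<open>
  The operator \<open>H\<^sub>\<beta>\<close> is self-adjoint for the pairing \<open>\<langle>\<cdot>,\<cdot>\<rangle>\<close> twisted by the involution, hence so is its
  inverse.
\<close>

lemma sol_bilinear_sym:
  assumes U: "star_closed U" and W: "star_symmetric W" and b: "star_invariant b" and d: "det (block U W b) \<noteq> 0"
  shows "(\<Sum>i\<in>U. y (star i) * sol U W b z i) = (\<Sum>i\<in>U. z (star i) * sol U W b y i)"
proof -
  define u v where "u = sol U W b y" and "v = sol U W b z"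
  have u: "y (star i) = row_apply U W b u (star i)" if "i \<in> U" for i
    using that U by (simp add: star_closed_def u_def sol_solves[OF d])
  have v: "z (star i) = row_apply U W b v (star i)" if "i \<in> U" for i
    using that U by (simp add: star_closed_def v_def sol_solves[OF d])
  have bb: "b (star i) = b i" for i using b by (simp add: star_invariant_def)
  have "(\<Sum>i\<in>U. y (star i) * v i) = (\<Sum>i\<in>U. b i * u (star i) * v i) - (\<Sum>i\<in>U. \<Sum>j\<in>U. W (star i) j * u j * v i)"
    by (simp add: u row_apply_def bb algebra_simps sum_subtractf sum_distrib_left cong: sum.cong)
  also have "(\<Sum>i\<in>U. b i * u (star i) * v i) = (\<Sum>i\<in>U. b i * v (star i) * u i)"
    by (subst sum_star[OF U, symmetric]) (simp add: bb algebra_simps)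
  also have "(\<Sum>i\<in>U. \<Sum>j\<in>U. W (star i) j * u j * v i) = (\<Sum>j\<in>U. \<Sum>i\<in>U. W (star j) i * v i * u j)"
    by (subst sum.swap, subst star_symmetric_swap[OF W]) (simp add: mult.assoc mult.commute[of "u _"])
  also have "(\<Sum>i\<in>U. b i * v (star i) * u i) - (\<Sum>j\<in>U. \<Sum>i\<in>U. W (star j) i * v i * u j) = (\<Sum>i\<in>U. z (star i) * u i)"
    by (simp add: v row_apply_def bb algebra_simps sum_subtractf sum_distrib_left cong: sum.cong)
  finally show ?thesis by (simp add: u_def v_def)
qed

lemma quad_add:
  assumes U: "star_closed U" and W: "star_symmetric W" and b: "star_invariant b" and d: "det (block U W b) \<noteq> 0"
  shows "quad star U W b (\<lambda>i. y i + z i)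
    = quad star U W b y + 2 * (\<Sum>i\<in>U. z (star i) * sol U W b y i) + quad star U W b z"
  unfolding quad_def using sol_bilinear_sym[OF assms, of y z]
  by (simp add: sol_add[OF d] algebra_simps sum.distrib cong: sum.cong)

text \<open>
  The blocks of \<open>W\<close> between \<open>U1\<close> and \<open>U2\<close> are adjoint to each other for the twisted pairing.
\<close>

lemma coupling_adjoint:
  assumes U1: "star_closed U1" and U2: "star_closed U2" and W: "star_symmetric W"
  shows "(\<Sum>k\<in>U2. y (star k) * (\<Sum>p\<in>U1. W k p * x p))
       = (\<Sum>p\<in>U1. (\<Sum>l\<in>U2. W (star p) l * y l) * x p)"
proof -
  have "(\<Sum>k\<in>U2. y (star k) * (\<Sum>p\<in>U1. W k p * x p)) = (\<Sum>p\<in>U1. \<Sum>k\<in>U2. y (star k) * W k p * x p)"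
    by (simp add: sum_distrib_left mult.assoc sum.swap[of _ U2 U1])
  also have "\<dots> = (\<Sum>p\<in>U1. \<Sum>k\<in>U2. y k * W (star k) p * x p)"
    using sum_star[OF U2, of "\<lambda>k. y k * W (star k) p * x p" for p] by simp
  also have "\<dots> = (\<Sum>p\<in>U1. (\<Sum>l\<in>U2. W (star p) l * y l) * x p)"
    by (simp add: star_symmetric_swap[OF W, of _ p for p] sum_distrib_right sum_distrib_left mult.commute)
  finally show ?thesis .
qed

lemma quad_schur:
  assumes U1: "star_closed U1" and U2: "star_closed U2" and disj: "U1 \<inter> U2 = {}"
    and W: "star_symmetric W" and b: "star_invariant b"
    and pos1: "m_matrix U1 W b" and pos2: "m_matrix U2 (schur_W U1 W b) b"
  shows "quad star (U1 \<union> U2) W b y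
    = quad star U1 W b y + quad star U2 (schur_W U1 W b) b (schur_v U1 W b y)"
proof -
  note W0 = star_symmetricD(1)[OF W]
  note d1 = m_matrix_det_nonzero[OF W0 pos1]
  note d2 = m_matrix_det_nonzero[OF schur_W_nonneg[OF W0 pos1] pos2]
  have d: "det (block (U1 \<union> U2) W b) \<noteq> 0"
    using m_matrix_det_nonzero[OF W0, of "U1 \<union> U2"] m_matrix_schur[OF W0 disj] pos1 pos2 by blast
  define X where "X = sol U2 (schur_W U1 W b) b (schur_v U1 W b y)"
  have "quad star (U1 \<union> U2) W b y
     = (\<Sum>i\<in>U1. y (star i) * sol (U1 \<union> U2) W b y i) + (\<Sum>i\<in>U2. y (star i) * sol (U1 \<union> U2) W b y i)"
    unfolding quad_def using disj by (simp add: sum.union_disjoint)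
  also have "(\<Sum>i\<in>U1. y (star i) * sol (U1 \<union> U2) W b y i)
     = quad star U1 W b y + (\<Sum>p\<in>U1. y (star p) * sol U1 W b (\<lambda>q. \<Sum>l\<in>U2. W q l * X l) p)"
    unfolding quad_def
    by (simp add: sol_schur(2)[OF disj d d1 d2] X_def algebra_simps sum.distrib cong: sum.cong)
  also have "(\<Sum>p\<in>U1. y (star p) * sol U1 W b (\<lambda>q. \<Sum>l\<in>U2. W q l * X l) p)
     = (\<Sum>p\<in>U1. (\<Sum>l\<in>U2. W (star p) l * X l) * sol U1 W b y p)"
    by (rule sol_bilinear_sym[OF U1 W b d1])
  also have "\<dots> = (\<Sum>k\<in>U2. X (star k) * (\<Sum>p\<in>U1. W k p * sol U1 W b y p))"
    by (rule coupling_adjoint[OF U1 U2 W, symmetric])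
  also have "\<dots> = (\<Sum>k\<in>U2. (\<Sum>p\<in>U1. W (star k) p * sol U1 W b y p) * X k)"
    by (subst sum_star[OF U2, symmetric]) (simp add: algebra_simps)
  also have "(\<Sum>i\<in>U2. y (star i) * sol (U1 \<union> U2) W b y i) = (\<Sum>i\<in>U2. y (star i) * X i)"
    by (simp add: sol_schur(1)[OF disj d d1 d2] X_def cong: sum.cong)
  finally show ?thesis
    by (simp add: quad_def X_def schur_v_def algebra_simps sum.distrib)
qed

lemma star_symmetric_schur:
  assumes U: "star_closed U" and W: "star_symmetric W" and b: "star_invariant b" and pos: "m_matrix U W b"
  shows "star_symmetric (schur_W U W b)"
proof -
  note d = m_matrix_det_nonzero[OF star_symmetricD(1)[OF W] pos]
  have "schur_W U W b k l = schur_W U W b (star l) (star k)" for k l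
  proof -
    have "(\<Sum>p\<in>U. W k p * sol U W b (\<lambda>q. W q l) p) = (\<Sum>p\<in>U. W (star p) (star k) * sol U W b (\<lambda>q. W q l) p)"
      by (simp add: star_symmetricD(2)[OF W])
    also have "\<dots> = (\<Sum>p\<in>U. W (star p) l * sol U W b (\<lambda>q. W q (star k)) p)"
      by (rule sol_bilinear_sym[OF U W b d])
    also have "\<dots> = (\<Sum>p\<in>U. W (star l) p * sol U W b (\<lambda>q. W q (star k)) p)"
      by (subst star_symmetric_swap[OF W]) simp
    finally show ?thesis by (simp add: schur_W_def star_symmetricD(2)[OF W])
  qed
  then show ?thesis
    using schur_W_nonneg[OF star_symmetricD(1)[OF W] pos] unfolding star_symmetric_def by blast
qed

text \<open>
  Minus twice the exponent of the antisymmetric model with effective weights and field, together with the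
  form of the eliminated block: the terms that contain the inverse on \<open>U1\<close> combine to its form
  at the shifted field \<open>y + W x\<close>.
\<close>

lemma complete_square:
  assumes U1: "star_closed U1" and U2: "star_closed U2" and W: "star_symmetric W" and b: "star_invariant b" and pos: "m_matrix U1 W b"
  shows "(\<Sum>k\<in>U2. x (star k) * (\<Sum>l\<in>U2. schur_W U1 W b k l * x l)) + 2 * (\<Sum>k\<in>U2. schur_v U1 W b y (star k) * x k)
       + quad star U1 W b y
     = (\<Sum>k\<in>U2. x (star k) * (\<Sum>l\<in>U2. W k l * x l)) + 2 * (\<Sum>k\<in>U2. y (star k) * x k)
       + quad star U1 W b (\<lambda>q. y q + (\<Sum>l\<in>U2. W q l * x l))"
proof -
  note d = m_matrix_det_nonzero[OF star_symmetricD(1)[OF W] pos]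
  let ?s = "\<lambda>q. \<Sum>l\<in>U2. W q l * x l"
  have "(\<Sum>k\<in>U2. x (star k) * (\<Sum>l\<in>U2. schur_W U1 W b k l * x l))
     = (\<Sum>k\<in>U2. x (star k) * ?s k) + (\<Sum>k\<in>U2. x (star k) * (\<Sum>p\<in>U1. W k p * sol U1 W b ?s p))"
    by (simp only: schur_W_apply[OF d] distrib_left sum.distrib)
  also have "(\<Sum>k\<in>U2. x (star k) * (\<Sum>p\<in>U1. W k p * sol U1 W b ?s p)) = quad star U1 W b ?s"
    unfolding quad_def by (rule coupling_adjoint[OF U1 U2 W])
  finally have 1: "(\<Sum>k\<in>U2. x (star k) * (\<Sum>l\<in>U2. schur_W U1 W b k l * x l))
     = (\<Sum>k\<in>U2. x (star k) * ?s k) + quad star U1 W b ?s" .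
  have "(\<Sum>k\<in>U2. schur_v U1 W b y (star k) * x k)
      = (\<Sum>k\<in>U2. y (star k) * x k) + (\<Sum>k\<in>U2. (\<Sum>p\<in>U1. W (star k) p * sol U1 W b y p) * x k)"
    by (simp add: schur_v_def algebra_simps sum.distrib)
  also have "(\<Sum>k\<in>U2. (\<Sum>p\<in>U1. W (star k) p * sol U1 W b y p) * x k)
      = (\<Sum>k\<in>U2. x (star k) * (\<Sum>p\<in>U1. W k p * sol U1 W b y p))"
    by (subst sum_star[OF U2, symmetric]) (simp add: algebra_simps)
  also have "\<dots> = (\<Sum>p\<in>U1. ?s (star p) * sol U1 W b y p)"
    by (rule coupling_adjoint[OF U1 U2 W])
  finally have 2: "(\<Sum>k\<in>U2. schur_v U1 W b y (star k) * x k)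
      = (\<Sum>k\<in>U2. y (star k) * x k) + (\<Sum>p\<in>U1. ?s (star p) * sol U1 W b y p)" .
  show ?thesis unfolding 1 2 quad_add[OF U1 W b d, of y ?s] by (simp add: algebra_simps)
qed

section \<open>The two densities in coordinates\<close>

abbreviation "fixed \<equiv> fixed_pts star"

lemma star_inj: "star i = star j \<longleftrightarrow> i = j"
  by (metis star_star)

lemma fixed_iff: "i \<in> fixed \<longleftrightarrow> star i = i"
  by (simp add: fixed_pts_def)

lemma V1_not_star: "i \<in> V1 \<Longrightarrow> star i \<notin> V1" "i \<in> V1 \<Longrightarrow> i \<notin> fixed" "i \<in> V1 \<Longrightarrow> star i \<notin> fixed"
  using V_disjoint by (auto simp: fixed_iff)

lemma not_reps: "i \<notin> fixed \<Longrightarrow> i \<notin> V1 \<Longrightarrow> star i \<in> V1"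
  using V_union by (metis UNIV_I Un_iff imageE star_star)

text \<open>
  The coordinates of \<open>symm_emb\<close>.
\<close>

definition sym_coord :: "('n \<Rightarrow> real) \<Rightarrow> 'n \<Rightarrow> real" where
  "sym_coord b i = (if i \<in> fixed \<union> V1 then b i else b (star i))"

text \<open>
  The coordinates of \<open>anti_emb\<close>.
\<close>

definition anti_coord :: "('n \<Rightarrow> real) \<Rightarrow> 'n \<Rightarrow> real" where
  "anti_coord b i = (if i \<in> fixed then 0 else if i \<in> V1 then b i else - b (star i))"

text \<open>
  The coordinates of \<open>exp_star\<close> at an antisymmetric vector.
\<close>

definition exp_coord :: "('n \<Rightarrow> real) \<Rightarrow> ('n \<Rightarrow> real) \<Rightarrow> 'n \<Rightarrow> real" where
  "exp_coord \<theta> b j = exp (anti_coord b (star j)) * \<theta> j"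

lemma star_invariant_sym_coord: "star_invariant (sym_coord b)"
  unfolding star_invariant_def
proof
  fix i
  consider "i \<in> fixed" | "i \<in> V1" | "star i \<in> V1" using not_reps by blast
  then show "sym_coord b (star i) = sym_coord b i"
    by cases (use V1_not_star[of i] V1_not_star[of "star i"] in \<open>auto simp: sym_coord_def fixed_iff\<close>)
qed

lemma star_closed_orbits: "star_closed (orbits I)"
  unfolding star_closed_def orbits_def by (metis Un_iff image_iff star_star)

lemma orbits_insert: "orbits (insert i I) = orbits {i} \<union> orbits I"
  by (auto simp: orbits_def)

lemma orbits_disj:
  assumes "i \<notin> I" "insert i I \<subseteq> fixed \<union> V1"
  shows "orbits {i} \<inter> orbits I = {}"
proof -
  have False if k: "k \<in> I" "i = star k" for k
  proof -
    have "k \<in> fixed \<union> V1" "star k \<in> fixed \<union> V1" using assms(2) k by auto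
    then have "star k = k" using V1_not_star[of k] by (auto simp: fixed_iff)
    then show False using k assms(1) by simp
  qed
  moreover have "star i \<noteq> star k" "star i \<noteq> k" if "k \<in> I" for k
    using that assms(1) calculation[of k] by (auto simp: star_inj)
  ultimately show ?thesis using assms(1) by (auto simp: orbits_def)
qed

lemma sym_coord_cong:
  assumes "I \<subseteq> fixed \<union> V1" "\<And>j. j \<in> I \<Longrightarrow> b j = b' j" "k \<in> orbits I"
  shows "sym_coord b k = sym_coord b' k"
proof (cases "k \<in> I")
  case True
  then show ?thesis using assms by (auto simp: sym_coord_def)
next
  case False
  then have "star k \<in> I" using assms(3) by (auto simp: orbits_def)
  then have "sym_coord b (star k) = sym_coord b' (star k)" using assms by (auto simp: sym_coord_def)
  then show ?thesis using star_invariant_sym_coord by (simp add: star_invariant_def)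
qed

lemma exp_coord_cong:
  assumes "I \<subseteq> fixed \<union> V1" "\<And>j. j \<in> I \<inter> V1 \<Longrightarrow> b j = b' j" "k \<in> orbits I"
  shows "exp_coord \<theta> b k = exp_coord \<theta> b' k"
proof -
  have "anti_coord b (star k) = anti_coord b' (star k)"
  proof (cases "k \<in> fixed")
    case True
    then show ?thesis by (simp add: anti_coord_def fixed_iff)
  next
    case False
    then have sk: "star k \<notin> fixed" by (auto simp: fixed_iff)
    show ?thesis
    proof (cases "k \<in> I")
      case True
      then have "k \<in> I \<inter> V1" using False assms(1) by auto
      then show ?thesis using assms(2)[of k] V1_not_star[of k] by (simp add: anti_coord_def)
    next
      case False
      then have "star k \<in> I" using assms(3) by (auto simp: orbits_def)
      then have "star k \<in> I \<inter> V1" using sk assms(1) by auto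
      then show ?thesis using assms(2)[of "star k"] sk by (simp add: anti_coord_def)
    qed
  qed
  then show ?thesis by (simp add: exp_coord_def)
qed

text \<open>
  The density of the symmetric model on the orbits of \<open>I\<close>, without the constant factor
  \<open>exp (\<langle>\<theta>,W\<theta>\<rangle>/2 + \<langle>\<theta>,\<eta>\<rangle>)\<close>; what remains contains \<open>W\<close> only through the matrix \<open>H\<^sub>\<beta>\<close>, which is what
  makes it factorise under elimination.
\<close>

definition dens_S :: "'n set \<Rightarrow> ('n \<Rightarrow> 'n \<Rightarrow> real) \<Rightarrow> ('n \<Rightarrow> real) \<Rightarrow> ('n \<Rightarrow> real) \<Rightarrow> ('n \<Rightarrow> real) \<Rightarrow> real" where
  "dens_S I W \<theta> y b = (if m_matrix (orbits I) W (sym_coord b) then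
      (\<Prod>i\<in>I \<inter> fixed. \<theta> i) / sqrt (2 * pi) ^ card I
      * exp (- (\<Sum>i\<in>orbits I. \<theta> (star i) * (sym_coord b i * \<theta> i)) / 2 - quad star (orbits I) W (sym_coord b) y / 2)
      / sqrt (det (block (orbits I) W (sym_coord b))) else 0)"

definition dens_A :: "'n set \<Rightarrow> ('n \<Rightarrow> 'n \<Rightarrow> real) \<Rightarrow> ('n \<Rightarrow> real) \<Rightarrow> ('n \<Rightarrow> real) \<Rightarrow> ('n \<Rightarrow> real) \<Rightarrow> real" where
  "dens_A I W \<theta> y b =
      exp (- (\<Sum>k\<in>orbits I. exp_coord \<theta> b (star k) * (\<Sum>l\<in>orbits I. W k l * exp_coord \<theta> b l)) / 2
           - (\<Sum>k\<in>orbits I. y (star k) * exp_coord \<theta> b k)) / sqrt (2 * pi) ^ card (I \<inter> V1)"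

lemma block_cong: "(\<And>k. k \<in> U \<Longrightarrow> b k = b' k) \<Longrightarrow> block U W b = block U W b'"
  by (auto simp: block_def vec_eq_iff)

lemma sol_cong: "(\<And>k. k \<in> U \<Longrightarrow> b k = b' k) \<Longrightarrow> sol U W b y = sol U W b' y"
  by (intro ext) (simp only: sol_def block_cong[of U b b' W])

lemma m_matrix_cong: "(\<And>k. k \<in> U \<Longrightarrow> b k = b' k) \<Longrightarrow> m_matrix U W b = m_matrix U W b'"
  by (simp add: m_matrix_def row_apply_def)

lemma schur_cong:
  assumes "\<And>k. k \<in> U \<Longrightarrow> b k = b' k"
  shows "schur_W U W b = schur_W U W b'" "schur_v U W b = schur_v U W b'"
  using sol_cong[of U b b' W, OF assms] by (auto simp: schur_W_def schur_v_def fun_eq_iff)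

lemma dens_S_cong:
  assumes "I \<subseteq> fixed \<union> V1" "\<And>j. j \<in> I \<Longrightarrow> b j = b' j"
  shows "dens_S I W \<theta> y b = dens_S I W \<theta> y b'"
proof -
  note sym_coord = sym_coord_cong[OF assms]
  show ?thesis
    unfolding dens_S_def quad_def
    by (simp add: m_matrix_cong[of "orbits I" "sym_coord b" "sym_coord b'", OF sym_coord] block_cong[of "orbits I" "sym_coord b" "sym_coord b'", OF sym_coord]
        sol_cong[of "orbits I" "sym_coord b" "sym_coord b'", OF sym_coord] sym_coord cong: sum.cong)
qed

lemma dens_A_cong:
  assumes "I \<subseteq> fixed \<union> V1" "\<And>j. j \<in> I \<inter> V1 \<Longrightarrow> b j = b' j"
  shows "dens_A I W \<theta> y b = dens_A I W \<theta> y b'"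
proof -
  note exp_coord = exp_coord_cong[OF assms]
  have "star k \<in> orbits I" if "k \<in> orbits I" for k using that star_closed_orbits[of I] by (simp add: star_closed_def)
  then show ?thesis unfolding dens_A_def using exp_coord by (simp cong: sum.cong)
qed

text \<open>
  The first factor depends only on the coordinate at \<open>i\<close>; the second is the density of the
  remaining orbits in the model from which the orbit of \<open>i\<close> has been eliminated.
\<close>

lemma dens_S_insert:
  assumes I: "i \<notin> I" "insert i I \<subseteq> fixed \<union> V1" and W: "star_symmetric W"
  shows "dens_S (insert i I) W \<theta> y b = dens_S {i} W \<theta> y b
     * dens_S I (schur_W (orbits {i}) W (sym_coord b)) \<theta> (schur_v (orbits {i}) W (sym_coord b) y) b"
proof -
  note disj = orbits_disj[OF I]
  note W0 = star_symmetricD(1)[OF W]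
  let ?W = "schur_W (orbits {i}) W (sym_coord b)" and ?y = "schur_v (orbits {i}) W (sym_coord b) y"
  have iff: "m_matrix (orbits (insert i I)) W (sym_coord b) \<longleftrightarrow> m_matrix (orbits {i}) W (sym_coord b) \<and> m_matrix (orbits I) ?W (sym_coord b)"
    unfolding orbits_insert[of i I] by (rule m_matrix_schur[OF W0 disj])
  show ?thesis
  proof (cases "m_matrix (orbits (insert i I)) W (sym_coord b)")
    case False
    then show ?thesis using iff by (auto simp: dens_S_def)
  next
    case True
    with iff have p1: "m_matrix (orbits {i}) W (sym_coord b)" and p2: "m_matrix (orbits I) ?W (sym_coord b)" by auto
    have q: "quad star (orbits (insert i I)) W (sym_coord b) y = quad star (orbits {i}) W (sym_coord b) y + quad star (orbits I) ?W (sym_coord b) ?y"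
      unfolding orbits_insert[of i I] by (rule quad_schur[OF star_closed_orbits star_closed_orbits disj W star_invariant_sym_coord p1 p2])
    have d: "det (block (orbits (insert i I)) W (sym_coord b)) = det (block (orbits {i}) W (sym_coord b)) * det (block (orbits I) ?W (sym_coord b))"
      unfolding orbits_insert[of i I] by (rule det_schur[OF disj m_matrix_det_nonzero[OF W0 p1]])
    have s: "(\<Sum>i\<in>orbits (insert i I). \<theta> (star i) * (sym_coord b i * \<theta> i))
       = (\<Sum>i\<in>orbits {i}. \<theta> (star i) * (sym_coord b i * \<theta> i)) + (\<Sum>i\<in>orbits I. \<theta> (star i) * (sym_coord b i * \<theta> i))"
      unfolding orbits_insert[of i I] using disj by (intro sum.union_disjoint) auto
    have "insert i I \<inter> fixed = ({i} \<inter> fixed) \<union> (I \<inter> fixed)" by auto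
    then have p: "(\<Prod>i\<in>insert i I \<inter> fixed. \<theta> i) = (\<Prod>i\<in>{i} \<inter> fixed. \<theta> i) * (\<Prod>i\<in>I \<inter> fixed. \<theta> i)"
      using I(1) by (simp only:) (intro prod.union_disjoint, auto)
    have c: "card (insert i I) = card {i} + card I" using I(1) by simp
    have e: "exp (- (s1 + s2) / 2 - (q1 + q2) / 2) = exp (- s1 / 2 - q1 / 2) * exp (- s2 / 2 - q2 / 2)"
      for s1 s2 q1 q2 :: real by (simp add: mult_exp_exp field_simps)
    have alg: "P1 * P2 / (C1 * C2) * (E1 * E2) / (D1 * D2) = P1 / C1 * E1 / D1 * (P2 / C2 * E2 / D2)"
      for P1 P2 C1 C2 E1 E2 D1 D2 :: real by (simp add: mult_ac)
    show ?thesis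
      unfolding dens_S_def if_P[OF True] if_P[OF p1] if_P[OF p2] q d s p c e power_add real_sqrt_mult alg ..
  qed
qed

lemma dens_A_insert:
  assumes I: "i \<notin> I" "insert i I \<subseteq> fixed \<union> V1" and W: "star_symmetric W"
  shows "dens_A (insert i I) W \<theta> y b = dens_A {i} W \<theta> (\<lambda>q. y q + (\<Sum>l\<in>orbits I. W q l * exp_coord \<theta> b l)) b * dens_A I W \<theta> y b"
proof -
  note disj = orbits_disj[OF I]
  let ?x = "exp_coord \<theta> b" and ?U = "orbits {i}" and ?V = "orbits I"
  have fin: "finite ?U" "finite ?V" by auto
  note un = sum.union_disjoint[OF fin disj]
  have cross: "(\<Sum>k\<in>?V. ?x (star k) * (\<Sum>p\<in>?U. W k p * ?x p)) = (\<Sum>p\<in>?U. (\<Sum>l\<in>?V. W (star p) l * ?x l) * ?x p)"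
    by (rule coupling_adjoint[OF star_closed_orbits star_closed_orbits W])
  have cross': "(\<Sum>p\<in>?U. ?x (star p) * (\<Sum>l\<in>?V. W p l * ?x l)) = (\<Sum>p\<in>?U. (\<Sum>l\<in>?V. W (star p) l * ?x l) * ?x p)"
    by (subst sum_star[OF star_closed_orbits, symmetric]) (simp add: mult.commute)
  have A: "(\<Sum>k\<in>?U \<union> ?V. ?x (star k) * (\<Sum>l\<in>?U \<union> ?V. W k l * ?x l))
     = (\<Sum>k\<in>?U. ?x (star k) * (\<Sum>l\<in>?U. W k l * ?x l)) + (\<Sum>k\<in>?V. ?x (star k) * (\<Sum>l\<in>?V. W k l * ?x l))
      + 2 * (\<Sum>p\<in>?U. (\<Sum>l\<in>?V. W (star p) l * ?x l) * ?x p)"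
    using cross cross' by (simp add: un distrib_left sum.distrib)
  have B: "(\<Sum>k\<in>?U. (y (star k) + (\<Sum>l\<in>?V. W (star k) l * ?x l)) * ?x k)
     = (\<Sum>k\<in>?U. y (star k) * ?x k) + (\<Sum>p\<in>?U. (\<Sum>l\<in>?V. W (star p) l * ?x l) * ?x p)"
    by (simp add: distrib_right sum.distrib)
  have "insert i I \<inter> V1 = ({i} \<inter> V1) \<union> (I \<inter> V1)" by auto
  then have c: "card (insert i I \<inter> V1) = card ({i} \<inter> V1) + card (I \<inter> V1)"
    using I(1) by (simp only:) (intro card_Un_disjoint, auto)
  have e: "exp (- (s1 + s2 + 2 * t) / 2 - (q1 + q2)) = exp (- s1 / 2 - (q1 + t)) * exp (- s2 / 2 - q2)"
      for s1 s2 q1 q2 t :: real by (simp add: mult_exp_exp field_simps)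
  have alg: "E1 * E2 / (D1 * D2) = E1 / D1 * (E2 / D2)" for E1 E2 D1 D2 :: real by simp
  show ?thesis
    unfolding dens_A_def orbits_insert[of i I] A
    unfolding un B c e power_add alg ..
qed

text \<open>
  This is where the elimination on the symmetric side meets the coupling on the antisymmetric
  side: effective parameters for the remaining orbits may be traded for a shift of the field at
  the orbit of \<open>i\<close>.
\<close>

lemma dens_S_dens_A_exchange:
  assumes I: "i \<notin> I" "insert i I \<subseteq> fixed \<union> V1" and W: "star_symmetric W"
  shows "dens_S {i} W \<theta> y b * dens_A I (schur_W (orbits {i}) W (sym_coord b)) \<theta> (schur_v (orbits {i}) W (sym_coord b) y) a
     = dens_S {i} W \<theta> (\<lambda>q. y q + (\<Sum>l\<in>orbits I. W q l * exp_coord \<theta> a l)) b * dens_A I W \<theta> y a"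
proof (cases "m_matrix (orbits {i}) W (sym_coord b)")
  case False
  then show ?thesis by (simp add: dens_S_def)
next
  case True
  have e: "P * exp (- s / 2 - q / 2) / D * (exp (- t / 2 - v) / C) = P * exp (- s / 2 - q' / 2) / D * (exp (- t' / 2 - v') / C)"
    if "t + 2 * v + q = t' + 2 * v' + q'" for P s q D t v C q' t' v' :: real
  proof -
    have "exp (- s / 2 - q / 2) * exp (- t / 2 - v) = exp (- s / 2 - q' / 2) * exp (- t' / 2 - v')"
      using that by (simp add: mult_exp_exp field_simps)
    then show ?thesis by (simp add: mult.assoc mult.left_commute)
  qed
  show ?thesis
    unfolding dens_S_def if_P[OF True] dens_A_def
    by (rule e, rule complete_square[OF star_closed_orbits star_closed_orbits W star_invariant_sym_coord True])
qed

text \<open>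
  The function \<open>dens_S\<close> for one orbit in closed form, with \<open>e\<close> and \<open>f\<close> the field at \<open>i\<close> and at its
  partner. Its joint measurability in all arguments is evident.
\<close>

definition orbit_dens :: "'n \<Rightarrow> ('n \<Rightarrow> 'n \<Rightarrow> real) \<Rightarrow> ('n \<Rightarrow> real) \<Rightarrow> real \<Rightarrow> real \<Rightarrow> real \<Rightarrow> real" where
  "orbit_dens i W \<theta> e f \<beta> = (if i \<in> fixed then
      (if \<beta> - W i i > 0 then \<theta> i * exp (- (\<theta> i * (\<beta> * \<theta> i)) / 2 - e * e / (\<beta> - W i i) / 2) / (sqrt (2 * pi) * sqrt (\<beta> - W i i)) else 0)
    else
      (if \<beta> - W i i > 0 \<and> (\<beta> - W i i)\<^sup>2 > W i (star i) * W (star i) i then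
        exp (- (\<beta> * (\<theta> i * \<theta> (star i)))
          - (2 * (\<beta> - W i i) * e * f + W i (star i) * f\<^sup>2 + W (star i) i * e\<^sup>2) / ((\<beta> - W i i)\<^sup>2 - W i (star i) * W (star i) i) / 2)
        / (sqrt (2 * pi) * sqrt ((\<beta> - W i i)\<^sup>2 - W i (star i) * W (star i) i)) else 0))"

lemma dens_S_single:
  assumes i: "i \<in> fixed \<union> V1" and W: "star_symmetric W"
  shows "dens_S {i} W \<theta> y b = orbit_dens i W \<theta> (y i) (y (star i)) (b i)"
proof (cases "i \<in> fixed")
  case True
  then have si: "star i = i" by (simp add: fixed_iff)
  have o: "orbits {i} = {i}" by (simp add: orbits_def si)
  have bsi: "sym_coord b i = b i" using i by (simp add: sym_coord_def)
  show ?thesis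
    using True by (simp add: dens_S_def orbit_dens_def o m_matrix_single bsi det_block_single quad_def sol_single si)
next
  case False
  then have ne: "star i \<noteq> i" by (simp add: fixed_iff)
  have o: "orbits {i} = {i, star i}" by (auto simp: orbits_def)
  have bsi: "sym_coord b i = b i" using i by (simp add: sym_coord_def)
  then have bsj: "sym_coord b (star i) = b i" using star_invariant_sym_coord[of b] by (simp add: star_invariant_def)
  have Wj: "W (star i) (star i) = W i i" using star_symmetricD(2)[OF W] by simp
  have M: "m_matrix (orbits {i}) W (sym_coord b) \<longleftrightarrow> b i - W i i > 0 \<and> (b i - W i i)\<^sup>2 > W i (star i) * W (star i) i"
    unfolding o using m_matrix_pair[OF star_symmetricD(1)[OF W] ne[symmetric], of "sym_coord b"]
    by (simp add: bsi bsj Wj power2_eq_square)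
  show ?thesis
  proof (cases "m_matrix (orbits {i}) W (sym_coord b)")
    case f: False
    then show ?thesis using False M by (auto simp: dens_S_def orbit_dens_def)
  next
    case True
    then have h: "b i - W i i > 0" and D: "(b i - W i i)\<^sup>2 > W i (star i) * W (star i) i" using M by auto
    have d: "det (block (orbits {i}) W (sym_coord b)) = (b i - W i i)\<^sup>2 - W i (star i) * W (star i) i"
      unfolding o using det_block_pair[OF ne[symmetric], of "sym_coord b" W] h
      by (simp add: bsi bsj Wj power2_eq_square)
    have "quad star (orbits {i}) W (sym_coord b) y = y (star i) * sol {i, star i} W (sym_coord b) y i + y i * sol {i, star i} W (sym_coord b) y (star i)"
      unfolding o quad_def using ne by simp
    also have "\<dots> = (2 * (b i - W i i) * y i * y (star i) + W i (star i) * (y (star i))\<^sup>2 + W (star i) i * (y i)\<^sup>2)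
        / ((b i - W i i)\<^sup>2 - W i (star i) * W (star i) i)"
    proof -
      have D': "(sym_coord b i - W i i) * (sym_coord b (star i) - W (star i) (star i)) - W i (star i) * W (star i) i
          = (b i - W i i)\<^sup>2 - W i (star i) * W (star i) i"
        by (simp add: bsi bsj Wj power2_eq_square)
      have h': "sym_coord b i - W i i \<noteq> 0" using h by (simp add: bsi)
      have nz: "(sym_coord b i - W i i) * (sym_coord b (star i) - W (star i) (star i)) - W i (star i) * W (star i) i \<noteq> 0"
        using D unfolding D' by linarith
      note s = sol_pair[OF ne[symmetric] h' nz, of y, unfolded D', unfolded bsi bsj Wj]
      have "f * ((h * e + a * f) / D) + e * ((c * e + h * f) / D) = (2 * h * e * f + a * f\<^sup>2 + c * e\<^sup>2) / D"
        for h a c D e f :: real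
        by (simp add: add_divide_distrib[symmetric] power2_eq_square algebra_simps)
      then show ?thesis unfolding s .
    qed
    finally have q: "quad star (orbits {i}) W (sym_coord b) y = \<dots>" .
    have s: "(\<Sum>k\<in>orbits {i}. \<theta> (star k) * (sym_coord b k * \<theta> k)) = 2 * (b i * (\<theta> i * \<theta> (star i)))"
      unfolding o using ne by (simp add: bsi bsj algebra_simps)
    show ?thesis
      unfolding dens_S_def if_P[OF True] d q s using False h D by (simp add: orbit_dens_def)
  qed
qed

lemma dens_A_single:
  assumes i: "i \<in> V1" and W: "star_symmetric W"
  shows "dens_A {i} W \<theta> y b = exp (- (2 * W i i * (\<theta> i * \<theta> (star i))
      + W i (star i) * (\<theta> (star i))\<^sup>2 * exp (2 * b i) + W (star i) i * (\<theta> i)\<^sup>2 * exp (- 2 * b i)) / 2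
      - y (star i) * \<theta> i * exp (- b i) - y i * \<theta> (star i) * exp (b i)) / sqrt (2 * pi)"
proof -
  have ne: "star i \<noteq> i" using V1_not_star(2)[OF i] by (simp add: fixed_iff)
  have o: "orbits {i} = {i, star i}" by (auto simp: orbits_def)
  have x1: "exp_coord \<theta> b i = exp (- b i) * \<theta> i" using V1_not_star[OF i] by (simp add: exp_coord_def anti_coord_def)
  have x2: "exp_coord \<theta> b (star i) = exp (b i) * \<theta> (star i)" using i V1_not_star[OF i] by (simp add: exp_coord_def anti_coord_def)
  have Wj: "W (star i) (star i) = W i i" using star_symmetricD(2)[OF W] by simp
  define E F where "E = exp (b i)" and "F = exp (- b i)"
  have EF: "E * F = 1" "exp (2 * b i) = E\<^sup>2" "exp (- 2 * b i) = F\<^sup>2"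
    by (simp_all add: E_def F_def mult_exp_exp power2_eq_square)
  have "(\<Sum>k\<in>orbits {i}. exp_coord \<theta> b (star k) * (\<Sum>l\<in>orbits {i}. W k l * exp_coord \<theta> b l))
     = E * \<theta> (star i) * (W i i * (F * \<theta> i) + W i (star i) * (E * \<theta> (star i)))
     + F * \<theta> i * (W (star i) i * (F * \<theta> i) + W i i * (E * \<theta> (star i)))"
    unfolding o using ne by (simp add: x1 x2 Wj E_def F_def)
  also have "\<dots> = 2 * W i i * (\<theta> i * \<theta> (star i)) + W i (star i) * (\<theta> (star i))\<^sup>2 * E\<^sup>2 + W (star i) i * (\<theta> i)\<^sup>2 * F\<^sup>2"
    using EF(1) by algebra
  finally have 1: "(\<Sum>k\<in>orbits {i}. exp_coord \<theta> b (star k) * (\<Sum>l\<in>orbits {i}. W k l * exp_coord \<theta> b l)) = \<dots>" .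
  have 2: "(\<Sum>k\<in>orbits {i}. y (star k) * exp_coord \<theta> b k) = y (star i) * \<theta> i * F + y i * \<theta> (star i) * E"
    unfolding o using ne by (simp add: x1 x2 E_def F_def)
  show ?thesis
    unfolding dens_A_def 1 2 EF(2,3) using i by (simp add: E_def[symmetric] F_def[symmetric] diff_diff_eq)
qed

lemma orbit_integral_fixed:
  assumes i: "i \<in> fixed" and \<theta>: "\<theta> i > 0" and y: "y i \<ge> 0"
  shows "(\<integral>\<^sup>+\<beta>. ennreal (orbit_dens i W \<theta> (y i) f \<beta>) \<partial>lborel) = ennreal (dens_A {i} W \<theta> y b)"
proof -
  have si: "star i = i" using i by (simp add: fixed_iff)
  have o: "orbits {i} = {i}" by (simp add: orbits_def si)
  have iV: "i \<notin> V1" using i V1_not_star(2) by blast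
  have x: "exp_coord \<theta> b i = \<theta> i" using i by (simp add: exp_coord_def anti_coord_def si)
  let ?w = "W i i"
  have [measurable]: "(\<lambda>\<beta>. ennreal (orbit_dens i W \<theta> (y i) f \<beta>)) \<in> borel_measurable borel"
    unfolding orbit_dens_def using i by simp
  have "(\<integral>\<^sup>+\<beta>. ennreal (orbit_dens i W \<theta> (y i) f \<beta>) \<partial>lborel)
     = ennreal (\<bar>1\<bar>) * (\<integral>\<^sup>+h. ennreal (orbit_dens i W \<theta> (y i) f (?w + 1 * h)) \<partial>lborel)"
    by (rule nn_integral_real_affine) simp_all
  also have "\<dots> = (\<integral>\<^sup>+h. ennreal (exp (- (\<theta> i * (?w * \<theta> i)) / 2)) *
     (ennreal (\<theta> i * exp (- ((\<theta> i)\<^sup>2 * h + (y i)\<^sup>2 / h) / 2) / sqrt (2 * pi * h)) * indicator {0<..} h) \<partial>lborel)"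
    unfolding abs_one ennreal_1 mult_1_left
  proof (rule nn_integral_cong)
    fix h :: real
    have "exp (- (\<theta> i * ((?w + h) * \<theta> i)) / 2 - y i * y i / h / 2) = exp (- (\<theta> i * (?w * \<theta> i)) / 2) * exp (- ((\<theta> i)\<^sup>2 * h + (y i)\<^sup>2 / h) / 2)"
      by (simp add: mult_exp_exp power2_eq_square field_simps)
    then have "orbit_dens i W \<theta> (y i) f (?w + h) = (if h > 0 then
       exp (- (\<theta> i * (?w * \<theta> i)) / 2) * (\<theta> i * exp (- ((\<theta> i)\<^sup>2 * h + (y i)\<^sup>2 / h) / 2) / sqrt (2 * pi * h)) else 0)"
      using i by (simp add: orbit_dens_def real_sqrt_mult)
    then show "ennreal (orbit_dens i W \<theta> (y i) f (?w + h)) = ennreal (exp (- (\<theta> i * (?w * \<theta> i)) / 2)) *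
     (ennreal (\<theta> i * exp (- ((\<theta> i)\<^sup>2 * h + (y i)\<^sup>2 / h) / 2) / sqrt (2 * pi * h)) * indicator {0<..} h)"
      by (simp add: indicator_def ennreal_mult'[symmetric])
  qed
  also have "\<dots> = ennreal (exp (- (\<theta> i * (?w * \<theta> i)) / 2)) *
     (\<integral>\<^sup>+h. ennreal (\<theta> i * exp (- ((\<theta> i)\<^sup>2 * h + (y i)\<^sup>2 / h) / 2) / sqrt (2 * pi * h)) * indicator {0<..} h \<partial>lborel)"
    by (rule nn_integral_cmult) simp
  also have "\<dots> = ennreal (exp (- (\<theta> i * (?w * \<theta> i)) / 2)) * ennreal (exp (- (\<theta> i * y i)))"
    by (simp only: single_integral[OF \<theta> y])
  also have "\<dots> = ennreal (exp (- (\<theta> i * (?w * \<theta> i)) / 2) * exp (- (\<theta> i * y i)))"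
    by (simp only: ennreal_mult' exp_ge_zero)
  also have "exp (- (\<theta> i * (?w * \<theta> i)) / 2) * exp (- (\<theta> i * y i)) = dens_A {i} W \<theta> y b"
    using iV by (simp add: dens_A_def o x si mult_exp_exp mult.commute)
  finally show ?thesis .
qed

lemma orbit_integral_pair:
  assumes i: "i \<in> V1" and \<theta>: "\<And>j. \<theta> j > 0" and y: "y i \<ge> 0" "y (star i) \<ge> 0" and W: "star_symmetric W"
  shows "(\<integral>\<^sup>+\<beta>. ennreal (orbit_dens i W \<theta> (y i) (y (star i)) \<beta>) \<partial>lborel)
      = (\<integral>\<^sup>+u. ennreal (dens_A {i} W \<theta> y (\<lambda>_. u)) \<partial>lborel)"
proof -
  have iF: "i \<notin> fixed" using i V1_not_star by blast
  let ?w = "W i i" and ?a = "W i (star i)" and ?c = "W (star i) i" and ?x = "\<theta> i" and ?y = "\<theta> (star i)"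
    and ?e = "y i" and ?f = "y (star i)"
  let ?C = "exp (- (?w * (?x * ?y))) / sqrt (2 * pi)"
  have [measurable]: "(\<lambda>\<beta>. ennreal (orbit_dens i W \<theta> ?e ?f \<beta>)) \<in> borel_measurable borel"
    unfolding orbit_dens_def using iF by simp
  let ?L = "\<lambda>h. exp (- (h * (?x * ?y)) - (2 * h * ?e * ?f + ?a * ?f\<^sup>2 + ?c * ?e\<^sup>2) / (h\<^sup>2 - ?a * ?c) / 2) / sqrt (h\<^sup>2 - ?a * ?c)"
    and ?R = "\<lambda>u. exp (- (?a * ?y\<^sup>2 * exp (2 * u) + ?c * ?x\<^sup>2 * exp (- 2 * u)) / 2 - ?f * ?x * exp (- u) - ?e * ?y * exp u)"
  have C: "?C \<ge> 0" by simp
  have "(\<integral>\<^sup>+\<beta>. ennreal (orbit_dens i W \<theta> ?e ?f \<beta>) \<partial>lborel)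
     = ennreal (\<bar>1\<bar>) * (\<integral>\<^sup>+h. ennreal (orbit_dens i W \<theta> ?e ?f (?w + 1 * h)) \<partial>lborel)"
    by (rule nn_integral_real_affine) simp_all
  also have "\<dots> = (\<integral>\<^sup>+h. ennreal ?C *
     (ennreal (?L h)
        * indicator {h. h > 0 \<and> h\<^sup>2 > ?a * ?c} h) \<partial>lborel)"
    unfolding abs_one ennreal_1 mult_1_left
  proof (rule nn_integral_cong)
    fix h :: real
    let ?N = "(2 * h * ?e * ?f + ?a * ?f\<^sup>2 + ?c * ?e\<^sup>2) / (h\<^sup>2 - ?a * ?c) / 2"
    have "exp (- ((?w + h) * (?x * ?y)) - ?N) = exp (- (?w * (?x * ?y))) * exp (- (h * (?x * ?y)) - ?N)"
      by (simp add: mult_exp_exp algebra_simps)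
    then have eq: "orbit_dens i W \<theta> ?e ?f (?w + h) = (if h > 0 \<and> h\<^sup>2 > ?a * ?c then
       ?C * (exp (- (h * (?x * ?y)) - ?N) / sqrt (h\<^sup>2 - ?a * ?c)) else 0)"
      using iF by (simp add: orbit_dens_def)
    show "ennreal (orbit_dens i W \<theta> ?e ?f (?w + h)) = ennreal ?C *
     (ennreal (exp (- (h * (?x * ?y)) - ?N) / sqrt (h\<^sup>2 - ?a * ?c)) * indicator {h. h > 0 \<and> h\<^sup>2 > ?a * ?c} h)"
    proof (cases "h > 0 \<and> h\<^sup>2 > ?a * ?c")
      case True
      have "ennreal (orbit_dens i W \<theta> ?e ?f (?w + h)) = ennreal ?C * ennreal (exp (- (h * (?x * ?y)) - ?N) / sqrt (h\<^sup>2 - ?a * ?c))"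
        by (simp only: eq if_P[OF True] ennreal_mult'[OF C])
      moreover have "indicator {h. h > 0 \<and> h\<^sup>2 > ?a * ?c} h = (1::ennreal)" using True by simp
      ultimately show ?thesis by (simp only: mult_1_right)
    next
      case False
      then show ?thesis by (simp only: eq if_False indicator_def mem_Collect_eq) simp
    qed
  qed
  also have "\<dots> = ennreal ?C * (\<integral>\<^sup>+h. ennreal (?L h)
        * indicator {h. h > 0 \<and> h\<^sup>2 > ?a * ?c} h \<partial>lborel)"
    by (rule nn_integral_cmult) measurable
  also have "\<dots> = ennreal ?C * (\<integral>\<^sup>+u. ennreal (?R u) \<partial>lborel)"
    using star_symmetricD(1)[OF W] \<theta> y by (subst pair_integral) simp_all
  also have "\<dots> = (\<integral>\<^sup>+u. ennreal ?C * ennreal (?R u) \<partial>lborel)"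
    by (rule nn_integral_cmult[symmetric]) simp
  also have "\<dots> = (\<integral>\<^sup>+u. ennreal (dens_A {i} W \<theta> y (\<lambda>_. u)) \<partial>lborel)"
  proof (rule nn_integral_cong)
    fix u :: real
    have "exp (- (2 * ?w * (?x * ?y) + A + B) / 2 - F - E) / s = exp (- (?w * (?x * ?y))) / s * exp (- (A + B) / 2 - F - E)"
      for A B E F s :: real by (simp add: mult_exp_exp field_simps)
    then show "ennreal ?C * ennreal (?R u)
      = ennreal (dens_A {i} W \<theta> y (\<lambda>_. u))"
      unfolding dens_A_single[OF i W] using C by (simp only: ennreal_mult'[symmetric])
  qed
  finally show ?thesis .
qed

section \<open>Integrating out one orbit at a time\<close>

lemma borel_measurable_coordinate:
  "(\<lambda>b::'n \<Rightarrow> real. b j) \<in> borel_measurable (\<Pi>\<^sub>M i\<in>I. lborel)"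
proof (cases "j \<in> I")
  case True
  then have "(\<lambda>b::'n \<Rightarrow> real. b j) \<in> measurable (\<Pi>\<^sub>M i\<in>I. lborel) lborel"
    by (rule measurable_component_singleton)
  then show ?thesis by simp
next
  case False
  then show ?thesis
    by (subst measurable_cong[where g = "\<lambda>_. undefined"]) (auto simp: space_PiM PiE_def extensional_def)
qed

lemma borel_measurable_sym_coord: "(\<lambda>b. sym_coord b j) \<in> borel_measurable (\<Pi>\<^sub>M i\<in>I. lborel)"
  unfolding sym_coord_def using borel_measurable_coordinate by (cases "j \<in> fixed \<union> V1") simp_all

lemma borel_measurable_anti_coord: "(\<lambda>b. anti_coord b j) \<in> borel_measurable (\<Pi>\<^sub>M i\<in>I. lborel)"
proof -
  consider "j \<in> fixed" | "j \<notin> fixed" "j \<in> V1" | "j \<notin> fixed" "j \<notin> V1" by blast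
  then show ?thesis
    using borel_measurable_coordinate[of j] borel_measurable_coordinate[of "star j"]
    by cases (simp_all add: anti_coord_def)
qed

lemma borel_measurable_exp_coord: "(\<lambda>b. exp_coord \<theta> b j) \<in> borel_measurable (\<Pi>\<^sub>M i\<in>I. lborel)"
proof -
  note [measurable] = borel_measurable_anti_coord
  show ?thesis unfolding exp_coord_def by measurable
qed

lemma borel_measurable_dens_S:
  assumes W: "\<forall>i j. W i j \<ge> 0"
  shows "(\<lambda>b. dens_S J W \<theta> y b) \<in> borel_measurable (\<Pi>\<^sub>M i\<in>I. lborel)"
proof -
  note [measurable] = borel_measurable_sym_coord measurable_m_matrix[OF W borel_measurable_sym_coord]
    borel_measurable_quad[OF borel_measurable_sym_coord] borel_measurable_det_block[OF borel_measurable_sym_coord]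
  show ?thesis unfolding dens_S_def by measurable
qed

lemma borel_measurable_dens_A:
  "(\<lambda>b. dens_A J W \<theta> y b) \<in> borel_measurable (\<Pi>\<^sub>M i\<in>I. lborel)"
proof -
  note [measurable] = borel_measurable_exp_coord
  show ?thesis unfolding dens_A_def by measurable
qed

lemma sym_coord_const: "sym_coord (\<lambda>_. \<beta>) = (\<lambda>_. \<beta>)"
  by (auto simp: sym_coord_def)

lemma sym_coord_upd: "i \<in> fixed \<union> V1 \<Longrightarrow> k \<in> orbits {i} \<Longrightarrow> sym_coord (x(i := \<beta>)) k = \<beta>"
  using sym_coord_cong[of "{i}" "x(i := \<beta>)" "\<lambda>_. \<beta>" k] by (simp add: sym_coord_const)

lemma orbit_dens_nonneg: "(\<And>j. \<theta> j > 0) \<Longrightarrow> orbit_dens i W \<theta> e f \<beta> \<ge> 0"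
  by (auto simp: orbit_dens_def less_imp_le)

lemma dens_A_nonneg: "dens_A I W \<theta> y b \<ge> 0"
  by (simp add: dens_A_def)

text \<open>
  Induction over the orbits; the weights and the field must be arbitrary, since the induction
  hypothesis is used with effective parameters that depend on the integration variable.
\<close>

theorem nn_integral_dens_S_eq_dens_A:
  assumes \<theta>: "\<And>j. \<theta> j > 0" and I: "I \<subseteq> fixed \<union> V1" and W: "star_symmetric W" and y: "\<forall>k. y k \<ge> 0"
  shows "(\<integral>\<^sup>+b. ennreal (dens_S I W \<theta> y b) \<partial>(\<Pi>\<^sub>M i\<in>I. lborel))
       = (\<integral>\<^sup>+a. ennreal (dens_A I W \<theta> y a) \<partial>(\<Pi>\<^sub>M i\<in>I \<inter> V1. lborel))"
proof -
  interpret P: product_sigma_finite "\<lambda>_::'n. lborel :: real measure" ..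
  have "finite I" by simp
  then show ?thesis using I W y
  proof (induction I arbitrary: W y rule: finite_induct)
    case empty
    have "dens_S {} W \<theta> y b = 1" "dens_A {} W \<theta> y b = 1" for b
      by (auto simp: dens_S_def dens_A_def orbits_def m_matrix_def quad_def det_block_empty intro: exI[of _ "\<lambda>_. 1"])
    then show ?case by simp
  next
    case (insert i I)
    note ins = insert.hyps(2) insert.prems(1)
    have i: "i \<in> fixed \<union> V1" and I: "I \<subseteq> fixed \<union> V1" using insert.prems(1) by auto
    note W = insert.prems(2) and y = insert.prems(3)
    note W0 = star_symmetricD(1)[OF W]
    let ?M = "\<Pi>\<^sub>M i\<in>I. (lborel :: real measure)"
    let ?N = "\<Pi>\<^sub>M i\<in>I \<inter> V1. (lborel :: real measure)"
    define d where "d \<beta> = orbit_dens i W \<theta> (y i) (y (star i)) \<beta>" for \<beta>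
    define W' where "W' \<beta> = schur_W (orbits {i}) W (\<lambda>_. \<beta>)" for \<beta>
    define y' where "y' \<beta> = schur_v (orbits {i}) W (\<lambda>_. \<beta>) y" for \<beta>
    define Y where "Y a q = y q + (\<Sum>l\<in>orbits I. W q l * exp_coord \<theta> a l)" for a q
  let ?D = "\<lambda>a \<beta>. ennreal (orbit_dens i W \<theta> (Y a i) (Y a (star i)) \<beta>)"
    have d0: "d \<beta> \<ge> 0" for \<beta> unfolding d_def by (rule orbit_dens_nonneg[OF \<theta>])
    have dS1: "dens_S {i} W \<theta> z (\<lambda>_. \<beta>) = orbit_dens i W \<theta> (z i) (z (star i)) \<beta>" for z \<beta>
      using dens_S_single[OF i W, of \<theta> z "\<lambda>_. \<beta>"] by simp
    have step: "dens_S (insert i I) W \<theta> y (x(i := \<beta>)) = d \<beta> * dens_S I (W' \<beta>) \<theta> (y' \<beta>) x" for x \<beta>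
    proof -
      have 1: "schur_W (orbits {i}) W (sym_coord (x(i := \<beta>))) = W' \<beta>" "schur_v (orbits {i}) W (sym_coord (x(i := \<beta>))) y = y' \<beta>"
        unfolding W'_def y'_def using schur_cong[of "orbits {i}" "sym_coord (x(i := \<beta>))" "\<lambda>_. \<beta>" W] sym_coord_upd[OF i] by auto
      have 2: "dens_S I (W' \<beta>) \<theta> (y' \<beta>) (x(i := \<beta>)) = dens_S I (W' \<beta>) \<theta> (y' \<beta>) x"
        using ins(1) by (intro dens_S_cong[OF I]) auto
      show ?thesis unfolding dens_S_insert[OF ins W] 1 2 dens_S_single[OF i W] by (simp add: d_def)
    qed
    have "(\<integral>\<^sup>+b. ennreal (dens_S (insert i I) W \<theta> y b) \<partial>(\<Pi>\<^sub>M i\<in>insert i I. lborel))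
       = (\<integral>\<^sup>+\<beta>. (\<integral>\<^sup>+x. ennreal (dens_S (insert i I) W \<theta> y (x(i := \<beta>))) \<partial>?M) \<partial>lborel)"
      using insert.hyps borel_measurable_dens_S[OF W0]
      by (intro P.product_nn_integral_insert_rev) simp_all
    also have "\<dots> = (\<integral>\<^sup>+\<beta>. (\<integral>\<^sup>+a. ?D a \<beta> * ennreal (dens_A I W \<theta> y a) \<partial>?N) \<partial>lborel)"
    proof (rule nn_integral_cong)
      fix \<beta> :: real
      have ex: "ennreal (d \<beta>) * ennreal (dens_A I (W' \<beta>) \<theta> (y' \<beta>) a)
         = ?D a \<beta> * ennreal (dens_A I W \<theta> y a)" for a
        using dens_S_dens_A_exchange[OF ins W, of \<theta> y "\<lambda>_. \<beta>" a]
        unfolding sym_coord_const dS1 W'_def[symmetric] y'_def[symmetric] d_def[symmetric] Y_def[symmetric]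
        by (simp only: ennreal_mult'[symmetric] d0 orbit_dens_nonneg[OF \<theta>])
      have IH: "ennreal (d \<beta>) * (\<integral>\<^sup>+x. ennreal (dens_S I (W' \<beta>) \<theta> (y' \<beta>) x) \<partial>?M)
          = ennreal (d \<beta>) * (\<integral>\<^sup>+a. ennreal (dens_A I (W' \<beta>) \<theta> (y' \<beta>) a) \<partial>?N)"
      proof (cases "m_matrix (orbits {i}) W (\<lambda>_. \<beta>)")
        case False
        then have "d \<beta> = 0" using dS1[of y \<beta>] by (simp add: d_def dens_S_def sym_coord_const)
        then show ?thesis by simp
      next
        case True
        have "star_symmetric (W' \<beta>)" unfolding W'_def
          using star_invariant_sym_coord[of "\<lambda>_. \<beta>"] by (intro star_symmetric_schur[OF star_closed_orbits W _ True]) (simp add: sym_coord_const)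
        moreover have "\<forall>k. y' \<beta> k \<ge> 0" unfolding y'_def by (rule schur_v_nonneg[OF W0 True y])
        ultimately show ?thesis using insert.IH[OF I] by simp
      qed
      have m1: "(\<lambda>x. ennreal (dens_S I (W' \<beta>) \<theta> (y' \<beta>) x)) \<in> borel_measurable ?M" if "d \<beta> \<noteq> 0"
      proof -
        have "m_matrix (orbits {i}) W (\<lambda>_. \<beta>)" using that dS1[of y \<beta>] by (auto simp: d_def dens_S_def sym_coord_const split: if_splits)
        then have "\<forall>k l. W' \<beta> k l \<ge> 0" unfolding W'_def by (rule schur_W_nonneg[OF W0])
        then show ?thesis using borel_measurable_dens_S by simp
      qed
      have "(\<integral>\<^sup>+x. ennreal (dens_S (insert i I) W \<theta> y (x(i := \<beta>))) \<partial>?M)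
          = (\<integral>\<^sup>+x. ennreal (d \<beta>) * ennreal (dens_S I (W' \<beta>) \<theta> (y' \<beta>) x) \<partial>?M)"
        unfolding step by (simp only: ennreal_mult'[OF d0])
      also have "\<dots> = ennreal (d \<beta>) * (\<integral>\<^sup>+x. ennreal (dens_S I (W' \<beta>) \<theta> (y' \<beta>) x) \<partial>?M)"
        using m1 by (cases "d \<beta> = 0") (simp_all add: nn_integral_cmult)
      also have "\<dots> = (\<integral>\<^sup>+a. ennreal (d \<beta>) * ennreal (dens_A I (W' \<beta>) \<theta> (y' \<beta>) a) \<partial>?N)"
        unfolding IH using borel_measurable_dens_A by (intro nn_integral_cmult[symmetric]) simp
      finally show "(\<integral>\<^sup>+x. ennreal (dens_S (insert i I) W \<theta> y (x(i := \<beta>))) \<partial>?M)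
        = (\<integral>\<^sup>+a. ?D a \<beta> * ennreal (dens_A I W \<theta> y a) \<partial>?N)"
        unfolding ex .
    qed
    also have "\<dots> = (\<integral>\<^sup>+a. (\<integral>\<^sup>+\<beta>. ?D a \<beta> * ennreal (dens_A I W \<theta> y a) \<partial>lborel) \<partial>?N)"
    proof -
      interpret N: sigma_finite_measure ?N by (rule P.sigma_finite) simp
      interpret Q: pair_sigma_finite ?N "lborel :: real measure" ..
      have [measurable]: "(\<lambda>a. Y a q) \<in> borel_measurable ?N" for q
        unfolding Y_def using borel_measurable_exp_coord by measurable
      have [measurable]: "(\<lambda>a. dens_A I W \<theta> y a) \<in> borel_measurable ?N" by (rule borel_measurable_dens_A)
      show ?thesis
        unfolding orbit_dens_def by (rule Q.Fubini') (cases "i \<in> fixed"; simp; measurable)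
    qed
    also have "\<dots> = (\<integral>\<^sup>+a. (\<integral>\<^sup>+\<beta>. ?D a \<beta> \<partial>lborel) * ennreal (dens_A I W \<theta> y a) \<partial>?N)"
    proof (intro nn_integral_cong nn_integral_multc)
      show "(\<lambda>\<beta>. ?D a \<beta>) \<in> borel_measurable lborel" for a
        unfolding orbit_dens_def by (cases "i \<in> fixed"; simp)
    qed
    also have "\<dots> = (\<integral>\<^sup>+a. ennreal (dens_A (insert i I) W \<theta> y a) \<partial>(\<Pi>\<^sub>M i\<in>insert i I \<inter> V1. lborel))"
    proof -
      have Y0: "Y a q \<ge> 0" for a q
        unfolding Y_def using y W0 \<theta> by (auto intro!: add_nonneg_nonneg sum_nonneg mult_nonneg_nonneg simp: exp_coord_def less_imp_le)
      have dAins: "dens_A (insert i I) W \<theta> y a = dens_A {i} W \<theta> (Y a) a * dens_A I W \<theta> y a" for a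
        unfolding Y_def by (rule dens_A_insert[OF ins W])
      show ?thesis
      proof (cases "i \<in> fixed")
        case True
        then have J: "insert i I \<inter> V1 = I \<inter> V1" using V1_not_star(2) by blast
        have "(\<integral>\<^sup>+\<beta>. ?D a \<beta> \<partial>lborel) * ennreal (dens_A I W \<theta> y a)
           = ennreal (dens_A (insert i I) W \<theta> y a)" for a
          using orbit_integral_fixed[where y = "Y a" and b = a and W = W and f = "Y a (star i)", OF True \<theta> Y0]
          by (simp only: dAins ennreal_mult'[OF dens_A_nonneg])
        then show ?thesis unfolding J by (simp only:)
      next
        case False
        then have iV: "i \<in> V1" using i by blast
        then have J: "insert i I \<inter> V1 = insert i (I \<inter> V1)" by blast
        have "(\<integral>\<^sup>+a. ennreal (dens_A (insert i I) W \<theta> y a) \<partial>(\<Pi>\<^sub>M i\<in>insert i I \<inter> V1. lborel))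
           = (\<integral>\<^sup>+a. (\<integral>\<^sup>+u. ennreal (dens_A (insert i I) W \<theta> y (a(i := u))) \<partial>lborel) \<partial>?N)"
          unfolding J using ins(1) borel_measurable_dens_A by (intro P.product_nn_integral_insert) simp_all
        also have "\<dots> = (\<integral>\<^sup>+a. (\<integral>\<^sup>+\<beta>. ?D a \<beta> \<partial>lborel) * ennreal (dens_A I W \<theta> y a) \<partial>?N)"
        proof (rule nn_integral_cong)
          fix a :: "'n \<Rightarrow> real"
          have "exp_coord \<theta> (a(i := u)) l = exp_coord \<theta> a l" if "l \<in> orbits I" for l u
            using ins(1) by (intro exp_coord_cong[OF I _ that]) auto
          then have Yu: "Y (a(i := u)) = Y a" for u unfolding Y_def by (intro ext) simp
          have "dens_A (insert i I) W \<theta> y (a(i := u)) = dens_A {i} W \<theta> (Y a) (\<lambda>_. u) * dens_A I W \<theta> y a" for u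
          proof -
            have 1: "dens_A {i} W \<theta> (Y a) (a(i := u)) = dens_A {i} W \<theta> (Y a) (\<lambda>_. u)"
              using i by (intro dens_A_cong) auto
            have 2: "dens_A I W \<theta> y (a(i := u)) = dens_A I W \<theta> y a"
              using ins(1) by (intro dens_A_cong[OF I]) auto
            show ?thesis unfolding dAins Yu 1 2 ..
          qed
          then have "(\<integral>\<^sup>+u. ennreal (dens_A (insert i I) W \<theta> y (a(i := u))) \<partial>lborel)
             = (\<integral>\<^sup>+u. ennreal (dens_A {i} W \<theta> (Y a) (\<lambda>_. u)) * ennreal (dens_A I W \<theta> y a) \<partial>lborel)"
            by (simp only: ennreal_mult'[OF dens_A_nonneg])
          also have "\<dots> = (\<integral>\<^sup>+u. ennreal (dens_A {i} W \<theta> (Y a) (\<lambda>_. u)) \<partial>lborel) * ennreal (dens_A I W \<theta> y a)"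
            by (rule nn_integral_multc) (simp add: dens_A_single[OF iV W])
          finally show "(\<integral>\<^sup>+u. ennreal (dens_A (insert i I) W \<theta> y (a(i := u))) \<partial>lborel)
             = (\<integral>\<^sup>+\<beta>. ?D a \<beta> \<partial>lborel) * ennreal (dens_A I W \<theta> y a)"
            unfolding orbit_integral_pair[where y = "Y a", OF iV \<theta> Y0 Y0 W] .
        qed
        finally show ?thesis ..
      qed
    qed
    finally show ?case .
  qed
qed

section \<open>Finiteness\<close>

text \<open>
  The negative of the exponent in the antisymmetric density, reindexed so that the field term is a
  sum of multiples of \<open>exp (a\<^sub>k)\<close>.
\<close>

definition action :: "('n \<Rightarrow> 'n \<Rightarrow> real) \<Rightarrow> ('n \<Rightarrow> real) \<Rightarrow> ('n \<Rightarrow> real) \<Rightarrow> ('n \<Rightarrow> real) \<Rightarrow> real" where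
  "action W \<theta> y a = (\<Sum>k\<in>UNIV. exp_coord \<theta> a (star k) * (\<Sum>l\<in>UNIV. W k l * exp_coord \<theta> a l)) / 2
     + (\<Sum>k\<in>UNIV. y k * exp_coord \<theta> a (star k))"

lemma anti_coord_star: "anti_coord a (star k) = - anti_coord a k"
proof -
  consider "k \<in> fixed" | "k \<in> V1" | "star k \<in> V1" using not_reps by blast
  then show ?thesis
    by cases (use V1_not_star[of k] V1_not_star[of "star k"] in \<open>auto simp: anti_coord_def fixed_iff\<close>)
qed

lemma action_ge_edge:
  assumes \<theta>: "\<forall>j. \<theta> j > 0" and W: "\<forall>i j. W i j \<ge> 0" and y: "\<forall>k. y k \<ge> 0"
  shows "\<theta> (star k) * W k l * \<theta> l * exp (anti_coord a k - anti_coord a l) / 2 \<le> action W \<theta> y a"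
proof -
  have x0: "exp_coord \<theta> a j \<ge> 0" for j using \<theta> by (simp add: exp_coord_def less_imp_le)
  have "exp_coord \<theta> a (star k) * (W k l * exp_coord \<theta> a l) \<le> exp_coord \<theta> a (star k) * (\<Sum>l\<in>UNIV. W k l * exp_coord \<theta> a l)"
    using x0 W by (intro mult_left_mono member_le_sum) auto
  also have "\<dots> \<le> (\<Sum>k\<in>UNIV. exp_coord \<theta> a (star k) * (\<Sum>l\<in>UNIV. W k l * exp_coord \<theta> a l))"
    using x0 W by (intro member_le_sum[of k UNIV "\<lambda>k. exp_coord \<theta> a (star k) * (\<Sum>l\<in>UNIV. W k l * exp_coord \<theta> a l)"])
      (auto intro!: mult_nonneg_nonneg sum_nonneg)
  finally have "exp_coord \<theta> a (star k) * (W k l * exp_coord \<theta> a l) / 2 \<le> action W \<theta> y a"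
    unfolding action_def using x0 y by (intro add_increasing2) (auto intro!: sum_nonneg)
  moreover have "exp_coord \<theta> a (star k) * (W k l * exp_coord \<theta> a l) = \<theta> (star k) * W k l * \<theta> l * exp (anti_coord a k - anti_coord a l)"
    by (simp add: exp_coord_def anti_coord_star exp_diff exp_minus divide_inverse)
  ultimately show ?thesis by simp
qed

lemma action_ge_vertex:
  assumes \<theta>: "\<forall>j. \<theta> j > 0" and W: "\<forall>i j. W i j \<ge> 0" and y: "\<forall>k. y k \<ge> 0"
  shows "y k * \<theta> (star k) * exp (anti_coord a k) \<le> action W \<theta> y a"
proof -
  have x0: "exp_coord \<theta> a j \<ge> 0" for j using \<theta> by (simp add: exp_coord_def less_imp_le)
  have "y k * exp_coord \<theta> a (star k) \<le> (\<Sum>k\<in>UNIV. y k * exp_coord \<theta> a (star k))"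
    using x0 y by (intro member_le_sum) auto
  also have "\<dots> \<le> action W \<theta> y a"
    unfolding action_def using x0 W by (intro add_increasing) (auto intro!: sum_nonneg mult_nonneg_nonneg divide_nonneg_nonneg)
  finally show ?thesis by (simp add: exp_coord_def mult_ac)
qed

lemma le_of_exp_le:
  assumes "c > 0" "c * exp t \<le> (T::real)"
  shows "t \<le> 1 / c * T"
proof -
  have "c * t \<le> c * exp t" using assms(1) exp_ge_add_one_self[of t] by (intro mult_left_mono) linarith+
  then have "c * t \<le> T" using assms(2) by linarith
  then show ?thesis using assms(1) by (simp add: field_simps)
qed

text \<open>
  From \<open>t \<le> exp t\<close> every edge bounds the difference of the two end values by a multiple of the
  action, and every vertex with a field bounds its own value. Such bounds add up along paths. A
  path from \<open>i\<close> to \<open>star i\<close> bounds twice the value at \<open>i\<close>, because the values are antisymmetric.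
\<close>

lemma action_controls:
  assumes \<theta>: "\<forall>j. \<theta> j > 0" and W: "\<forall>i j. W i j \<ge> 0" and y: "\<forall>k. y k \<ge> 0"
    and E: "\<And>i j. (i, j) \<in> E \<Longrightarrow> W i j > 0"
    and paths: "\<forall>i. (i, star i) \<in> E\<^sup>* \<or> (\<exists>j. (i, j) \<in> E\<^sup>* \<and> y j > 0)"
  shows "\<exists>C \<ge> 0. \<forall>a. \<forall>i. anti_coord a i \<le> C * action W \<theta> y a"
proof -
  have T0: "action W \<theta> y a \<ge> 0" for a
    using action_ge_vertex[OF assms(1-3), of undefined a] y \<theta>
    by (smt (verit) exp_gt_zero mult_nonneg_nonneg)
  have path: "\<exists>C \<ge> 0. \<forall>a. anti_coord a i - anti_coord a j \<le> C * action W \<theta> y a" if "(i, j) \<in> E\<^sup>*" for i j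
    using that
  proof (induction rule: rtrancl_induct)
    case base
    show ?case by (rule exI[of _ 0]) simp
  next
    case (step j k)
    then obtain C where C: "C \<ge> 0" "\<And>a. anti_coord a i - anti_coord a j \<le> C * action W \<theta> y a" by blast
    define c where "c = \<theta> (star j) * W j k * \<theta> k / 2"
    have c: "c > 0" unfolding c_def using \<theta> E[OF step.hyps(2)] by simp
    have "anti_coord a j - anti_coord a k \<le> 1 / c * action W \<theta> y a" for a
      using action_ge_edge[OF assms(1-3), of j k a] by (intro le_of_exp_le c) (simp add: c_def)
    then have "anti_coord a i - anti_coord a k \<le> (C + 1 / c) * action W \<theta> y a" for a
      using C(2)[of a] by (simp add: distrib_right) (smt (verit))
    then show ?case using C(1) c by (intro exI[of _ "C + 1 / c"]) auto
  qed
  have "\<exists>C \<ge> 0. \<forall>a. anti_coord a i \<le> C * action W \<theta> y a" for i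
  proof (cases "(i, star i) \<in> E\<^sup>*")
    case True
    then obtain C where C: "C \<ge> 0" "\<And>a. anti_coord a i - anti_coord a (star i) \<le> C * action W \<theta> y a" using path by blast
    have "anti_coord a i \<le> C / 2 * action W \<theta> y a" for a using C(2)[of a] by (simp add: anti_coord_star)
    then show ?thesis using C(1) by (intro exI[of _ "C / 2"]) auto
  next
    case False
    then obtain j where j: "(i, j) \<in> E\<^sup>*" "y j > 0" using paths by blast
    obtain C where C: "C \<ge> 0" "\<And>a. anti_coord a i - anti_coord a j \<le> C * action W \<theta> y a" using path[OF j(1)] by blast
    define c where "c = y j * \<theta> (star j)"
    have c: "c > 0" unfolding c_def using \<theta> j by simp
    have "anti_coord a j \<le> 1 / c * action W \<theta> y a" for a
      using action_ge_vertex[OF assms(1-3), of j a] by (intro le_of_exp_le c) (simp add: c_def)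
    then have "anti_coord a i \<le> (C + 1 / c) * action W \<theta> y a" for a
      using C(2)[of a] by (simp add: distrib_right) (smt (verit))
    then show ?thesis using C(1) c by (intro exI[of _ "C + 1 / c"]) auto
  qed
  then obtain C where C: "\<And>i. C i \<ge> 0" "\<And>i a. anti_coord a i \<le> C i * action W \<theta> y a" by metis
  have "anti_coord a i \<le> (\<Sum>i\<in>UNIV. C i) * action W \<theta> y a" for a i
  proof -
    have "C i \<le> (\<Sum>i\<in>UNIV. C i)" using C(1) by (intro member_le_sum) auto
    then show ?thesis using C(2)[of a i] T0[of a] by (meson mult_right_mono order_trans)
  qed
  then show ?thesis using C(1) by (intro exI[of _ "\<Sum>i\<in>UNIV. C i"]) (auto intro!: sum_nonneg)
qed

lemma orbits_reps: "orbits (fixed \<union> V1) = UNIV"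
  using V_union by (auto simp: orbits_def)

lemma reps_V1: "(fixed \<union> V1) \<inter> V1 = V1"
  by blast

lemma dens_A_action: "dens_A (fixed \<union> V1) W \<theta> y a = exp (- action W \<theta> y a) / sqrt (2 * pi) ^ card V1"
proof -
  have "(\<Sum>k\<in>UNIV. y (star k) * exp_coord \<theta> a k) = (\<Sum>k\<in>UNIV. y k * exp_coord \<theta> a (star k))"
    by (subst sum_star[symmetric]) (simp_all add: star_closed_def)
  then show ?thesis unfolding dens_A_def orbits_reps reps_V1 action_def by simp
qed

text \<open>
  The bound on all coordinates, used at \<open>i\<close> and at \<open>star i\<close>, makes the action grow at least
  linearly in the absolute values, so the density lies below a product of integrable functions of
  one variable.
\<close>

lemma nn_integral_dens_A_finite:
  assumes \<theta>: "\<forall>j. \<theta> j > 0" and W: "\<forall>i j. W i j \<ge> 0" and y: "\<forall>k. y k \<ge> 0"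
    and E: "\<And>i j. (i, j) \<in> E \<Longrightarrow> W i j > 0"
    and paths: "\<forall>i. (i, star i) \<in> E\<^sup>* \<or> (\<exists>j. (i, j) \<in> E\<^sup>* \<and> y j > 0)"
  shows "(\<integral>\<^sup>+a. ennreal (dens_A (fixed \<union> V1) W \<theta> y a) \<partial>(\<Pi>\<^sub>M i\<in>V1. lborel)) < top"
proof -
  interpret P: product_sigma_finite "\<lambda>_::'n. lborel :: real measure" ..
  obtain C where C: "C \<ge> 0" "\<And>a i. anti_coord a i \<le> C * action W \<theta> y a"
    using action_controls[OF assms] by blast
  define M where "M = real (card V1) * C + 1"
  define e where "e = 1 / M"
  have M: "M > 0" unfolding M_def using C(1) by (simp add: add_nonneg_pos)
  have e: "e > 0" using M by (simp add: e_def)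
  have bound: "(\<Sum>i\<in>V1. e * \<bar>a i\<bar>) \<le> action W \<theta> y a" for a
  proof -
    have T0: "action W \<theta> y a \<ge> 0"
      using action_ge_vertex[OF \<theta> W y, of undefined a] y \<theta> by (smt (verit) exp_gt_zero mult_nonneg_nonneg)
    have "\<bar>a i\<bar> \<le> C * action W \<theta> y a" if "i \<in> V1" for i
    proof -
      have "anti_coord a i = a i" using that V1_not_star(2) by (simp add: anti_coord_def)
      then show ?thesis using C(2)[of a i] C(2)[of a "star i"] by (simp add: anti_coord_star)
    qed
    then have "(\<Sum>i\<in>V1. \<bar>a i\<bar>) \<le> real (card V1) * (C * action W \<theta> y a)"
      by (rule sum_bounded_above)
    also have "\<dots> \<le> M * action W \<theta> y a" using T0 by (simp add: M_def algebra_simps)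
    finally show ?thesis using M by (simp add: e_def sum_divide_distrib[symmetric] field_simps)
  qed
  have "ennreal (dens_A (fixed \<union> V1) W \<theta> y a) \<le> (\<Prod>i\<in>V1. ennreal (exp (- (e * \<bar>a i\<bar>))))" for a
  proof -
    have "dens_A (fixed \<union> V1) W \<theta> y a \<le> exp (- action W \<theta> y a)"
    proof -
      have "sqrt (2 * pi) \<ge> 1" using pi_gt3 by simp
      then have "sqrt (2 * pi) ^ card V1 \<ge> 1" by (rule one_le_power)
      then show ?thesis unfolding dens_A_action by (simp add: divide_le_eq mult_le_cancel_left1)
    qed
    also have "\<dots> \<le> exp (- (\<Sum>i\<in>V1. e * \<bar>a i\<bar>))" using bound[of a] by simp
    also have "\<dots> = (\<Prod>i\<in>V1. exp (- (e * \<bar>a i\<bar>)))"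
      by (simp add: exp_sum sum_negf[symmetric] del: sum_negf)
    finally show ?thesis by (simp add: prod_ennreal ennreal_leI)
  qed
  then have "(\<integral>\<^sup>+a. ennreal (dens_A (fixed \<union> V1) W \<theta> y a) \<partial>(\<Pi>\<^sub>M i\<in>V1. lborel))
     \<le> (\<integral>\<^sup>+a. (\<Prod>i\<in>V1. ennreal (exp (- (e * \<bar>a i\<bar>)))) \<partial>(\<Pi>\<^sub>M i\<in>V1. lborel))"
    by (intro nn_integral_mono)
  also have "\<dots> = (\<Prod>i\<in>V1. \<integral>\<^sup>+u. ennreal (exp (- (e * \<bar>u\<bar>))) \<partial>lborel)"
    by (rule P.product_nn_integral_prod) simp_all
  also have "\<dots> < top"
    using nn_integral_exp_abs_finite[OF e] by (simp add: power_less_top_ennreal)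
  finally show ?thesis .
qed

section \<open>From coordinates to the measures\<close>

lemma symm_emb_nth: "symm_emb star V1 b $ i = sym_coord b i"
  by (simp add: symm_emb_def sym_coord_def)

lemma anti_emb_nth: "anti_emb star V1 b $ i = anti_coord b i"
  by (simp add: anti_emb_def anti_coord_def)

lemma exp_star_anti_emb: "exp_star star (anti_emb star V1 b) \<theta> $ i = exp_coord (\<lambda>i. \<theta> $ i) b i"
  by (simp add: exp_star_def anti_emb_nth exp_coord_def)

lemma symm_emb_in: "symm_emb star V1 b \<in> symm_space star"
  using star_invariant_sym_coord[of b] by (simp add: symm_space_def vec_eq_iff symm_emb_nth star_invariant_def)

lemma anti_emb_in: "anti_emb star V1 b \<in> anti_space star"
  by (simp add: anti_space_def vec_eq_iff anti_emb_nth anti_coord_star)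

lemma dim_image_coordinate_space:
  fixes f :: "real^'n \<Rightarrow> real^'n"
  assumes f: "linear f" and inj: "\<And>x. \<lbrakk>\<And>i. i \<notin> d \<Longrightarrow> x $ i = 0; f x = 0\<rbrakk> \<Longrightarrow> x = 0"
  shows "dim (f ` {x. \<forall>i. i \<notin> d \<longrightarrow> x $ i = 0}) = card d"
proof -
  let ?S = "{x::real^'n. \<forall>i. i \<notin> d \<longrightarrow> x $ i = 0}"
  have S: "subspace ?S" by (auto simp: subspace_def)
  have "inj_on f ?S"
    using inj by (subst linear_inj_on_iff_eq_0[OF f S]) auto
  moreover have "span ?S = ?S" using S by (simp only: span_eq_iff)
  ultimately have "dim (f ` ?S) = dim ?S"
    by (intro eucl.dim_image_eq f) (simp only:)
  also have "\<dots> = card d" using dim_substandard_cart[of d, where 'a = real] by (simp add: dim_vec_eq)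
  finally show ?thesis .
qed

lemma dim_symm_space: "dim (symm_space star) = card (fixed \<union> V1)"
proof -
  let ?f = "\<lambda>x::real^'n. symm_emb star V1 (\<lambda>i. x $ i)"
  have lin: "linear ?f"
    by (rule linearI) (simp_all add: vec_eq_iff symm_emb_nth sym_coord_def)
  have "?f ` {x. \<forall>i. i \<notin> fixed \<union> V1 \<longrightarrow> x $ i = 0} = symm_space star"
  proof (intro set_eqI iffI)
    fix s assume s: "s \<in> symm_space star"
    then have ss: "s $ star i = s $ i" for i by (auto simp: symm_space_def vec_eq_iff)
    show "s \<in> ?f ` {x. \<forall>i. i \<notin> fixed \<union> V1 \<longrightarrow> x $ i = 0}"
    proof (rule image_eqI)
      show "s = ?f (\<chi> i. if i \<in> fixed \<union> V1 then s $ i else 0)"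
        using ss not_reps by (auto simp: vec_eq_iff symm_emb_nth sym_coord_def)
    qed auto
  qed (auto simp: symm_emb_in)
  moreover have "dim (?f ` {x. \<forall>i. i \<notin> fixed \<union> V1 \<longrightarrow> x $ i = 0}) = card (fixed \<union> V1)"
  proof (rule dim_image_coordinate_space[OF lin])
    fix x :: "real^'n" assume x: "\<And>i. i \<notin> fixed \<union> V1 \<Longrightarrow> x $ i = 0" "?f x = 0"
    have "x $ i = 0" for i
      using x(1)[of i] arg_cong[OF x(2), of "\<lambda>v. v $ i"] by (cases "i \<in> fixed \<union> V1") (auto simp: symm_emb_nth sym_coord_def)
    then show "x = 0" by (simp add: vec_eq_iff)
  qed
  ultimately show ?thesis by simp
qed

lemma dim_anti_space: "dim (anti_space star) = card V1"
proof -
  let ?f = "\<lambda>x::real^'n. anti_emb star V1 (\<lambda>i. x $ i)"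
  have lin: "linear ?f"
    by (rule linearI) (simp_all add: vec_eq_iff anti_emb_nth anti_coord_def)
  have "?f ` {x. \<forall>i. i \<notin> V1 \<longrightarrow> x $ i = 0} = anti_space star"
  proof (intro set_eqI iffI)
    fix s assume s: "s \<in> anti_space star"
    then have ss: "s $ star i = - s $ i" for i by (auto simp: anti_space_def vec_eq_iff)
    have s0: "s $ i = 0" if "i \<in> fixed" for i using ss[of i] that by (simp add: fixed_iff)
    show "s \<in> ?f ` {x. \<forall>i. i \<notin> V1 \<longrightarrow> x $ i = 0}"
    proof (rule image_eqI)
      show "s = ?f (\<chi> i. if i \<in> V1 then s $ i else 0)"
        using ss s0 not_reps by (auto simp: vec_eq_iff anti_emb_nth anti_coord_def)
    qed auto
  qed (auto simp: anti_emb_in)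
  moreover have "dim (?f ` {x. \<forall>i. i \<notin> V1 \<longrightarrow> x $ i = 0}) = card V1"
  proof (rule dim_image_coordinate_space[OF lin])
    fix x :: "real^'n" assume x: "\<And>i. i \<notin> V1 \<Longrightarrow> x $ i = 0" "?f x = 0"
    have "x $ i = 0" for i
      using x(1)[of i] arg_cong[OF x(2), of "\<lambda>v. v $ i"] V1_not_star(2)[of i]
      by (cases "i \<in> V1") (auto simp: anti_emb_nth anti_coord_def)
    then show "x = 0" by (simp add: vec_eq_iff)
  qed
  ultimately show ?thesis by simp
qed

lemma symm_emb_measurable:
  "symm_emb star V1 \<in> measurable (\<Pi>\<^sub>M i\<in>I. lborel) (restrict_space borel (symm_space star))"
proof (rule measurable_restrict_space2)
  show "symm_emb star V1 \<in> borel_measurable (\<Pi>\<^sub>M i\<in>I. lborel)"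
  proof (rule borel_measurable_vec_componentwise)
    show "(\<lambda>b. symm_emb star V1 b $ j) \<in> borel_measurable (\<Pi>\<^sub>M i\<in>I. lborel)" for j
      unfolding symm_emb_nth by (rule borel_measurable_sym_coord)
  qed
  show "symm_emb star V1 \<in> space (\<Pi>\<^sub>M i\<in>I. lborel) \<rightarrow> symm_space star"
    using symm_emb_in by blast
qed

lemma anti_emb_measurable:
  "anti_emb star V1 \<in> measurable (\<Pi>\<^sub>M i\<in>I. lborel) (restrict_space borel (anti_space star))"
proof (rule measurable_restrict_space2)
  show "anti_emb star V1 \<in> borel_measurable (\<Pi>\<^sub>M i\<in>I. lborel)"
  proof (rule borel_measurable_vec_componentwise)
    show "(\<lambda>b. anti_emb star V1 b $ j) \<in> borel_measurable (\<Pi>\<^sub>M i\<in>I. lborel)" for j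
      unfolding anti_emb_nth by (rule borel_measurable_anti_coord)
  qed
  show "anti_emb star V1 \<in> space (\<Pi>\<^sub>M i\<in>I. lborel) \<rightarrow> anti_space star"
    using anti_emb_in by blast
qed

lemma emeasure_density_distr:
  assumes g: "g \<in> measurable M (restrict_space borel S)" and f: "f \<in> borel_measurable borel"
  shows "emeasure (density (distr M (restrict_space borel S) g) f) S = (\<integral>\<^sup>+x. f (g x) \<partial>M)"
proof -
  let ?D = "distr M (restrict_space borel S) g"
  have S: "space ?D = S" by (simp add: space_restrict_space)
  have f': "f \<in> borel_measurable (restrict_space borel S)" using f by (rule measurable_restrict_space1)
  have "emeasure (density ?D f) (space ?D) = (\<integral>\<^sup>+x. f x * indicator (space ?D) x \<partial>?D)"
    using f' by (intro emeasure_density) auto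
  also have "\<dots> = (\<integral>\<^sup>+x. f x \<partial>?D)" by (intro nn_integral_cong) auto
  also have "\<dots> = (\<integral>\<^sup>+x. f (g x) \<partial>M)" using f' g by (intro nn_integral_distr) auto
  finally show ?thesis unfolding S .
qed

text \<open>
  The constant factor \<open>exp (\<langle>\<theta>,W\<theta>\<rangle>/2 + \<langle>\<theta>,\<eta>\<rangle>)\<close> by which the total masses differ from the
  integrals of \<open>dens_S\<close> and \<open>dens_A\<close>.
\<close>

definition norm_const :: "('n \<Rightarrow> 'n \<Rightarrow> real) \<Rightarrow> ('n \<Rightarrow> real) \<Rightarrow> ('n \<Rightarrow> real) \<Rightarrow> real" where
  "norm_const W \<theta> y = exp ((\<Sum>k\<in>UNIV. \<theta> (star k) * (\<Sum>l\<in>UNIV. W k l * \<theta> l)) / 2 + (\<Sum>k\<in>UNIV. y (star k) * \<theta> k))"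

lemma emeasure_nu_S:
  fixes W :: "real^'n^'n"
  assumes W: "\<forall>i j. W $ i $ j \<ge> 0"
  shows "emeasure (nu_S star V1 W \<theta> \<eta>) (symm_space star)
     = ennreal (norm_const (\<lambda>i j. W $ i $ j) (\<lambda>i. \<theta> $ i) (\<lambda>i. \<eta> $ i)) *
       (\<integral>\<^sup>+b. ennreal (dens_S (fixed \<union> V1) (\<lambda>i j. W $ i $ j) (\<lambda>i. \<theta> $ i) (\<lambda>i. \<eta> $ i) b) \<partial>(\<Pi>\<^sub>M i\<in>fixed \<union> V1. lborel))"
proof -
  let ?W = "\<lambda>i j. W $ i $ j" and ?\<theta> = "\<lambda>i. \<theta> $ i" and ?\<eta> = "\<lambda>i. \<eta> $ i"
  let ?C = "norm_const ?W ?\<theta> ?\<eta>"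
  define f where "f \<beta> = (if m_matrix UNIV ?W (\<lambda>i. \<beta> $ i) then
      (\<Prod>i\<in>fixed. \<theta> $ i) / sqrt (2 * pi) ^ card (fixed \<union> V1)
      * exp (- (\<Sum>i\<in>UNIV. \<theta> $ star i * (\<beta> $ i * \<theta> $ i)) / 2 - quad star UNIV ?W (\<lambda>i. \<beta> $ i) ?\<eta> / 2)
      / sqrt (det (block UNIV ?W (\<lambda>i. \<beta> $ i))) else 0)" for \<beta> :: "real^'n"
  have dens: "(\<Prod>i\<in>fixed. \<theta> $ i) * (if pos_mat (H_mat W \<beta>) then 1 else 0) / sqrt (2 * pi) ^ dim (symm_space star)
      * exp (- (1/2) * star_inner star \<theta> (H_mat W \<beta> *v \<theta>)
             - (1/2) * star_inner star \<eta> (matrix_inv (H_mat W \<beta>) *v \<eta>)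
             + star_inner star \<theta> \<eta>)
      / sqrt (det (H_mat W \<beta>)) = ?C * f \<beta>" for \<beta>
  proof (cases "m_matrix UNIV ?W (\<lambda>i. \<beta> $ i)")
    case False
    then show ?thesis by (simp add: f_def H_mat_block pos_mat_block_iff[OF W])
  next
    case True
    then have p: "pos_mat (H_mat W \<beta>)" by (simp add: H_mat_block pos_mat_block_iff[OF W])
    have q: "star_inner star \<eta> (matrix_inv (H_mat W \<beta>) *v \<eta>) = quad star UNIV ?W (\<lambda>i. \<beta> $ i) ?\<eta>"
      unfolding star_inner_def quad_def H_mat_block matrix_inv_mult_eq_sol[OF m_matrix_det_nonzero[OF W True]] ..
    have h: "star_inner star \<theta> (H_mat W \<beta> *v \<theta>) = (\<Sum>i\<in>UNIV. \<theta> $ star i * (\<beta> $ i * \<theta> $ i))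
       - (\<Sum>k\<in>UNIV. \<theta> $ star k * (\<Sum>l\<in>UNIV. W $ k $ l * \<theta> $ l))"
      by (simp add: star_inner_def H_mat_block block_mult_vec row_apply_def right_diff_distrib sum_subtractf)
    have t: "star_inner star \<theta> \<eta> = (\<Sum>k\<in>UNIV. \<eta> $ star k * \<theta> $ k)"
      unfolding star_inner_def using sum_star[of UNIV "\<lambda>k. \<eta> $ star k * \<theta> $ k"]
      by (simp add: star_closed_def mult.commute)
    have e: "exp (- (1/2) * (s - A) - (1/2) * Q + Y) = exp (A / 2 + Y) * exp (- s / 2 - Q / 2)" for s A Q Y :: real
      by (simp add: mult_exp_exp field_simps)
    show ?thesis
      unfolding f_def if_P[OF True] if_P[OF p] q h t e dim_symm_space norm_const_def
      by (simp add: H_mat_block)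
  qed
  have fm: "f \<in> borel_measurable borel"
  proof -
    note b = borel_measurable_vec_nth
    note [measurable] = b measurable_m_matrix[OF W b] borel_measurable_quad[OF b] borel_measurable_det_block[OF b]
    show ?thesis unfolding f_def[abs_def] by measurable
  qed
  have fd: "f (symm_emb star V1 b) = dens_S (fixed \<union> V1) ?W ?\<theta> ?\<eta> b" for b
  proof -
    have "(fixed \<union> V1) \<inter> fixed = fixed" by blast
    then show ?thesis by (simp only: f_def dens_S_def orbits_reps symm_emb_nth)
  qed
  have C: "?C \<ge> 0" by (simp add: norm_const_def)
  have "emeasure (nu_S star V1 W \<theta> \<eta>) (symm_space star)
     = (\<integral>\<^sup>+b. ennreal (?C * f (symm_emb star V1 b)) \<partial>(\<Pi>\<^sub>M i\<in>fixed \<union> V1. lborel))"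
    unfolding nu_S_def dens symm_lebesgue_def
    using fm by (intro emeasure_density_distr symm_emb_measurable) simp
  also have "\<dots> = (\<integral>\<^sup>+b. ennreal ?C * ennreal (dens_S (fixed \<union> V1) ?W ?\<theta> ?\<eta> b) \<partial>(\<Pi>\<^sub>M i\<in>fixed \<union> V1. lborel))"
    by (simp only: fd ennreal_mult'[OF C])
  also have "\<dots> = ennreal ?C * (\<integral>\<^sup>+b. ennreal (dens_S (fixed \<union> V1) ?W ?\<theta> ?\<eta> b) \<partial>(\<Pi>\<^sub>M i\<in>fixed \<union> V1. lborel))"
    using borel_measurable_dens_S[OF W] by (intro nn_integral_cmult) simp
  finally show ?thesis .
qed

lemma emeasure_nu_A:
  fixes W :: "real^'n^'n"
  shows "emeasure (nu_A star V1 W \<theta> \<eta>) (anti_space star)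
     = ennreal (norm_const (\<lambda>i j. W $ i $ j) (\<lambda>i. \<theta> $ i) (\<lambda>i. \<eta> $ i)) *
       (\<integral>\<^sup>+a. ennreal (dens_A (fixed \<union> V1) (\<lambda>i j. W $ i $ j) (\<lambda>i. \<theta> $ i) (\<lambda>i. \<eta> $ i) a) \<partial>(\<Pi>\<^sub>M i\<in>V1. lborel))"
proof -
  let ?W = "\<lambda>i j. W $ i $ j" and ?\<theta> = "\<lambda>i. \<theta> $ i" and ?\<eta> = "\<lambda>i. \<eta> $ i"
  let ?C = "norm_const ?W ?\<theta> ?\<eta>"
  define f where "f a = 1 / sqrt (2 * pi) ^ dim (anti_space star)
      * exp (- (1/2) * star_inner star (exp_star star a \<theta>) (W *v exp_star star a \<theta>)
             + (1/2) * star_inner star \<theta> (W *v \<theta>)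
             - star_inner star \<eta> (exp_star star a \<theta> - \<theta>))" for a :: "real^'n"
  have fm: "f \<in> borel_measurable borel"
  proof -
    note [measurable] = borel_measurable_vec_nth
    show ?thesis
      unfolding f_def[abs_def] star_inner_def exp_star_def matrix_vector_mult_def
      by (simp add: vector_minus_component) measurable
  qed
  have fd: "f (anti_emb star V1 b) = ?C * dens_A (fixed \<union> V1) ?W ?\<theta> ?\<eta> b" for b
  proof -
    have 1: "star_inner star (exp_star star (anti_emb star V1 b) \<theta>) (W *v exp_star star (anti_emb star V1 b) \<theta>)
       = (\<Sum>k\<in>UNIV. exp_coord ?\<theta> b (star k) * (\<Sum>l\<in>UNIV. W $ k $ l * exp_coord ?\<theta> b l))"
      by (simp add: star_inner_def exp_star_anti_emb matrix_vector_mult_def)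
    have 2: "star_inner star \<theta> (W *v \<theta>) = (\<Sum>k\<in>UNIV. \<theta> $ star k * (\<Sum>l\<in>UNIV. W $ k $ l * \<theta> $ l))"
      by (simp add: star_inner_def matrix_vector_mult_def)
    have 3: "star_inner star \<eta> (exp_star star (anti_emb star V1 b) \<theta> - \<theta>)
       = (\<Sum>k\<in>UNIV. \<eta> $ star k * exp_coord ?\<theta> b k) - (\<Sum>k\<in>UNIV. \<eta> $ star k * \<theta> $ k)"
      by (simp add: star_inner_def exp_star_anti_emb right_diff_distrib sum_subtractf)
    have e: "1 / D * exp (- (1/2) * s + (1/2) * A - (Q - Y)) = exp (A / 2 + Y) * (exp (- s / 2 - Q) / D)" for s A Q Y D :: real
      by (simp add: mult_exp_exp field_simps)
    show ?thesis
      unfolding f_def 1 2 3 e dim_anti_space norm_const_def dens_A_def orbits_reps reps_V1 ..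
  qed
  have C: "?C \<ge> 0" by (simp add: norm_const_def)
  have "emeasure (nu_A star V1 W \<theta> \<eta>) (anti_space star)
     = (\<integral>\<^sup>+b. ennreal (f (anti_emb star V1 b)) \<partial>(\<Pi>\<^sub>M i\<in>V1. lborel))"
    unfolding nu_A_def f_def[symmetric] anti_lebesgue_def
    using fm by (intro emeasure_density_distr anti_emb_measurable) simp
  also have "\<dots> = (\<integral>\<^sup>+b. ennreal ?C * ennreal (dens_A (fixed \<union> V1) ?W ?\<theta> ?\<eta> b) \<partial>(\<Pi>\<^sub>M i\<in>V1. lborel))"
    by (simp only: fd ennreal_mult'[OF C])
  also have "\<dots> = ennreal ?C * (\<integral>\<^sup>+b. ennreal (dens_A (fixed \<union> V1) ?W ?\<theta> ?\<eta> b) \<partial>(\<Pi>\<^sub>M i\<in>V1. lborel))"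
    using borel_measurable_dens_A by (intro nn_integral_cmult) simp
  finally show ?thesis .
qed

end

theorem theorem6p2:
  fixes E :: "('n::finite \<times> 'n) set"
    and star :: "'n \<Rightarrow> 'n"
    and V1 :: "'n set"
    and W :: "real^'n^'n"
    and \<theta> \<eta> :: "real^'n"
  assumes star_involution: "\<And>i. star (star i) = i"
    and E_star: "\<And>i j. (i, j) \<in> E \<Longrightarrow> (star j, star i) \<in> E"
    and V_union: "fixed_pts star \<union> V1 \<union> star ` V1 = UNIV"
    and V_disjoint: "fixed_pts star \<inter> V1 = {}" "fixed_pts star \<inter> star ` V1 = {}"
      "V1 \<inter> star ` V1 = {}"
    and W_pos: "\<And>i j. (i, j) \<in> E \<Longrightarrow> W $ i $ j > 0"
    and W_zero: "\<And>i j. (i, j) \<notin> E \<Longrightarrow> W $ i $ j = 0"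
    and W_star: "\<And>i j. (i, j) \<in> E \<Longrightarrow> W $ i $ j = W $ star j $ star i"
    and theta_pos: "\<And>i. \<theta> $ i > 0"
    and eta_nonneg: "\<And>i. \<eta> $ i \<ge> 0"
  shows "emeasure (nu_S star V1 W \<theta> \<eta>) (symm_space star)
           = emeasure (nu_A star V1 W \<theta> \<eta>) (anti_space star)
    \<and> ((\<forall>i. (i, star i) \<in> E\<^sup>* \<or> (\<exists>j. (i, j) \<in> E\<^sup>* \<and> \<eta> $ j > 0))
        \<longrightarrow> emeasure (nu_S star V1 W \<theta> \<eta>) (symm_space star) < \<infinity>)"
proof -
  interpret involution star V1
    using star_involution V_union V_disjoint by unfold_locales auto
  have W0: "\<forall>i j. W $ i $ j \<ge> 0"
    using W_pos W_zero by (metis less_imp_le order_refl)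
  have "W $ i $ j = W $ star j $ star i" for i j
  proof (cases "(i, j) \<in> E")
    case False
    then have "(star j, star i) \<notin> E" using E_star[of "star j" "star i"] by (auto simp: star_involution)
    then show ?thesis using False W_zero by simp
  qed (rule W_star)
  then have Wsym: "star_symmetric (\<lambda>i j. W $ i $ j)" using W0 by (simp add: star_symmetric_def)
  have eq: "emeasure (nu_S star V1 W \<theta> \<eta>) (symm_space star)
           = emeasure (nu_A star V1 W \<theta> \<eta>) (anti_space star)"
    unfolding emeasure_nu_S[OF W0] emeasure_nu_A
    using nn_integral_dens_S_eq_dens_A[of "\<lambda>i. \<theta> $ i" "fixed \<union> V1" "\<lambda>i j. W $ i $ j" "\<lambda>i. \<eta> $ i"]
      theta_pos eta_nonneg Wsym by (simp add: reps_V1)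
  moreover have "emeasure (nu_A star V1 W \<theta> \<eta>) (anti_space star) < top"
    if "\<forall>i. (i, star i) \<in> E\<^sup>* \<or> (\<exists>j. (i, j) \<in> E\<^sup>* \<and> \<eta> $ j > 0)"
    unfolding emeasure_nu_A
    using nn_integral_dens_A_finite[of "\<lambda>i. \<theta> $ i" "\<lambda>i j. W $ i $ j" "\<lambda>i. \<eta> $ i" E] that theta_pos eta_nonneg W0 W_pos
    by (simp add: ennreal_mult_less_top)
  ultimately show ?thesis by simp
qed

end
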